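(* Suppose $(\mathbf{u},\mathbf{B})$ is a smooth axisymmetric self-similar solution in $\mathbb{R}^3\setminus\{0\}$ of the stationary MHD system $$-\Delta \mathbf{u} + (\mathbf{u}\cdot\nabla)\mathbf{u} - (\mathbf{B}\cdot\nabla)\mathbf{B} + \nabla p = 0,\qquad -\Delta \mathbf{B} + (\mathbf{u}\cdot\nabla)\mathbf{B} - (\mathbf{B}\cdot\nabla)\mathbf{u} = 0,\qquad \nabla\cdot\mathbf{u}=\nabla\cdot\mathbf{B}=0,$$ of the form $\mathbf{u}=u^r(r,z)\mathbf{e}_r+u^\theta(r,z)\mathbf{e}_\theta+u^z(r,z)\mathbf{e}_z$ and $\mathbf{B}=B^\theta(r,z)\mathbf{e}_\theta$, where $(r,\theta,z)$ are cylindrical coordinates. If the inequality $u^r(r,z)<\frac{1}{3r}+\frac{2r}{3}$ holds on the unit sphere $\partial B_1=\{x\in\mathbb{R}^3: |x|=1\}$, then $\mathbf{u}$ must be a Landau solution and $\mathbf{B}\equiv 0$.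
   Context: In the system, $\mathbf{u}$ is the fluid velocity, $\mathbf{B}$ the magnetic field and $p$ the scalar pressure. Cylindrical coordinates $(r,\theta,z)$: $(x_1,x_2,x_3)=(r\cos\theta,r\sin\theta,z)$, with $\mathbf{e}_r=(\cos\theta,\sin\theta,0)$, $\mathbf{e}_\theta=(-\sin\theta,\cos\theta,0)$, $\mathbf{e}_z=(0,0,1)$. A vector field $\mathbf{w}$ is axisymmetric if $\mathbf{w}=w^r(r,z)\mathbf{e}_r+w^\theta(r,z)\mathbf{e}_\theta+w^z(r,z)\mathbf{e}_z$. Self-similar: a solution $(\mathbf{u},\mathbf{B},p)$ is self-similar if $\mathbf{u}(x)=\lambda\mathbf{u}(\lambda x)$, $\mathbf{B}(x)=\lambda\mathbf{B}(\lambda x)$, $p(x)=\lambda^2p(\lambda x)$ for any $\lambda>0$. Landau solutions: a function $f$ is $(-k)$-homogeneous if $f(\lambda x)=\lambda^{-k}f(x)$ for all $\lambda>0$. For any $0\ne\mathbf{b}\in\mathbb{R}^3$ there exist a unique $(-1)$-homogeneous $\mathbf{U}^{\mathbf{b}}$ and a corresponding $(-2)$-homogeneous $P^{\mathbf{b}}$ such that $(\mathbf{U}^{\mathbf{b}},P^{\mathbf{b}})$ are smooth in $\mathbb{R}^3\setminus\{0\}$ and solve $-\Delta\mathbf{U}^{\mathbf{b}}+\mathbf{U}^{\mathbf{b}}\cdot\nabla\mathbf{U}^{\mathbf{b}}+\nabla P^{\mathbf{b}}=\mathbf{b}\delta$, $\nabla\cdot\mathbf{U}^{\mathbf{b}}=0$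 in the distributional sense on $\mathbb{R}^3$, where $\delta$ is the Dirac delta function. The fields $\mathbf{U}^{\mathbf{b}}$ are the Landau solutions. When $\mathbf{b}=(0,0,\beta)$ with $\beta>0$, in spherical coordinates $(x_1,x_2,x_3)=(\rho\sin\varphi\cos\theta,\rho\sin\varphi\sin\theta,\rho\cos\varphi)$ with $\mathbf{e}_\rho=x/\rho$, $\mathbf{e}_\theta=(-\sin\theta,\cos\theta,0)$, $\mathbf{e}_\varphi=\mathbf{e}_\theta\times\mathbf{e}_\rho$, they have the explicit form $$\mathbf{U}^{\mathbf{b}}=\frac{2}{\rho}\Big(\frac{a^2-1}{(a-\cos\varphi)^2}-1\Big)\mathbf{e}_\rho-\frac{2\sin\varphi}{\rho(a-\cos\varphi)}\mathbf{e}_\varphi,\qquad P^{\mathbf{b}}=\frac{4(a\cos\varphi-1)}{\rho^2(a-\cos\varphi)^2},$$ where $\beta>0$ and $a>1$ are related by $\beta=16\pi\big(a+\frac12a^2\log\frac{a-1}{a+1}+\frac{4a}{3(a^2-1)}\big)$.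
   Formalization: The conclusion reads "u is a Landau solution or u vanishes identically on R^3 minus the origin", because u = 0, B = 0, p = 0 satisfies all hypotheses while Landau solutions are defined only for nonzero b. *)

theory Defs
  imports "HOL-Analysis.Analysis"
begin

section \<open>Smooth functions on open sets\<close>

text \<open>\<open>Ck_on k S f\<close> and \<open>smooth_on S f\<close> are meant for open \<open>S\<close>: only then does the
  derivative at a point of \<open>S\<close> not depend on values of \<open>f\<close> outside \<open>S\<close>.\<close>

primrec Ck_on ::
  "nat \<Rightarrow> 'a::real_normed_vector set \<Rightarrow> ('a \<Rightarrow> 'b::real_normed_vector) \<Rightarrow> bool" where
  "Ck_on 0 S f \<longleftrightarrow> continuous_on S f"
| "Ck_on (Suc k) S f \<longleftrightarrow>
     (\<forall>x\<in>S. f differentiable (at x)) \<and> (\<forall>v. Ck_on k S (\<lambda>x. frechet_derivative f (at x) v))"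

definition smooth_on :: "'a::real_normed_vector set \<Rightarrow> ('a \<Rightarrow> 'b::real_normed_vector) \<Rightarrow> bool" where
  "smooth_on S f \<longleftrightarrow> (\<forall>k. Ck_on k S f)"

section \<open>Differential operators on three-dimensional space\<close>

definition pderivative :: "3 \<Rightarrow> (real^3 \<Rightarrow> 'b::real_normed_vector) \<Rightarrow> real^3 \<Rightarrow> 'b" where
  "pderivative i f x = frechet_derivative f (at x) (axis i 1)"

definition laplacian :: "(real^3 \<Rightarrow> 'b::real_normed_vector) \<Rightarrow> real^3 \<Rightarrow> 'b" where
  "laplacian f x = (\<Sum>i\<in>UNIV. pderivative i (pderivative i f) x)"

definition gradient :: "(real^3 \<Rightarrow> real) \<Rightarrow> real^3 \<Rightarrow> real^3" where
  "gradient p x = (\<chi> i. pderivative i p x)"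

definition divergence :: "(real^3 \<Rightarrow> real^3) \<Rightarrow> real^3 \<Rightarrow> real" where
  "divergence w x = (\<Sum>i\<in>UNIV. pderivative i (\<lambda>y. w y $ i) x)"

text \<open>\<open>advect v w\<close> is \<open>(v \<cdot> \<nabla>) w\<close>.\<close>

definition advect :: "(real^3 \<Rightarrow> real^3) \<Rightarrow> (real^3 \<Rightarrow> real^3) \<Rightarrow> real^3 \<Rightarrow> real^3" where
  "advect v w x = (\<Sum>j\<in>UNIV. (v x $ j) *\<^sub>R pderivative j w x)"

section \<open>The stationary MHD system\<close>

text \<open>Fields on \<open>\<real>\<^sup>3 \<setminus> {0}\<close> are modelled by total functions; the value at the origin
  is never constrained.\<close>

definition smooth_MHD_solution ::
  "(real^3 \<Rightarrow> real^3) \<Rightarrow> (real^3 \<Rightarrow> real^3) \<Rightarrow> (real^3 \<Rightarrow> real) \<Rightarrow> bool" where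
  "smooth_MHD_solution u B p \<longleftrightarrow>
     smooth_on (- {0}) u \<and> smooth_on (- {0}) B \<and> smooth_on (- {0}) p \<and>
     (\<forall>x. x \<noteq> 0 \<longrightarrow>
        - laplacian u x + advect u u x - advect B B x + gradient p x = 0 \<and>
        - laplacian B x + advect u B x - advect B u x = 0 \<and>
        divergence u x = 0 \<and> divergence B x = 0)"

definition self_similar ::
  "(real^3 \<Rightarrow> real^3) \<Rightarrow> (real^3 \<Rightarrow> real^3) \<Rightarrow> (real^3 \<Rightarrow> real) \<Rightarrow> bool" where
  "self_similar u B p \<longleftrightarrow>
     (\<forall>l>0. \<forall>x. x \<noteq> 0 \<longrightarrow>
        u x = l *\<^sub>R u (l *\<^sub>R x) \<and> B x = l *\<^sub>R B (l *\<^sub>R x) \<and> p x = l\<^sup>2 * p (l *\<^sub>R x))"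

section \<open>Cylindrical coordinates\<close>

definition cyl_point :: "real \<Rightarrow> real \<Rightarrow> real \<Rightarrow> real^3" where
  "cyl_point r t z = vector [r * cos t, r * sin t, z]"

definition e_r :: "real \<Rightarrow> real^3" where
  "e_r t = vector [cos t, sin t, 0]"

definition e_theta :: "real \<Rightarrow> real^3" where
  "e_theta t = vector [- sin t, cos t, 0]"

definition e_z :: "real^3" where
  "e_z = vector [0, 0, 1]"

text \<open>The frame is undefined on the axis \<open>r = 0\<close>, so the representation is required for
  \<open>r > 0\<close>; for fields continuous off the origin this determines the values on the axis.\<close>

definition axisymmetric_form ::
  "(real^3 \<Rightarrow> real^3) \<Rightarrow> (real \<Rightarrow> real \<Rightarrow> real) \<Rightarrow> (real \<Rightarrow> real \<Rightarrow> real) \<Rightarrow> (real \<Rightarrow> real \<Rightarrow> real) \<Rightarrow> bool"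
  where
  "axisymmetric_form w wr wt wz \<longleftrightarrow>
     (\<forall>r>0. \<forall>t z. w (cyl_point r t z) =
        wr r z *\<^sub>R e_r t + wt r z *\<^sub>R e_theta t + wz r z *\<^sub>R e_z)"

section \<open>Landau solutions\<close>

definition neg_homogeneous :: "nat \<Rightarrow> (real^3 \<Rightarrow> 'b::real_normed_vector) \<Rightarrow> bool" where
  "neg_homogeneous k f \<longleftrightarrow>
     (\<forall>l>0. \<forall>x. x \<noteq> 0 \<longrightarrow> f (l *\<^sub>R x) = (1 / l ^ k) *\<^sub>R f x)"

definition test_function :: "(real^3 \<Rightarrow> 'b::real_normed_vector) \<Rightarrow> bool" where
  "test_function \<phi> \<longleftrightarrow> smooth_on UNIV \<phi> \<and> compact (closure {x. \<phi> x \<noteq> 0})"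

text \<open>The distributional system \<open>- \<Delta>U + U \<cdot> \<nabla>U + \<nabla>P = b \<delta>\<close>, \<open>\<nabla> \<cdot> U = 0\<close> on all of \<open>\<real>\<^sup>3\<close>,
  tested against vector fields and scalars. As \<open>U\<close> is divergence free, \<open>U \<cdot> \<nabla>U\<close> is the
  distribution \<open>\<nabla> \<cdot> (U \<otimes> U)\<close>; the pointwise product is only of order \<open>|x|\<^sup>-\<^sup>3\<close> and not locally
  integrable. For the fields in \<open>Landau_field\<close>, all terms of the integrands below are
  integrable: they are of order \<open>|x|\<^sup>-\<^sup>2\<close> at the origin.\<close>

definition distributional_NS ::
  "(real^3 \<Rightarrow> real^3) \<Rightarrow> (real^3 \<Rightarrow> real) \<Rightarrow> real^3 \<Rightarrow> bool" where
  "distributional_NS U P b \<longleftrightarrow>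
     (\<forall>\<phi> :: real^3 \<Rightarrow> real^3. test_function \<phi> \<longrightarrow>
        (LINT x|lborel. - (U x \<bullet> laplacian \<phi> x) - U x \<bullet> advect U \<phi> x - P x * divergence \<phi> x)
          = b \<bullet> \<phi> 0) \<and>
     (\<forall>\<psi> :: real^3 \<Rightarrow> real. test_function \<psi> \<longrightarrow> (LINT x|lborel. U x \<bullet> gradient \<psi> x) = 0)"

definition Landau_field :: "real^3 \<Rightarrow> (real^3 \<Rightarrow> real^3) \<Rightarrow> bool" where
  "Landau_field b U \<longleftrightarrow>
     (\<exists>P. neg_homogeneous 1 U \<and> neg_homogeneous 2 P \<and>
          smooth_on (- {0}) U \<and> smooth_on (- {0}) P \<and> distributional_NS U P b)"

text \<open>The parameter \<open>b\<close> is nonzero, so the zero field (conventionally \<open>U\<^sup>0\<close>) is not a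
  \<open>Landau_solution\<close> here and has to be listed separately where it can occur.\<close>

definition Landau_solution :: "(real^3 \<Rightarrow> real^3) \<Rightarrow> bool" where
  "Landau_solution U \<longleftrightarrow> (\<exists>b. b \<noteq> 0 \<and> Landau_field b U)"

end

theory Submission
  imports Defs
begin

text \<open>Homogeneity and axisymmetry turn the system into ordinary differential equations in the cosine
  \<open>s\<close> of the polar angle. A weighted energy identity for \<open>B\<^sub>\<theta>\<close>, in which the bound on \<open>u\<^sub>r\<close> is exactly
  what makes the quadratic form definite, gives \<open>B = 0\<close>; a maximum principle for the angular momentum
  removes the swirl. The remaining equations integrate to the Riccati equation \<open>b' = b\<^sup>2 / 2\<close> for
  \<open>b = - u\<^sub>\<phi> / sin \<phi>\<close>, whose bounded solutions are \<open>b = 0\<close> and \<open>b = 2 / (c - s)\<close> with \<open>|c| > 1\<close>.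
  Testing the equations against a vector field vanishing at the origin shows that their distributional
  form on the whole space only produces a multiple of \<open>\<delta>\<close>. Its coefficient is nonzero because the
  momentum flux, corrected by a tangential divergence, has the sign of \<open>c\<close>.\<close>

section \<open>Calculus of line derivatives, smoothness and homogeneity\<close>

section \<open>Partial derivatives along coordinate lines\<close>

text \<open>Two degenerate places shape the argument. On the axis the orthonormal spherical frame
  and the variable \<open>s\<close> both break down. The fields are therefore expanded in
  \<open>x\<close>, \<open>e_z\<close>, \<open>e_z \<times> x\<close>, a frame that is not
  orthogonal but polynomial, so that the reduced equations have polynomial coefficients. Regularity
  at the poles is read off in the polar angle, in which the fields are smooth, and enters as
  boundary data: zero boundary values for the angular momentum and the energy, boundedness of
  \<open>b\<close>, a limit of \<open>(1 - s\<^sup>2) * b'\<close>. These data select the constants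
  of integration.

  At the origin the pointwise equations say nothing, while a Landau solution needs a nonzero point
  force. Evaluating that force leads to a logarithm, which working with the sign alone avoids.

  The constants of the hypothesis enter through \<open>r * u\<^sub>r\<close>: with
  \<open>r\<^sup>2 = 1 - s\<^sup>2\<close> on the unit sphere, the bound is
  \<open>(1 - s\<^sup>2) * a < 1 - 2 * s\<^sup>2 / 3\<close>. The alternative \<open>u = 0\<close>
  in the conclusion is the state of rest, which satisfies all hypotheses and exerts no
  force.\<close>

definition has_pd :: "3 \<Rightarrow> (real^3 \<Rightarrow> real) \<Rightarrow> real \<Rightarrow> real^3 \<Rightarrow> bool" where
  "has_pd j f d x \<longleftrightarrow> ((\<lambda>t. f (x + t *\<^sub>R axis j 1)) has_real_derivative d) (at 0)"

lemma has_pd_eqI: "has_pd j f d x \<Longrightarrow> d = e \<Longrightarrow> has_pd j f e x"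
  by simp

lemma has_pd_const: "has_pd j (\<lambda>x. c) 0 x"
  by (simp add: has_pd_def)

lemma has_pd_add: "has_pd j f d x \<Longrightarrow> has_pd j g e x \<Longrightarrow> has_pd j (\<lambda>x. f x + g x) (d + e) x"
  unfolding has_pd_def by (rule DERIV_add)

lemma has_pd_diff: "has_pd j f d x \<Longrightarrow> has_pd j g e x \<Longrightarrow> has_pd j (\<lambda>x. f x - g x) (d - e) x"
  unfolding has_pd_def by (rule DERIV_diff)

lemma has_pd_minus: "has_pd j f d x \<Longrightarrow> has_pd j (\<lambda>x. - f x) (- d) x"
  unfolding has_pd_def by (rule DERIV_minus)

lemma has_pd_mult:
  "has_pd j f d x \<Longrightarrow> has_pd j g e x \<Longrightarrow> has_pd j (\<lambda>x. f x * g x) (d * g x + e * f x) x"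
  unfolding has_pd_def
  using DERIV_mult[of "\<lambda>t. f (x + t *\<^sub>R axis j 1)" d 0 UNIV "\<lambda>t. g (x + t *\<^sub>R axis j 1)" e] by simp

lemma has_pd_sum:
  "(\<And>i. i \<in> I \<Longrightarrow> has_pd j (f i) (d i) x) \<Longrightarrow> has_pd j (\<lambda>x. \<Sum>i\<in>I. f i x) (\<Sum>i\<in>I. d i) x"
  unfolding has_pd_def by (rule DERIV_sum)

lemma has_pd_chain:
  "(g has_real_derivative e) (at (f x)) \<Longrightarrow> has_pd j f d x \<Longrightarrow> has_pd j (\<lambda>x. g (f x)) (e * d) x"
  unfolding has_pd_def by (rule DERIV_chain2[where g = "\<lambda>t. f (x + t *\<^sub>R axis j 1)"]) simp_all

lemma has_pd_coord: "has_pd j (\<lambda>x. x $ i) (if i = j then 1 else 0) x"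
  unfolding has_pd_def by (auto simp: axis_def intro!: derivative_eq_intros)

lemma has_pd_unique: "has_pd j f d x \<Longrightarrow> has_pd j f e x \<Longrightarrow> d = e"
  unfolding has_pd_def by (rule DERIV_unique)

text \<open>The bridge from Frechet derivatives to line derivatives. The converse fails in general,
  which is why \<open>pderivative_eqI\<close> asks for differentiability separately.\<close>

lemma has_pd_differentiable:
  assumes "f differentiable (at x)"
  shows "has_pd j f (pderivative j f x) x"
proof -
  let ?D = "frechet_derivative f (at x)"
  have "(f has_derivative ?D) (at x)"
    using assms frechet_derivative_works by blast
  then have 1: "(f has_derivative ?D) (at (x + 0 *\<^sub>R axis j 1))"
    by simp
  have 2: "((\<lambda>t. x + t *\<^sub>R axis j 1) has_derivative (\<lambda>t. t *\<^sub>R axis j 1)) (at 0)"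
    by (auto intro!: derivative_eq_intros)
  have "((\<lambda>t. f (x + t *\<^sub>R axis j 1)) has_derivative (\<lambda>t. ?D (t *\<^sub>R axis j 1))) (at 0)"
    using has_derivative_compose[OF 2 1] .
  moreover have "(\<lambda>t. ?D (t *\<^sub>R axis j 1)) = (*) (pderivative j f x)"
    using linear_frechet_derivative[OF assms]
    by (auto simp: pderivative_def linear_cmul fun_eq_iff)
  ultimately show ?thesis
    unfolding has_pd_def has_field_derivative_def by simp
qed

lemma has_pd_norm:
  assumes "x \<noteq> 0"
  shows "has_pd j norm (x $ j / norm x) x"
proof -
  have "(norm has_derivative (\<lambda>h. x \<bullet> h / norm x)) (at x)"
    using has_derivative_norm[OF assms] by (simp add: sgn_div_norm inner_commute divide_inverse mult.commute)
  then have d: "norm differentiable (at x)" and "frechet_derivative norm (at x) = (\<lambda>h. x \<bullet> h / norm x)"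
    using frechet_derivative_at[of norm "\<lambda>h. x \<bullet> h / norm x" x] by (auto simp: differentiable_def)
  then have "pderivative j norm x = x $ j / norm x"
    by (simp add: pderivative_def inner_axis)
  then show ?thesis
    using has_pd_differentiable[OF d, of j] by simp
qed

lemma eventually_line_open:
  fixes x :: "real^3"
  assumes "open S" "x \<in> S"
  shows "\<forall>\<^sub>F t in nhds 0. x + t *\<^sub>R axis j 1 \<in> S"
proof -
  have "continuous (at 0) (\<lambda>t::real. x + t *\<^sub>R axis j 1)"
    by (intro continuous_intros)
  then have "((\<lambda>t::real. x + t *\<^sub>R axis j 1) \<longlongrightarrow> x) (nhds 0)"
    by (simp add: isCont_def tendsto_nhds_iff)
  then show ?thesis
    using assms topological_tendstoD by blast
qed

lemma has_pd_cong:
  assumes "open S" "x \<in> S" "\<And>y. y \<in> S \<Longrightarrow> f y = g y"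
  shows "has_pd j f d x \<longleftrightarrow> has_pd j g d x"
  unfolding has_pd_def
  using eventually_mono[OF eventually_line_open[OF assms(1,2)] assms(3)] by (intro DERIV_cong_ev) auto

text \<open>Turns the derivative at parameter 0 into one at every point of a line, the form in which
  the fundamental theorem of calculus can be applied after Fubini.\<close>

lemma has_pd_line:
  "has_pd j f d (x + t *\<^sub>R axis j 1) \<longleftrightarrow>
     ((\<lambda>t. f (x + t *\<^sub>R axis j 1)) has_real_derivative d) (at t)"
  unfolding has_pd_def using DERIV_shift[of "\<lambda>t. f (x + t *\<^sub>R axis j 1)" d 0 t]
  by (simp add: algebra_simps)

lemma pderivative_eqI:
  assumes "open S" "x \<in> S" "\<And>y. y \<in> S \<Longrightarrow> f y = g y" "f differentiable (at x)" "has_pd j g d x"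
  shows "pderivative j f x = d"
proof -
  have "has_pd j f d x"
    using assms(5) by (subst has_pd_cong[OF assms(1-3)]) auto
  then show ?thesis
    using has_pd_unique[OF has_pd_differentiable[OF assms(4)]] by blast
qed

section \<open>Smooth functions\<close>

lemma frechet_derivative_cong_open:
  assumes "open S" "x \<in> S" "\<And>y. y \<in> S \<Longrightarrow> f y = g y"
  shows "frechet_derivative f (at x) = frechet_derivative g (at x)"
proof -
  have "(f has_derivative D) (at x) \<longleftrightarrow> (g has_derivative D) (at x)" for D
    using has_derivative_transform_within_open[OF _ assms(1,2), of f D UNIV g]
      has_derivative_transform_within_open[OF _ assms(1,2), of g D UNIV f] assms(3) by auto
  then show ?thesis
    by (simp add: frechet_derivative_def)
qed

lemma differentiable_cong_open:
  assumes "open S" "x \<in> S" "\<And>y. y \<in> S \<Longrightarrow> f y = g y" "f differentiable (at x)"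
  shows "g differentiable (at x)"
  using assms has_derivative_transform_within_open[OF _ assms(1,2), of f _ UNIV g]
  by (auto simp: differentiable_def)

lemma Ck_on_cong:
  assumes "open S" "\<And>y. y \<in> S \<Longrightarrow> f y = g y" "Ck_on k S f"
  shows "Ck_on k S g"
  using assms(2,3)
proof (induction k arbitrary: f g)
  case 0
  then show ?case using continuous_on_cong[of S S f g] by simp
next
  case (Suc k)
  show ?case
  proof (simp, intro conjI ballI allI)
    fix x assume "x \<in> S"
    then show "g differentiable (at x)"
      using differentiable_cong_open[OF assms(1) _ Suc.prems(1)] Suc.prems(2) by simp
  next
    fix v
    show "Ck_on k S (\<lambda>x. frechet_derivative g (at x) v)"
    proof (rule Suc.IH)
      show "frechet_derivative f (at y) v = frechet_derivative g (at y) v" if "y \<in> S" for y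
        using frechet_derivative_cong_open[OF assms(1) that Suc.prems(1)] by simp
      show "Ck_on k S (\<lambda>x. frechet_derivative f (at x) v)"
        using Suc.prems(2) by simp
    qed
  qed
qed

text \<open>Needed for products: the Leibniz rule leaves undifferentiated factors, which must be
  available one order lower.\<close>

lemma Ck_on_SucD: "Ck_on (Suc k) S f \<Longrightarrow> Ck_on k S f"
proof (induction k arbitrary: f)
  case 0
  then show ?case
    by (simp add: continuous_at_imp_continuous_on differentiable_imp_continuous_within)
next
  case (Suc k)
  have "(\<forall>x\<in>S. f differentiable (at x)) \<and>
      (\<forall>v. Ck_on (Suc k) S (\<lambda>x. frechet_derivative f (at x) v))"
    using Suc.prems by (rule iffD1[OF Ck_on.simps(2)])
  then show ?case
    using Suc.IH by (intro iffD2[OF Ck_on.simps(2)]) blast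
qed

lemma Ck_on_linear:
  assumes "open S" "bounded_linear L" "Ck_on k S f"
  shows "Ck_on k S (\<lambda>x. L (f x))"
  using assms(3)
proof (induction k arbitrary: f)
  case 0
  then show ?case by (simp add: bounded_linear.continuous_on[OF assms(2)])
next
  case (Suc k)
  have D: "((\<lambda>x. L (f x)) has_derivative (\<lambda>v. L (frechet_derivative f (at x) v))) (at x)"
    if "x \<in> S" for x
    using Suc.prems that frechet_derivative_works
    by (intro bounded_linear.has_derivative[OF assms(2)]) auto
  have "Ck_on k S (\<lambda>x. frechet_derivative (\<lambda>x. L (f x)) (at x) v)" for v
  proof (rule Ck_on_cong[OF assms(1)])
    show "Ck_on k S (\<lambda>x. L (frechet_derivative f (at x) v))"
      using Suc by auto
    show "L (frechet_derivative f (at y) v) = frechet_derivative (\<lambda>x. L (f x)) (at y) v"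
      if "y \<in> S" for y
      using fun_cong[OF frechet_derivative_at[OF D[OF that]]] .
  qed
  then show ?case using D by (auto simp: differentiable_def)
qed

lemma Ck_on_add:
  assumes "open S" "Ck_on k S f" "Ck_on k S g"
  shows "Ck_on k S (\<lambda>x. f x + g x)"
  using assms(2,3)
proof (induction k arbitrary: f g)
  case 0
  then show ?case by (simp add: continuous_on_add)
next
  case (Suc k)
  have D: "((\<lambda>x. f x + g x) has_derivative
      (\<lambda>v. frechet_derivative f (at x) v + frechet_derivative g (at x) v)) (at x)" if "x \<in> S" for x
    using Suc.prems that frechet_derivative_works by (intro has_derivative_add) auto
  have "Ck_on k S (\<lambda>x. frechet_derivative (\<lambda>x. f x + g x) (at x) v)" for v
  proof (rule Ck_on_cong[OF assms(1)])
    show "Ck_on k S (\<lambda>x. frechet_derivative f (at x) v + frechet_derivative g (at x) v)"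
      using Suc by auto
    show "frechet_derivative f (at y) v + frechet_derivative g (at y) v
        = frechet_derivative (\<lambda>x. f x + g x) (at y) v" if "y \<in> S" for y
      using fun_cong[OF frechet_derivative_at[OF D[OF that]]] .
  qed
  then show ?case using D by (auto simp: differentiable_def)
qed

lemma Ck_on_mult:
  fixes f g :: "'a::real_normed_vector \<Rightarrow> real"
  assumes "open S" "Ck_on k S f" "Ck_on k S g"
  shows "Ck_on k S (\<lambda>x. f x * g x)"
  using assms(2,3)
proof (induction k arbitrary: f g)
  case 0
  then show ?case by (simp add: continuous_on_mult)
next
  case (Suc k)
  have D: "((\<lambda>x. f x * g x) has_derivative
      (\<lambda>v. f x * frechet_derivative g (at x) v + frechet_derivative f (at x) v * g x)) (at x)"
    if "x \<in> S" for x
    using Suc.prems that frechet_derivative_works by (intro has_derivative_mult) auto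
  have "Ck_on k S (\<lambda>x. frechet_derivative (\<lambda>x. f x * g x) (at x) v)" for v
  proof (rule Ck_on_cong[OF assms(1)])
    show "Ck_on k S (\<lambda>x. f x * frechet_derivative g (at x) v + frechet_derivative f (at x) v * g x)"
      using Suc.prems Ck_on_SucD[OF Suc.prems(1)] Ck_on_SucD[OF Suc.prems(2)]
      by (intro Ck_on_add[OF assms(1)] Suc.IH) auto
    show "f y * frechet_derivative g (at y) v + frechet_derivative f (at y) v * g y
        = frechet_derivative (\<lambda>x. f x * g x) (at y) v" if "y \<in> S" for y
      using fun_cong[OF frechet_derivative_at[OF D[OF that]]] .
  qed
  then show ?case using D by (auto simp: differentiable_def)
qed

lemma Ck_on_const: "Ck_on k S (\<lambda>x. c)"
  by (induction k arbitrary: c) auto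

lemma Ck_on_coord: "open S \<Longrightarrow> Ck_on k S (\<lambda>x :: real^3. x $ i)"
proof (cases k)
  case (Suc k')
  have D: "((\<lambda>x :: real^3. x $ i) has_derivative (\<lambda>v. v $ i)) (at x)" for x
    by (rule bounded_linear_imp_has_derivative) (rule bounded_linear_vec_nth)
  have "frechet_derivative (\<lambda>x :: real^3. x $ i) (at x) = (\<lambda>v. v $ i)" for x
    using frechet_derivative_at[OF D] by (rule sym)
  then show ?thesis
    using Suc Ck_on_const[of k' S] D by (simp add: differentiable_def) blast
qed (simp add: continuous_on_component)

lemma smooth_on_diff: "smooth_on S f \<Longrightarrow> x \<in> S \<Longrightarrow> f differentiable (at x)"
  unfolding smooth_on_def using Ck_on.simps(2) by blast

lemma smooth_on_continuous: "smooth_on S f \<Longrightarrow> continuous_on S f"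
  unfolding smooth_on_def using Ck_on.simps(1) by blast

lemma smooth_on_pderivative: "smooth_on S f \<Longrightarrow> smooth_on S (pderivative j f)"
  unfolding smooth_on_def pderivative_def using Ck_on.simps(2) by blast

lemma smooth_on_component:
  fixes f :: "'a::real_normed_vector \<Rightarrow> real^3"
  shows "open S \<Longrightarrow> smooth_on S f \<Longrightarrow> smooth_on S (\<lambda>x. f x $ i)"
  unfolding smooth_on_def using Ck_on_linear[OF _ bounded_linear_vec_nth] by blast

lemma smooth_on_has_pd: "smooth_on S f \<Longrightarrow> x \<in> S \<Longrightarrow> has_pd j f (pderivative j f x) x"
  using has_pd_differentiable smooth_on_diff by blast

lemma pderivative_component:
  fixes f :: "real^3 \<Rightarrow> real^3"
  assumes "f differentiable (at x)"
  shows "pderivative j f x $ i = pderivative j (\<lambda>y. f y $ i) x"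
proof -
  have "(f has_derivative frechet_derivative f (at x)) (at x)"
    using assms frechet_derivative_works by blast
  then have "((\<lambda>y. f y $ i) has_derivative (\<lambda>v. frechet_derivative f (at x) v $ i)) (at x)"
    by (rule bounded_linear.has_derivative[OF bounded_linear_vec_nth])
  then have "frechet_derivative (\<lambda>y. f y $ i) (at x) = (\<lambda>v. frechet_derivative f (at x) v $ i)"
    by (rule frechet_derivative_at[symmetric])
  then show ?thesis by (simp add: pderivative_def)
qed

lemma laplacian_component:
  fixes f :: "real^3 \<Rightarrow> real^3"
  assumes "open S" "smooth_on S f" "x \<in> S"
  shows "laplacian f x $ i = laplacian (\<lambda>y. f y $ i) x"
proof -
  have "pderivative j (pderivative j f) x $ i = pderivative j (pderivative j (\<lambda>y. f y $ i)) x" for j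
  proof -
    have "pderivative j (pderivative j f) x $ i = pderivative j (\<lambda>y. pderivative j f y $ i) x"
      using smooth_on_diff[OF smooth_on_pderivative[OF assms(2)] assms(3)] pderivative_component by blast
    also have "\<dots> = pderivative j (pderivative j (\<lambda>y. f y $ i)) x"
      using frechet_derivative_cong_open[OF assms(1,3), of "\<lambda>y. pderivative j f y $ i" "pderivative j (\<lambda>y. f y $ i)"]
        pderivative_component[OF smooth_on_diff[OF assms(2)]]
      by (simp add: pderivative_def)
    finally show ?thesis .
  qed
  then show ?thesis by (simp add: laplacian_def)
qed

lemma advect_component:
  fixes w :: "real^3 \<Rightarrow> real^3"
  assumes "w differentiable (at x)"
  shows "advect v w x $ i = (\<Sum>j\<in>UNIV. v x $ j * pderivative j (\<lambda>y. w y $ i) x)"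
  by (simp add: advect_def pderivative_component[OF assms])

section \<open>Homogeneous functions\<close>

definition homog :: "nat \<Rightarrow> (real^3 \<Rightarrow> real) \<Rightarrow> bool" where
  "homog k f \<longleftrightarrow> (\<forall>l>0. \<forall>x. x \<noteq> 0 \<longrightarrow> f (l *\<^sub>R x) = f x / l ^ k)"

lemma homog_bound:
  assumes "homog k f" "continuous_on (- {0}) f"
  obtains C where "C > 0" "\<And>x. x \<noteq> 0 \<Longrightarrow> \<bar>f x\<bar> \<le> C / norm x ^ k"
proof -
  have "compact (f ` sphere 0 1)"
    by (rule compact_continuous_image[OF continuous_on_subset[OF assms(2)]]) auto
  then obtain C where C: "C > 0" "\<And>x. norm x = 1 \<Longrightarrow> \<bar>f x\<bar> \<le> C"
    using compact_imp_bounded[of "f ` sphere 0 1"] by (auto simp: bounded_pos)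
  have "\<bar>f x\<bar> \<le> C / norm x ^ k" if "x \<noteq> 0" for x
  proof -
    have "norm x > 0" "(1 / norm x) *\<^sub>R x \<noteq> 0"
      using that by auto
    then have "f (norm x *\<^sub>R ((1 / norm x) *\<^sub>R x)) = f ((1 / norm x) *\<^sub>R x) / norm x ^ k"
      using assms(1) unfolding homog_def by blast
    then have "\<bar>f x\<bar> = \<bar>f ((1 / norm x) *\<^sub>R x)\<bar> / norm x ^ k"
      using that by simp
    also have "\<dots> \<le> C / norm x ^ k"
      using that by (intro divide_right_mono C(2)) auto
    finally show ?thesis .
  qed
  with C that show thesis by blast
qed

text \<open>Differentiating \<open>f (l *\<^sub>R y) = f y / l ^ k\<close> in \<open>y\<close>, the
  chain rule puts one more factor \<open>l\<close> on the left.\<close>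

lemma homog_pderivative:
  assumes "homog k f" "\<And>x. x \<noteq> 0 \<Longrightarrow> f differentiable (at x)"
  shows "homog (Suc k) (pderivative j f)"
  unfolding homog_def
proof (intro allI impI)
  fix l :: real and x :: "real^3" assume l: "l > 0" and x: "x \<noteq> 0"
  have lx: "l *\<^sub>R x \<noteq> 0" using l x by simp
  have "has_pd j f (pderivative j f (l *\<^sub>R x)) (l *\<^sub>R x)"
    using has_pd_differentiable assms(2) lx by blast
  then have "((\<lambda>t. f (l *\<^sub>R x + t *\<^sub>R axis j 1)) has_real_derivative pderivative j f (l *\<^sub>R x)) (at (l * 0))"
    by (simp add: has_pd_def)
  then have "((\<lambda>t. f (l *\<^sub>R x + (l * t) *\<^sub>R axis j 1)) has_real_derivative pderivative j f (l *\<^sub>R x) * l) (at 0)"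
    by (rule DERIV_chain2) (auto intro!: derivative_eq_intros)
  then have "has_pd j (\<lambda>y. f (l *\<^sub>R y)) (pderivative j f (l *\<^sub>R x) * l) x"
    by (simp add: has_pd_def algebra_simps)
  then have "has_pd j (\<lambda>y. f y / l ^ k) (pderivative j f (l *\<^sub>R x) * l) x"
    using has_pd_cong[of "- {0}" x "\<lambda>y. f (l *\<^sub>R y)" "\<lambda>y. f y / l ^ k"] assms(1) l x
    by (auto simp: homog_def)
  moreover have "has_pd j (\<lambda>y. f y / l ^ k) (pderivative j f x / l ^ k) x"
    using has_pd_mult[OF has_pd_differentiable[OF assms(2)[OF x]] has_pd_const[of j "1 / l ^ k"]] by simp
  ultimately have "pderivative j f (l *\<^sub>R x) * l = pderivative j f x / l ^ k"
    by (rule has_pd_unique)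
  then show "pderivative j f (l *\<^sub>R x) = pderivative j f x / l ^ Suc k"
    using l by (simp add: field_simps)
qed

section \<open>Integration across the origin and the distributional equations\<close>

section \<open>Integration of coordinate derivatives with an integrable singularity\<close>

lemma borel_measurable_off_origin:
  fixes f :: "real^3 \<Rightarrow> real"
  assumes "continuous_on (- {0}) f"
  shows "f \<in> borel_measurable borel"
proof -
  have "(\<lambda>x. if x \<in> - {0} then f x else f 0) \<in> borel_measurable borel"
    using assms by (intro borel_measurable_continuous_on_if) auto
  moreover have "(\<lambda>x. if x \<in> - {0} then f x else f 0) = f" by auto
  ultimately show ?thesis by simp
qed

lemma nn_integral_abs_powr_finite:
  "(\<integral>\<^sup>+t. ennreal (indicator {-R..R} t * \<bar>t\<bar> powr (-2/3)) \<partial>lborel) < \<infinity>"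
proof -
  \<comment> \<open>For negative \<open>R\<close> the interval is empty, but the integral of the
    power still needs a nonnegative endpoint.\<close>
  define c where "c = max R 0"
  have "((\<lambda>t::real. t powr (-2/3)) has_integral (c powr (-2/3+1) / (-2/3+1))) {0..c}"
    by (rule has_integral_powr_from_0) (auto simp: c_def)
  then have "(\<lambda>t::real. t powr (-2/3)) absolutely_integrable_on {0..c}"
    by (intro nonnegative_absolutely_integrable_1) (auto simp: integrable_on_def)
  then have i1: "integrable lborel (\<lambda>t::real. indicator {0..c} t * t powr (-2/3))"
    unfolding set_integrable_def by (subst (asm) integrable_completion) simp_all
  have i2: "integrable lborel (\<lambda>t::real. indicator {0..c} (- t) * (- t) powr (-2/3))"
    using lborel_integrable_real_affine[OF i1, of "-1" 0] by simp
  define h where "h = (\<lambda>t::real. indicator {0..c} t * t powr (-2/3) + indicator {0..c} (- t) * (- t) powr (-2/3) :: real)"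
  have "integrable lborel h"
    unfolding h_def by (rule Bochner_Integration.integrable_add[OF i1 i2])
  then have fin: "(\<integral>\<^sup>+t. ennreal (norm (h t)) \<partial>lborel) < \<infinity>"
    by (simp only: integrable_iff_bounded)
  have "indicator {-R..R} t * \<bar>t\<bar> powr (-2/3) \<le> norm (h t)" for t :: real
  proof (cases "t > 0")
    case True
    then show ?thesis by (simp add: h_def c_def indicator_def)
  next
    case False
    then show ?thesis by (cases "t = 0") (simp_all add: h_def c_def indicator_def)
  qed
  then have "(\<integral>\<^sup>+t. ennreal (indicator {-R..R} t * \<bar>t\<bar> powr (-2/3)) \<partial>lborel)
    \<le> (\<integral>\<^sup>+t. ennreal (norm (h t)) \<partial>lborel)"
    by (intro nn_integral_mono ennreal_leI)
  then show ?thesis using fin by (rule le_less_trans)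
qed

text \<open>The function \<open>1 / norm x ^ 2\<close> is a product of three factors
  \<open>norm x powr (-2/3)\<close>, one per axis. The exponent is negative, so replacing the norm
  by the modulus of one coordinate only increases each factor. The bound is then a product of
  one-dimensional integrals, finite because the exponent exceeds -1. Points with a vanishing
  coordinate form a null set.\<close>

lemma integrable_inverse_square_singularity:
  fixes D :: "real^3 \<Rightarrow> real"
  assumes meas: "D \<in> borel_measurable borel"
    and bound: "\<And>x. x \<noteq> 0 \<Longrightarrow> \<bar>D x\<bar> \<le> C / norm x ^ 2"
    and supp: "\<And>x. norm x > R \<Longrightarrow> D x = 0"
  shows "integrable lborel D"
proof -
  define f where "f = (\<lambda>(b::real^3) t. indicator {-R..R} t * \<bar>t\<bar> powr (-2/3::real))"
  have C: "C \<ge> 0"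
    using bound[of "axis 1 1"] abs_ge_zero[of "D (axis 1 1)"] by (simp del: abs_ge_zero)
  have "(\<integral>\<^sup>+x. (\<Prod>b\<in>Basis. ennreal (f b ((x :: real^3) \<bullet> b))) \<partial>lborel) = (\<Prod>b\<in>(Basis :: (real^3) set). (\<integral>\<^sup>+t. ennreal (f b t) \<partial>lborel))"
    by (rule nn_integral_lborel_prod) (auto simp: f_def)
  also have "\<dots> < \<infinity>"
    using nn_integral_abs_powr_finite[of R] unfolding f_def
    by (simp add: power_less_top_ennreal)
  finally have fin: "(\<integral>\<^sup>+x. (\<Prod>b\<in>Basis. ennreal (f b ((x :: real^3) \<bullet> b))) \<partial>lborel) < \<infinity>" .
  have ae: "AE x :: real^3 in lborel. \<forall>b\<in>Basis. x \<bullet> b \<noteq> 0"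
    by (rule AE_finite_allI[OF finite_Basis]) (rule AE_lborel_inner_neq)
  have "(\<integral>\<^sup>+x. ennreal (norm (D x)) \<partial>lborel) \<le> (\<integral>\<^sup>+x. ennreal C * (\<Prod>b\<in>Basis. ennreal (f b (x \<bullet> b))) \<partial>lborel)"
  proof (rule nn_integral_mono_AE, rule AE_mp[OF ae], rule AE_I2, rule impI)
    fix x :: "real^3" assume ne: "\<forall>b\<in>Basis. x \<bullet> b \<noteq> 0"
    then have x: "x \<noteq> 0" using nonempty_Basis by fastforce
    show "ennreal (norm (D x)) \<le> ennreal C * (\<Prod>b\<in>Basis. ennreal (f b (x \<bullet> b)))"
    proof (cases "norm x > R")
      case True
      then show ?thesis by (simp add: supp)
    next
      case False
      have le: "\<bar>x \<bullet> b\<bar> \<le> norm x" if "b \<in> Basis" for b using Basis_le_norm[OF that] .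
      have "norm x powr (-2/3) \<le> f b (x \<bullet> b)" if b: "b \<in> Basis" for b
      proof -
        have "x \<bullet> b \<in> {-R..R}" using le[OF b] False by auto
        moreover have "norm x powr (-2/3) \<le> \<bar>x \<bullet> b\<bar> powr (-2/3)"
          using le[OF b] ne b by (intro powr_mono2') auto
        ultimately show ?thesis by (simp add: f_def)
      qed
      then have "(\<Prod>b\<in>(Basis :: (real^3) set). norm x powr (-2/3)) \<le> (\<Prod>b\<in>Basis. f b (x \<bullet> b))"
        by (intro prod_mono) auto
      moreover have "(\<Prod>b\<in>(Basis :: (real^3) set). norm x powr (-2/3)) = 1 / norm x ^ 2"
      proof -
        have "(norm x powr (-2/3)) ^ 3 = norm x powr (- 2)"
          using x by (subst powr_power) simp_all
        also have "\<dots> = 1 / norm x ^ 2"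
          using x by (subst powr_minus_divide) (simp add: powr_numeral)
        finally show ?thesis by simp
      qed
      ultimately have "C / norm x ^ 2 \<le> C * (\<Prod>b\<in>Basis. f b (x \<bullet> b))"
        using mult_left_mono[OF _ C] by fastforce
      then have "ennreal (norm (D x)) \<le> ennreal (C * (\<Prod>b\<in>Basis. f b (x \<bullet> b)))"
        using bound[OF x] by (intro ennreal_leI) simp
      also have "\<dots> = ennreal C * (\<Prod>b\<in>Basis. ennreal (f b (x \<bullet> b)))"
      proof -
        have "f b t \<ge> 0" for b t by (simp add: f_def)
        then show ?thesis using C by (simp add: ennreal_mult prod_ennreal prod_nonneg)
      qed
      finally show ?thesis .
    qed
  qed
  also have "\<dots> = ennreal C * (\<integral>\<^sup>+x. (\<Prod>b\<in>Basis. ennreal (f b (x \<bullet> b))) \<partial>lborel)"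
    by (intro nn_integral_cmult) (auto simp: f_def)
  also have "\<dots> < \<infinity>" using fin by (simp add: ennreal_mult_less_top)
  finally show ?thesis using meas by (simp add: integrable_iff_bounded)
qed

lemma integral_derivative_compact_support:
  fixes g g' :: "real \<Rightarrow> real"
  assumes der: "\<And>t. (g has_real_derivative g' t) (at t)"
    and cont: "continuous_on UNIV g'"
    and supp: "\<And>t. \<bar>t\<bar> > R \<Longrightarrow> g t = 0" and "R \<ge> 0"
  shows "(LINT t|lborel. g' t) = 0"
proof -
  have z: "g' t = 0" if "\<bar>t\<bar> > R" for t
  proof -
    have "open {t. \<bar>t\<bar> > R}" by (intro open_Collect_less continuous_intros)
    then have "((\<lambda>_. 0) has_real_derivative g' t) (at t)"
      using DERIV_cong_ev[of t t g "\<lambda>_. 0" "g' t"] der supp that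
      by (auto simp: eventually_nhds intro!: exI[of _ "{t. \<bar>t\<bar> > R}"])
    then show ?thesis using DERIV_unique DERIV_const by blast
  qed
  \<comment> \<open>The function \<open>g\<close> is known to vanish only for
    \<open>\<bar>t\<bar> > R\<close>, hence the endpoints \<open>R + 1\<close> and
    \<open>- (R + 1)\<close> rather than \<open>R\<close> and \<open>- R\<close>.\<close>
  have "g' t = g' t * indicator {-(R+1)..R+1} t" for t
    using z[of t] by (cases "\<bar>t\<bar> > R") (auto simp: indicator_def)
  then have "(LINT t|lborel. g' t) = (LINT t|lborel. g' t * indicator {-(R+1)..R+1} t)"
    by (rule Bochner_Integration.integral_cong[OF refl])
  also have "\<dots> = g (R+1) - g (-(R+1))"
    using \<open>R \<ge> 0\<close> der cont by (intro integral_FTC_Icc_real) (auto simp: continuous_on_eq_continuous_at)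
  also have "\<dots> = 0" using supp \<open>R \<ge> 0\<close> by simp
  finally show ?thesis .
qed

text \<open>By Fubini it suffices to integrate along the lines parallel to the \<open>j\<close>-th axis, and
  almost every such line misses the origin.\<close>

lemma integral_pd_zero:
  fixes W D :: "real^3 \<Rightarrow> real"
  assumes int: "integrable lborel D"
    and der: "\<And>x. x \<noteq> 0 \<Longrightarrow> has_pd j W (D x) x"
    and cont: "continuous_on (- {0}) D"
    and supp: "\<And>x. norm x > R \<Longrightarrow> W x = 0"
  shows "(LINT x|lborel. D x) = 0"
proof -
  interpret product_sigma_finite "\<lambda>_::real^3. lborel :: real measure" by standard
  define e :: "real^3" where "e = axis j 1"
  define I where "I = (Basis :: (real^3) set) - {e}"
  have eB: "e \<in> Basis" by (simp add: e_def axis_in_Basis_iff)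
  have ins: "insert e I = Basis" and I: "finite I" "e \<notin> I" using eB by (auto simp: I_def)
  \<comment> \<open>The dimension matters here: in dimension one the only line passes through the
    origin. With another coordinate left, the lines through the origin form a null set.\<close>
  have neI: "I \<noteq> {}"
  proof
    assume "I = {}"
    then have "card (Basis :: (real^3) set) \<le> 1" unfolding I_def using card_mono[of "{e}" Basis] by auto
    then show False by simp
  qed
  interpret fin: finite_product_sigma_finite "\<lambda>_::real^3. lborel :: real measure" I
    by standard (rule I)
  let ?T = "\<lambda>f. \<Sum>b\<in>Basis. f b *\<^sub>R (b :: real^3)"
  have T: "?T \<in> (\<Pi>\<^sub>M b\<in>Basis. lborel) \<rightarrow>\<^sub>M borel" by measurable
  have D: "D \<in> borel_measurable borel" using int by auto
  have iT: "integrable (\<Pi>\<^sub>M b\<in>Basis. lborel) (\<lambda>f. D (?T f))"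
    using int D by (subst (asm) lborel_eq) (simp add: integrable_distr_eq[OF T])
  have inner: "(LINT y|lborel. D (?T (f(e := y)))) = 0" if f: "b \<in> I" "f b \<noteq> 0" for f b
  proof -
    define v where "v = (\<Sum>b\<in>I. f b *\<^sub>R b)"
    have Tv: "?T (f(e := y)) = v + y *\<^sub>R e" for y
    proof -
      have "?T (f(e := y)) = y *\<^sub>R e + (\<Sum>b\<in>I. (f(e := y)) b *\<^sub>R b)"
        using I by (simp add: ins[symmetric])
      also have "(\<Sum>b\<in>I. (f(e := y)) b *\<^sub>R b) = v"
        unfolding v_def using I by (intro sum.cong) auto
      finally show ?thesis by simp
    qed
    have nz: "v + y *\<^sub>R e \<noteq> 0" for y
    proof -
      have b: "b \<in> Basis" "b \<noteq> e" using f by (auto simp: I_def)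
      have "?T (f(e := y)) \<bullet> b = f b"
        using b by (subst inner_sum_left_Basis) simp_all
      then show ?thesis using f Tv[of y] by force
    qed
    have "(LINT y|lborel. D (v + y *\<^sub>R e)) = 0"
    proof (rule integral_derivative_compact_support)
      show "((\<lambda>y. W (v + y *\<^sub>R e)) has_real_derivative D (v + t *\<^sub>R e)) (at t)" for t
        using der[OF nz[of t]] unfolding e_def by (simp add: has_pd_line)
      show "continuous_on UNIV (\<lambda>y. D (v + y *\<^sub>R e))"
        by (rule continuous_on_compose2[OF cont]) (use nz in \<open>auto intro!: continuous_intros\<close>)
      show "W (v + t *\<^sub>R e) = 0" if "\<bar>t\<bar> > \<bar>R\<bar> + norm v" for t
      proof (rule supp)
        have "norm (t *\<^sub>R e) \<le> norm (v + t *\<^sub>R e) + norm v"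
          using norm_triangle_ineq4[of "v + t *\<^sub>R e" v] by simp
        moreover have "norm (t *\<^sub>R e) = \<bar>t\<bar>" by (simp add: e_def)
        ultimately show "norm (v + t *\<^sub>R e) > R" using that by linarith
      qed
    qed simp
    then show ?thesis by (simp only: Tv)
  qed
  have ae: "AE f in (\<Pi>\<^sub>M b\<in>I. lborel). \<exists>b\<in>I. f b \<noteq> (0::real)"
  proof -
    have "emeasure (\<Pi>\<^sub>M b\<in>I. lborel) (\<Pi>\<^sub>E b\<in>I. {0::real}) = (\<Prod>b\<in>I. emeasure lborel {0::real})"
      by (rule fin.measure_times) auto
    also have "\<dots> = 0" using neI I by (simp add: card_gt_0_iff)
    finally have "(\<Pi>\<^sub>E b\<in>I. {0::real}) \<in> null_sets (\<Pi>\<^sub>M b\<in>I. lborel)"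
      using I(1) by (intro null_setsI sets_PiM_I_finite) simp_all
    then show ?thesis
    proof (rule AE_I', intro subsetI)
      fix f assume "f \<in> {f \<in> space (\<Pi>\<^sub>M b\<in>I. lborel). \<not> (\<exists>b\<in>I. f b \<noteq> (0::real))}"
      then show "f \<in> (\<Pi>\<^sub>E b\<in>I. {0})"
        by (simp only: space_PiM PiE_iff mem_Collect_eq) blast
    qed
  qed
  have "(LINT x|lborel. D x) = (LINT f|(\<Pi>\<^sub>M b\<in>Basis. lborel). D (?T f))"
    by (subst lborel_eq) (rule integral_distr[OF T D])
  also have "\<dots> = (LINT f|(\<Pi>\<^sub>M b\<in>I. lborel). LINT y|lborel. D (?T (f(e := y))))"
    using product_integral_insert[OF I, of "\<lambda>f. D (?T f)"] iT by (simp only: ins)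
  also have "\<dots> = 0"
    by (rule integral_eq_zero_AE, rule AE_mp[OF ae], rule AE_I2) (use inner in blast)
  finally show ?thesis .
qed

section \<open>Functions of prescribed order at the origin\<close>

text \<open>The bound is required on the whole punctured space, not only near the origin.
  Homogeneous functions satisfy such a bound, and exponents simply add under products; the price is
  that lowering the exponent, as in \<open>order_at_0_mono\<close>, uses bounded support.\<close>

definition order_at_0 :: "int \<Rightarrow> (real^3 \<Rightarrow> real) \<Rightarrow> bool" where
  "order_at_0 k f \<longleftrightarrow>
     continuous_on (- {0}) f \<and> (\<exists>C. \<forall>x. x \<noteq> 0 \<longrightarrow> \<bar>f x\<bar> \<le> C * norm x powi k)"

lemma order_at_0_add: "order_at_0 k f \<Longrightarrow> order_at_0 k g \<Longrightarrow> order_at_0 k (\<lambda>x. f x + g x)"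
  unfolding order_at_0_def
proof (elim conjE exE, intro conjI exI allI impI)
  fix C D :: real and x :: "real^3"
  assume "\<forall>x. x \<noteq> 0 \<longrightarrow> \<bar>f x\<bar> \<le> C * norm x powi k" "\<forall>x. x \<noteq> 0 \<longrightarrow> \<bar>g x\<bar> \<le> D * norm x powi k" "x \<noteq> 0"
  then have "\<bar>f x\<bar> \<le> C * norm x powi k" "\<bar>g x\<bar> \<le> D * norm x powi k" by blast+
  then show "\<bar>f x + g x\<bar> \<le> (C + D) * norm x powi k"
    using abs_triangle_ineq[of "f x" "g x"] unfolding distrib_right by linarith
qed (intro continuous_intros)

lemma order_at_0_mult:
  assumes "order_at_0 k f" "order_at_0 l g"
  shows "order_at_0 (k + l) (\<lambda>x. f x * g x)"
proof -
  obtain C D where C: "\<And>x. x \<noteq> 0 \<Longrightarrow> \<bar>f x\<bar> \<le> C * norm x powi k"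
    and D: "\<And>x. x \<noteq> 0 \<Longrightarrow> \<bar>g x\<bar> \<le> D * norm x powi l"
    using assms unfolding order_at_0_def by blast
  have "\<bar>f x * g x\<bar> \<le> (C * D) * norm x powi (k + l)" if "x \<noteq> 0" for x
  proof -
    have "\<bar>f x * g x\<bar> \<le> (C * norm x powi k) * (D * norm x powi l)"
      unfolding abs_mult using C[OF that] D[OF that] abs_ge_zero[of "f x"]
      by (intro mult_mono) (auto intro: order_trans[OF abs_ge_zero])
    then show ?thesis using that by (simp add: power_int_add mult_ac)
  qed
  then show ?thesis using assms unfolding order_at_0_def
    by (auto intro!: continuous_on_mult exI[of _ "C * D"])
qed

lemma order_at_0_minus: "order_at_0 k f \<Longrightarrow> order_at_0 k (\<lambda>x. - f x)"
  unfolding order_at_0_def by (simp add: continuous_on_minus)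

lemma order_at_0_diff: "order_at_0 k f \<Longrightarrow> order_at_0 k g \<Longrightarrow> order_at_0 k (\<lambda>x. f x - g x)"
  using order_at_0_add[OF _ order_at_0_minus, of k f g] by simp

lemma order_at_0_sum:
  "finite I \<Longrightarrow> (\<And>i. i \<in> I \<Longrightarrow> order_at_0 k (f i)) \<Longrightarrow> order_at_0 k (\<lambda>x. \<Sum>i\<in>I. f i x)"
proof (induction I rule: finite_induct)
  case empty
  show ?case by (auto simp: order_at_0_def intro!: exI[of _ 0])
next
  case (insert i I)
  then show ?case by (simp add: order_at_0_add)
qed

lemma order_at_0_const_mult: "order_at_0 k f \<Longrightarrow> order_at_0 k (\<lambda>x. c * f x)"
  using order_at_0_mult[of 0 "\<lambda>_. c" k f] by (auto simp: order_at_0_def)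

lemma order_at_0_mult':
  "order_at_0 k f \<Longrightarrow> order_at_0 l g \<Longrightarrow> m = k + l \<Longrightarrow> order_at_0 m (\<lambda>x. f x * g x)"
  using order_at_0_mult by blast

lemma order_at_0_mono:
  assumes "order_at_0 k f" "\<And>x. norm x > R \<Longrightarrow> f x = 0" "l \<le> k"
  shows "order_at_0 l f"
proof -
  obtain C where C: "\<And>x. x \<noteq> 0 \<Longrightarrow> \<bar>f x\<bar> \<le> C * norm x powi k"
    using assms unfolding order_at_0_def by blast
  have "C * norm (axis 1 1 :: real^3) powi k \<ge> 0"
    by (rule order_trans[OF abs_ge_zero C]) simp
  then have C0: "C \<ge> 0" by simp
  define n where "n = nat (k - l)"
  have "\<bar>f x\<bar> \<le> (C * (max R 1) ^ n) * norm x powi l" if x: "x \<noteq> 0" for x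
  proof (cases "norm x > R")
    case True
    then show ?thesis using C0 by (simp add: assms(2))
  next
    case False
    have "norm x powi k = norm x ^ n * norm x powi l"
      using x assms(3) unfolding n_def by (simp flip: power_int_of_nat power_int_add)
    moreover have "norm x ^ n \<le> (max R 1) ^ n" using False by (intro power_mono) auto
    ultimately have "norm x powi k \<le> (max R 1) ^ n * norm x powi l"
      by (simp add: mult_right_mono)
    then have "C * norm x powi k \<le> C * ((max R 1) ^ n * norm x powi l)" using C0 by (rule mult_left_mono)
    then show ?thesis using C[OF x] by (simp add: mult_ac)
  qed
  then show ?thesis using assms(1) unfolding order_at_0_def by blast
qed

lemma order_at_0_integrable:
  assumes "order_at_0 (-2) f" "\<And>x. norm x > R \<Longrightarrow> f x = 0"
  shows "integrable lborel f"
proof -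
  obtain C where "\<And>x. x \<noteq> 0 \<Longrightarrow> \<bar>f x\<bar> \<le> C * norm x powi (-2)"
    using assms unfolding order_at_0_def by blast
  then show ?thesis
    using assms unfolding order_at_0_def
    by (intro integrable_inverse_square_singularity[where C = C and R = R] borel_measurable_off_origin)
      (auto simp: power_int_minus field_simps)
qed

lemma order_at_0_homog:
  assumes "homog k f" "continuous_on (- {0}) f"
  shows "order_at_0 (- int k) f"
proof -
  obtain C where "\<And>x. x \<noteq> 0 \<Longrightarrow> \<bar>f x\<bar> \<le> C / norm x ^ k"
    using homog_bound[OF assms] by blast
  then show ?thesis using assms(2) unfolding order_at_0_def
    by (auto simp: power_int_minus divide_inverse)
qed

lemma order_at_0_bounded_support:
  fixes f :: "real^3 \<Rightarrow> real"
  assumes "continuous_on UNIV f" "\<And>x. norm x > R \<Longrightarrow> f x = 0"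
  shows "order_at_0 0 f"
proof -
  have "compact (f ` cball 0 R)"
    by (rule compact_continuous_image[OF continuous_on_subset[OF assms(1)]]) auto
  then obtain C where C: "C > 0" "\<And>x. norm x \<le> R \<Longrightarrow> \<bar>f x\<bar> \<le> C"
    using compact_imp_bounded[of "f ` cball 0 R"] by (auto simp: bounded_pos)
  have "\<bar>f x\<bar> \<le> C" for x
    using C assms(2)[of x] by (cases "norm x \<le> R") auto
  then show ?thesis
    using continuous_on_subset[OF assms(1)] by (auto simp: order_at_0_def)
qed

section \<open>A cutoff function\<close>

text \<open>At the kink the difference quotient is at most \<open>\<bar>h\<bar> ^ (n + 1)\<close>,
  which tends to 0 because the power of the positive part is at least two.\<close>

lemma DERIV_max_power:
  "((\<lambda>y::real. (max 0 (1 - y)) ^ (n+2)) has_real_derivative - (real (n+2) * (max 0 (1 - y)) ^ (n+1))) (at y)"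
proof -
  consider "y < 1" | "y > 1" | "y = 1" by linarith
  then show ?thesis
  proof cases
    case 1
    have "((\<lambda>y::real. 1 - y) has_real_derivative - 1) (at y)"
      by (auto intro!: derivative_eq_intros)
    from DERIV_power[OF this, of "n + 2"]
    have "((\<lambda>y::real. (1 - y) ^ (n+2)) has_real_derivative - (real (n+2) * (1 - y) ^ (n+1))) (at y)"
      by simp
    then have "((\<lambda>y::real. (max 0 (1 - y)) ^ (n+2)) has_real_derivative - (real (n+2) * (1 - y) ^ (n+1))) (at y)"
      by (rule has_field_derivative_transform_within_open[of _ _ _ "{..<1}"]) (use 1 in auto)
    then show ?thesis using 1 by simp
  next
    case 2
    have "((\<lambda>y::real. 0) has_real_derivative 0) (at y)" by simp
    then have "((\<lambda>y::real. (max 0 (1 - y)) ^ (n+2)) has_real_derivative 0) (at y)"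
      by (rule has_field_derivative_transform_within_open[of _ _ _ "{1<..}"]) (use 2 in auto)
    then show ?thesis using 2 by simp
  next
    case 3
    have bd: "\<bar>(max 0 (- h)) ^ (n+2) / h\<bar> \<le> \<bar>h\<bar> ^ (n+1)" for h :: real
    proof (cases "h < 0")
      case True
      then have "(max 0 (- h)) ^ (n+2) / h = - ((- h) ^ (n+1))" by simp
      then show ?thesis using True by (simp add: abs_mult power_abs)
    qed simp
    have lim: "((\<lambda>h::real. \<bar>h\<bar> ^ (n+1)) \<longlongrightarrow> 0) (at 0)"
      by (auto intro!: tendsto_eq_intros)
    have "((\<lambda>h::real. (max 0 (- h)) ^ (n+2) / h) \<longlongrightarrow> 0) (at 0)"
      by (rule Lim_null_comparison[OF _ lim]) (simp only: real_norm_def bd eventually_True)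
    then show ?thesis using 3 by (simp add: DERIV_def)
  qed
qed

definition bump :: "real^3 \<Rightarrow> real" where
  "bump x = max 0 (1 - (norm x)\<^sup>2)"

lemma has_pd_norm_sq: "has_pd j (\<lambda>x. (norm x)\<^sup>2) (2 * x $ j) x"
proof -
  have eq: "(\<lambda>x::real^3. (norm x)\<^sup>2) = (\<lambda>x. \<Sum>i\<in>UNIV. x $ i * x $ i)"
    by (simp add: power2_norm_eq_inner inner_vec_def)
  have "has_pd j (\<lambda>x::real^3. \<Sum>i\<in>UNIV. x $ i * x $ i)
      (\<Sum>i\<in>UNIV. (if i = j then 1 else 0) * x $ i + (if i = j then 1 else 0) * x $ i) x"
    by (intro has_pd_sum has_pd_mult has_pd_coord)
  then show ?thesis unfolding eq by (rule has_pd_eqI) (simp add: sum.distrib if_distrib[of "\<lambda>a. a * _"] flip: sum_distrib_left cong: if_cong)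
qed

lemma has_pd_bump_power: "has_pd j (\<lambda>x. bump x ^ (n+2)) (- (2 * real (n+2) * bump x ^ (n+1) * x $ j)) x"
  unfolding bump_def
  by (rule has_pd_eqI[OF has_pd_chain[OF DERIV_max_power has_pd_norm_sq]]) (simp add: algebra_simps)

lemma continuous_on_bump [continuous_intros]: "continuous_on S bump"
  unfolding bump_def[abs_def] by (intro continuous_intros)

lemma bump_eq_0: "norm x \<ge> 1 \<Longrightarrow> bump x = 0"
  by (simp add: bump_def one_le_power)

lemma bump_bounds: "0 \<le> bump x" "bump x \<le> 1"
  by (auto simp: bump_def)

text \<open>The cube is the lowest power with continuous second derivatives across the unit sphere.
  The cutoff is thus not a \<open>test_function\<close>; it is chosen for its polynomial
  derivatives, recorded in \<open>cutoff1\<close> and \<open>cutoff2\<close>, which keep the force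
  computable by hand.\<close>

definition cutoff :: "real^3 \<Rightarrow> real" where "cutoff x = bump x ^ 3"
definition cutoff1 :: "3 \<Rightarrow> real^3 \<Rightarrow> real" where "cutoff1 j x = - (6 * bump x ^ 2 * x $ j)"
definition cutoff2 :: "3 \<Rightarrow> real^3 \<Rightarrow> real" where "cutoff2 j x = 24 * bump x * (x $ j)\<^sup>2 - 6 * bump x ^ 2"

lemma has_pd_cutoff: "has_pd j cutoff (cutoff1 j x) x"
  unfolding cutoff_def[abs_def] cutoff1_def using has_pd_bump_power[of j 1 x]
  by (simp add: numeral_3_eq_3 numeral_2_eq_2)

lemma has_pd_cutoff1: "has_pd j (cutoff1 j) (cutoff2 j x) x"
proof -
  have b: "has_pd j (\<lambda>x. bump x ^ 2) (- (4 * bump x * x $ j)) x"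
    using has_pd_bump_power[of j 0 x] by (simp add: numeral_2_eq_2)
  show ?thesis
    unfolding cutoff1_def[abs_def] cutoff2_def
    by (rule has_pd_eqI[OF has_pd_minus[OF has_pd_mult[OF has_pd_mult[OF has_pd_const b] has_pd_coord]]])
      (simp add: power2_eq_square)
qed

lemma cutoff_support: "norm x > 1 \<Longrightarrow> cutoff x = 0" "norm x > 1 \<Longrightarrow> cutoff1 j x = 0" "norm x > 1 \<Longrightarrow> cutoff2 j x = 0"
  by (simp_all add: cutoff_def cutoff1_def cutoff2_def bump_eq_0)

lemma cutoff_order: "order_at_0 0 cutoff" "order_at_0 0 (cutoff1 j)" "order_at_0 0 (cutoff2 j)"
proof -
  have "continuous_on UNIV cutoff" "continuous_on UNIV (cutoff1 j)" "continuous_on UNIV (cutoff2 j)"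
    unfolding cutoff_def[abs_def] cutoff1_def[abs_def] cutoff2_def[abs_def] by (intro continuous_intros)+
  then show "order_at_0 0 cutoff" "order_at_0 0 (cutoff1 j)" "order_at_0 0 (cutoff2 j)"
    using cutoff_support by (blast intro: order_at_0_bounded_support[where R = 1])+
qed

lemma cutoff_near_0: "\<bar>1 - cutoff x\<bar> \<le> 3 * norm x"
proof (cases "norm x \<ge> 1")
  case True
  then show ?thesis by (simp add: cutoff_def bump_eq_0)
next
  case False
  then have b: "bump x = 1 - (norm x)\<^sup>2" by (simp add: bump_def abs_square_le_1 power_le_one)
  have "1 - bump x ^ 3 = (1 - bump x) * (1 + bump x + (bump x)\<^sup>2)"
    by (simp add: algebra_simps power2_eq_square power3_eq_cube)
  also have "\<dots> \<le> (1 - bump x) * 3"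
    using bump_bounds[of x] power_le_one[of "bump x" 2] by (intro mult_left_mono) auto
  also have "\<dots> \<le> 3 * norm x"
    using False mult_left_mono[of "norm x" 1 "norm x"] by (simp add: b power2_eq_square)
  finally have "1 - cutoff x \<le> 3 * norm x" by (simp add: cutoff_def)
  moreover have "cutoff x \<le> 1" using bump_bounds[of x] power_le_one by (simp add: cutoff_def)
  ultimately show ?thesis by simp
qed

section \<open>The force exerted by a homogeneous Navier--Stokes solution\<close>

lemma pderivative_support:
  fixes f :: "real^3 \<Rightarrow> real"
  assumes "\<And>x. norm x > R \<Longrightarrow> f x = 0" "norm x > R"
  shows "pderivative j f x = 0"
proof -
  have "open {x :: real^3. norm x > R}" by (intro open_Collect_less continuous_intros)
  then have "frechet_derivative f (at x) = frechet_derivative (\<lambda>_. 0) (at x)"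
    by (rule frechet_derivative_cong_open) (use assms in auto)
  then show ?thesis by (simp add: pderivative_def)
qed

lemma test_function_support:
  assumes "test_function \<phi>"
  obtains R where "\<And>x. norm x > R \<Longrightarrow> \<phi> x = 0"
proof -
  have "bounded (closure {x. \<phi> x \<noteq> 0})"
    using assms compact_imp_bounded unfolding test_function_def by blast
  then obtain R where "\<And>x. x \<in> closure {x. \<phi> x \<noteq> 0} \<Longrightarrow> norm x \<le> R"
    unfolding bounded_iff by blast
  then have "norm x > R \<Longrightarrow> \<phi> x = 0" for x
    using closure_subset[of "{x. \<phi> x \<noteq> 0}"] by force
  then show thesis using that by blast
qed

lemma order_at_0_compact_support:
  assumes "smooth_on UNIV f" "\<And>x. norm x > R \<Longrightarrow> f x = 0"
  shows "order_at_0 0 f" "order_at_0 0 (pderivative j f)" "order_at_0 0 (pderivative k (pderivative j f))"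
proof -
  have s1: "norm x > R \<Longrightarrow> pderivative j f x = 0" for x j by (rule pderivative_support[OF assms(2)])
  have s2: "norm x > R \<Longrightarrow> pderivative k (pderivative j f) x = 0" for x j k by (rule pderivative_support[OF s1])
  show "order_at_0 0 f"
    by (rule order_at_0_bounded_support[OF smooth_on_continuous[OF assms(1)] assms(2)])
  show "order_at_0 0 (pderivative j f)"
    by (rule order_at_0_bounded_support[OF smooth_on_continuous[OF smooth_on_pderivative[OF assms(1)]] s1])
  show "order_at_0 0 (pderivative k (pderivative j f))"
    by (rule order_at_0_bounded_support[OF smooth_on_continuous[OF smooth_on_pderivative[OF smooth_on_pderivative[OF assms(1)]]] s2])
qed

lemma frechet_derivative_pderivative:
  fixes f :: "real^3 \<Rightarrow> real"
  assumes "f differentiable (at x)"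
  shows "frechet_derivative f (at x) h = (\<Sum>j\<in>UNIV. h $ j * pderivative j f x)"
proof -
  have L: "linear (frechet_derivative f (at x))" by (rule linear_frechet_derivative[OF assms])
  have "h = (\<Sum>j\<in>UNIV. h $ j *\<^sub>R axis j 1)"
    using basis_expansion[of h] by (simp add: scalar_mult_eq_scaleR)
  then have "frechet_derivative f (at x) h = frechet_derivative f (at x) (\<Sum>j\<in>UNIV. h $ j *\<^sub>R axis j 1)"
    by simp
  also have "\<dots> = (\<Sum>j\<in>UNIV. h $ j * pderivative j f x)"
    by (simp add: linear_sum[OF L] linear_cmul[OF L] pderivative_def)
  finally show ?thesis .
qed

lemma compact_support_Lipschitz:
  fixes f :: "real^3 \<Rightarrow> real"
  assumes "smooth_on UNIV f" "\<And>x. norm x > R \<Longrightarrow> f x = 0"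
  obtains K where "\<And>x. \<bar>f x - f 0\<bar> \<le> K * norm x"
proof -
  have "\<exists>C. \<forall>x. x \<noteq> 0 \<longrightarrow> \<bar>pderivative j f x\<bar> \<le> C" for j
    using order_at_0_compact_support(2)[OF assms] by (auto simp: order_at_0_def)
  then obtain C where C: "\<And>j x. x \<noteq> 0 \<Longrightarrow> \<bar>pderivative j f x\<bar> \<le> C j" by metis
  \<comment> \<open>The bounds \<open>C j\<close> hold off the origin, so the value at the origin is
    added through the maximum.\<close>
  define K where "K = (\<Sum>j\<in>UNIV. max (C j) \<bar>pderivative j f 0\<bar>)"
  have "onorm (frechet_derivative f (at x)) \<le> K" for x
  proof (rule onorm_le)
    fix h :: "real^3"
    have "norm (frechet_derivative f (at x) h) \<le> (\<Sum>j\<in>UNIV. \<bar>h $ j * pderivative j f x\<bar>)"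
      unfolding frechet_derivative_pderivative[OF smooth_on_diff[OF assms(1) UNIV_I]] real_norm_def
      by (rule sum_abs)
    also have "\<dots> \<le> (\<Sum>j\<in>UNIV. max (C j) \<bar>pderivative j f 0\<bar> * norm h)"
    proof (rule sum_mono)
      fix j
      have "\<bar>pderivative j f x\<bar> \<le> max (C j) \<bar>pderivative j f 0\<bar>"
        using C[of x j] by (cases "x = 0") auto
      then show "\<bar>h $ j * pderivative j f x\<bar> \<le> max (C j) \<bar>pderivative j f 0\<bar> * norm h"
        using component_le_norm_cart[of h j] unfolding abs_mult
        by (subst mult.commute) (intro mult_mono, auto)
    qed
    finally show "norm (frechet_derivative f (at x) h) \<le> K * norm h"
      by (simp add: K_def sum_distrib_right)
  qed
  moreover have "(f has_derivative frechet_derivative f (at x)) (at x)" for x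
    using smooth_on_diff[OF assms(1) UNIV_I] by (simp only: frechet_derivative_works)
  ultimately have "norm (f x - f 0) \<le> K * norm (x - 0)" for x
    by (intro differentiable_bound[of UNIV f "\<lambda>x. frechet_derivative f (at x)"]) auto
  then have "\<bar>f x - f 0\<bar> \<le> K * norm x" for x by simp
  then show thesis by (rule that)
qed

lemma neg_homogeneous_component:
  "neg_homogeneous k u \<Longrightarrow> homog k (\<lambda>x. (u x :: real^3) $ i)"
  by (simp add: neg_homogeneous_def homog_def)

lemma neg_homogeneous_homog: "neg_homogeneous k p \<Longrightarrow> homog k p"
  by (simp add: neg_homogeneous_def homog_def)

locale homogeneous_NS =
  fixes u :: "real^3 \<Rightarrow> real^3" and p :: "real^3 \<Rightarrow> real"
  assumes smooth_u: "smooth_on (- {0}) u" and smooth_p: "smooth_on (- {0}) p"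
    and homog_u: "neg_homogeneous 1 u" and homog_p: "neg_homogeneous 2 p"
    and momentum: "\<And>x. x \<noteq> 0 \<Longrightarrow> - laplacian u x + advect u u x + gradient p x = 0"
    and div_free: "\<And>x. x \<noteq> 0 \<Longrightarrow> divergence u x = 0"
begin

abbreviation U :: "3 \<Rightarrow> real^3 \<Rightarrow> real" where "U i \<equiv> \<lambda>x. u x $ i"

lemma smooth_U: "smooth_on (- {0}) (U i)"
  using smooth_on_component[OF _ smooth_u] by (simp add: open_Compl)

lemma U_order:
  "order_at_0 (-1) (U i)" "order_at_0 (-2) (pderivative j (U i))"
  "order_at_0 (-3) (pderivative k (pderivative j (U i)))"
proof -
  have s: "smooth_on (- {0}) (pderivative j (U i))" by (rule smooth_on_pderivative[OF smooth_U])
  have h0: "homog 1 (U i)" by (rule neg_homogeneous_component[OF homog_u])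
  have h1: "homog 2 (pderivative j (U i))"
    using homog_pderivative[OF h0] smooth_on_diff[OF smooth_U] by (simp add: numeral_2_eq_2)
  have h2: "homog 3 (pderivative k (pderivative j (U i)))"
    using homog_pderivative[OF h1] smooth_on_diff[OF s] by (simp add: numeral_3_eq_3 numeral_2_eq_2)
  show "order_at_0 (-1) (U i)" "order_at_0 (-2) (pderivative j (U i))"
    "order_at_0 (-3) (pderivative k (pderivative j (U i)))"
    using order_at_0_homog[OF h0 smooth_on_continuous[OF smooth_U]]
      order_at_0_homog[OF h1 smooth_on_continuous[OF s]]
      order_at_0_homog[OF h2 smooth_on_continuous[OF smooth_on_pderivative[OF s]]] by simp_all
qed

lemma p_order: "order_at_0 (-2) p" "order_at_0 (-3) (pderivative j p)"
proof -
  have h0: "homog 2 p" by (rule neg_homogeneous_homog[OF homog_p])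
  have h1: "homog 3 (pderivative j p)"
    using homog_pderivative[OF h0] smooth_on_diff[OF smooth_p] by (simp add: numeral_3_eq_3 numeral_2_eq_2)
  show "order_at_0 (-2) p" "order_at_0 (-3) (pderivative j p)"
    using order_at_0_homog[OF h0 smooth_on_continuous[OF smooth_p]]
      order_at_0_homog[OF h1 smooth_on_continuous[OF smooth_on_pderivative[OF smooth_p]]] by simp_all
qed

lemma momentum_component:
  assumes "x \<noteq> 0"
  shows "pderivative i p x =
    (\<Sum>j\<in>UNIV. pderivative j (pderivative j (U i)) x) - (\<Sum>j\<in>UNIV. U j x * pderivative j (U i) x)"
proof -
  have x: "x \<in> - {0}" and o: "open (- {0 :: real^3})" using assms by (auto simp: open_Compl)
  have "(- laplacian u x + advect u u x + gradient p x) $ i = 0"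
    using momentum[OF assms] by simp
  then show ?thesis
    using laplacian_component[OF o smooth_u x, of i] advect_component[OF smooth_on_diff[OF smooth_u x], of u i]
    by (simp add: gradient_def laplacian_def)
qed

text \<open>The integrand of the weak momentum equation, with \<open>dz i j\<close> in place of the
  \<open>j\<close>-th derivative of the \<open>i\<close>-th test component and
  \<open>ddz i j\<close> in place of the second derivative. Passing the derivatives as separate
  arguments admits test fields that are only twice differentiable, or only off the origin.\<close>

definition weak_density :: "(3 \<Rightarrow> 3 \<Rightarrow> real^3 \<Rightarrow> real) \<Rightarrow> (3 \<Rightarrow> 3 \<Rightarrow> real^3 \<Rightarrow> real) \<Rightarrow> real^3 \<Rightarrow> real" where
  "weak_density dz ddz x = (\<Sum>i\<in>UNIV. - (U i x * (\<Sum>j\<in>UNIV. ddz i j x))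
     - (\<Sum>j\<in>UNIV. U i x * U j x * dz i j x) - p x * dz i i x)"

lemma weak_density_integrable:
  assumes "\<And>i j. order_at_0 0 (dz i j)" "\<And>i j. order_at_0 (-1) (ddz i j)"
    and "\<And>i j x. norm x > R \<Longrightarrow> dz i j x = 0" "\<And>i j x. norm x > R \<Longrightarrow> ddz i j x = 0"
  shows "integrable lborel (weak_density dz ddz)"
proof (rule order_at_0_integrable)
  show "order_at_0 (-2) (weak_density dz ddz)"
    unfolding weak_density_def[abs_def]
    by (intro order_at_0_sum order_at_0_diff order_at_0_minus finite)
      (rule order_at_0_mult'[OF U_order(1) order_at_0_sum[OF finite assms(2)]]
        order_at_0_mult'[OF order_at_0_mult[OF U_order(1) U_order(1)] assms(1)]
        order_at_0_mult'[OF p_order(1) assms(1)], simp)+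
  show "weak_density dz ddz x = 0" if "norm x > R" for x
    using assms(3,4) that by (simp add: weak_density_def)
qed

text \<open>For a test field vanishing at the origin the singularity of the momentum flux is weak
  enough that integration by parts produces no contribution from the origin.\<close>

lemma weak_density_integral_zero:
  assumes z: "\<And>i. order_at_0 1 (z i)" "\<And>i j. order_at_0 0 (dz i j)" "\<And>i j. order_at_0 (-1) (ddz i j)"
    and supp: "\<And>i x. norm x > R \<Longrightarrow> z i x = 0" "\<And>i j x. norm x > R \<Longrightarrow> dz i j x = 0"
      "\<And>i j x. norm x > R \<Longrightarrow> ddz i j x = 0"
    and der: "\<And>i j x. x \<noteq> 0 \<Longrightarrow> has_pd j (z i) (dz i j x) x"
      "\<And>i j x. x \<noteq> 0 \<Longrightarrow> has_pd j (dz i j) (ddz i j x) x"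
  shows "(LINT x|lborel. weak_density dz ddz x) = 0"
proof -
  \<comment> \<open>The flux of the Green identity for the Stokes operator plus advection: in its
    divergence the terms carrying an undifferentiated \<open>z\<close> cancel by the momentum
    equation and incompressibility, and \<open>weak_density\<close> remains. Since \<open>z\<close>
    is of order 1, every term of the divergence is of the integrable order -2.\<close>
  define W where "W = (\<lambda>j x. (\<Sum>i\<in>UNIV. z i x * pderivative j (U i) x - U i x * dz i j x
      - U i x * U j x * z i x) - p x * z j x)"
  define D where "D = (\<lambda>j x. (\<Sum>i\<in>UNIV.
      (dz i j x * pderivative j (U i) x + pderivative j (pderivative j (U i)) x * z i x)
      - (pderivative j (U i) x * dz i j x + ddz i j x * U i x)
      - ((pderivative j (U i) x * U j x + pderivative j (U j) x * U i x) * z i x + dz i j x * (U i x * U j x)))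
      - (pderivative j p x * z j x + dz j j x * p x))"
  have W: "has_pd j (W j) (D j x) x" if x: "x \<noteq> 0" for j x
  proof -
    have x': "x \<in> - {0}" using x by simp
    show ?thesis
      unfolding W_def D_def
      by (intro has_pd_diff has_pd_sum has_pd_mult der[OF x] smooth_on_has_pd[OF smooth_U x']
          smooth_on_has_pd[OF smooth_p x'] smooth_on_has_pd[OF smooth_on_pderivative[OF smooth_U] x'])
  qed
  have D: "order_at_0 (-2) (D j)" for j
    unfolding D_def
    by (intro order_at_0_diff order_at_0_sum order_at_0_add finite)
      (rule order_at_0_mult'[OF z(2) U_order(2)] order_at_0_mult'[OF U_order(3) z(1)]
        order_at_0_mult'[OF U_order(2) z(2)] order_at_0_mult'[OF z(3) U_order(1)]
        order_at_0_mult'[OF order_at_0_add[OF order_at_0_mult[OF U_order(2) U_order(1)]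
            order_at_0_mult[OF U_order(2) U_order(1)]] z(1)]
        order_at_0_mult'[OF z(2) order_at_0_mult[OF U_order(1) U_order(1)]]
        order_at_0_mult'[OF p_order(2) z(1)] order_at_0_mult'[OF z(2) p_order(1)], simp)+
  have supD: "D j x = 0" if "norm x > R" for j x
    using supp that by (simp add: D_def)
  have int: "integrable lborel (D j)" for j
    by (rule order_at_0_integrable[OF D supD])
  have zero: "(LINT x|lborel. D j x) = 0" for j
  proof (rule integral_pd_zero[OF int W])
    show "continuous_on (- {0}) (D j)" using D[of j] by (simp add: order_at_0_def)
    show "W j x = 0" if "norm x > R" for x using supp that by (simp add: W_def)
  qed
  have eq: "weak_density dz ddz x = (\<Sum>j\<in>UNIV. D j x)" if x: "x \<noteq> 0" for x
  proof -
    have d: "pderivative 1 (U 1) x + pderivative 2 (U 2) x + pderivative 3 (U 3) x = 0"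
      using div_free[OF x] by (simp add: divergence_def sum_3)
    have d3: "pderivative 3 (U 3) x = - pderivative 1 (U 1) x - pderivative 2 (U 2) x"
      using d by linarith
    show ?thesis
      unfolding weak_density_def D_def sum_3 momentum_component[OF x] d3 by (simp add: algebra_simps)
  qed
  have "AE x in lborel. x \<noteq> (0 :: real^3)"
    by (rule AE_lborel_singleton)
  then have "(LINT x|lborel. weak_density dz ddz x) = (LINT x|lborel. (\<Sum>j\<in>UNIV. D j x))"
  proof (intro integral_cong_AE)
    show "weak_density dz ddz \<in> borel_measurable lborel"
      using weak_density_integrable[OF z(2,3) supp(2,3)] by (rule borel_measurable_integrable)
    show "(\<lambda>x. \<Sum>j\<in>UNIV. D j x) \<in> borel_measurable lborel"
      using int by (intro borel_measurable_sum borel_measurable_integrable)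
    show "AE x in lborel. weak_density dz ddz x = (\<Sum>j\<in>UNIV. D j x)"
      if "AE x in lborel. x \<noteq> (0 :: real^3)"
      using that by (rule AE_mp) (use eq in \<open>auto intro!: AE_I2\<close>)
  qed
  also have "\<dots> = (\<Sum>j\<in>UNIV. LINT x|lborel. D j x)"
    using int by (intro Bochner_Integration.integral_sum)
  finally show ?thesis by (simp add: zero)
qed

text \<open>Component \<open>k\<close> is the weak form tested against \<open>cutoff\<close> times
  the \<open>k\<close>-th unit vector. As this field takes the value of that unit vector at the
  origin, no other definition is compatible with a right-hand side that is a multiple of the Dirac
  delta.\<close>

definition force :: "real^3" where
  "force = (\<chi> k. LINT x|lborel. weak_density (\<lambda>i j. if i = k then cutoff1 j else (\<lambda>_. 0))
     (\<lambda>i j. if i = k then cutoff2 j else (\<lambda>_. 0)) x)"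

lemma cutoff_weak_density_integrable:
  "integrable lborel (weak_density (\<lambda>i j. if i = k then cutoff1 j else (\<lambda>_. 0))
     (\<lambda>i j. if i = k then cutoff2 j else (\<lambda>_. 0)))"
proof (rule weak_density_integrable[where R = 1])
  have z: "order_at_0 l (\<lambda>_. 0)" for l by (auto simp: order_at_0_def intro!: exI[of _ 0])
  have "order_at_0 (-1) (cutoff2 j)" for j
    by (rule order_at_0_mono[OF cutoff_order(3), where R = 1]) (auto simp: cutoff_support)
  then show "order_at_0 (-1) (if i = k then cutoff2 j else (\<lambda>_. 0))" for i j using z by simp
  show "order_at_0 0 (if i = k then cutoff1 j else (\<lambda>_. 0))" for i j using z cutoff_order by simp
qed (auto simp: cutoff_support)

text \<open>Subtracting \<open>\<phi> 0 $ k\<close> times the \<open>k\<close>-th cutoff field for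
  each \<open>k\<close> leaves a test field that vanishes at the origin, to which
  \<open>weak_density_integral_zero\<close> applies. By linearity only the value of
  \<open>\<phi>\<close> at 0 survives.\<close>

lemma weak_momentum:
  assumes "test_function \<phi>"
  shows "(LINT x|lborel. - (u x \<bullet> laplacian \<phi> x) - u x \<bullet> advect u \<phi> x - p x * divergence \<phi> x)
    = force \<bullet> \<phi> 0"
proof -
  obtain R0 where R0: "\<And>x. norm x > R0 \<Longrightarrow> \<phi> x = 0" using test_function_support[OF assms] by blast
  define R where "R = max R0 1"
  have R: "\<phi> x $ i = 0" "cutoff x = 0" "cutoff1 j x = 0" "cutoff2 j x = 0" if "norm x > R" for x i j
    using R0 that by (auto simp: R_def cutoff_support)
  have sm: "smooth_on UNIV \<phi>" using assms by (simp add: test_function_def)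
  define f where "f = (\<lambda>i x. \<phi> x $ i)"
  have smf: "smooth_on UNIV (f i)" for i unfolding f_def by (rule smooth_on_component[OF open_UNIV sm])
  have sf: "norm x > R \<Longrightarrow> f i x = 0" for i x by (simp add: f_def R)
  have sf1: "norm x > R \<Longrightarrow> pderivative j (f i) x = 0" for x j i by (rule pderivative_support[OF sf])
  have sf2: "norm x > R \<Longrightarrow> pderivative k (pderivative j (f i)) x = 0" for x j k i by (rule pderivative_support[OF sf1])
  define z where "z = (\<lambda>i x. f i x - f i 0 * cutoff x)"
  define dz where "dz = (\<lambda>i j x. pderivative j (f i) x - f i 0 * cutoff1 j x)"
  define ddz where "ddz = (\<lambda>i j x. pderivative j (pderivative j (f i)) x - f i 0 * cutoff2 j x)"
  have zero: "(LINT x|lborel. weak_density dz ddz x) = 0" and int: "integrable lborel (weak_density dz ddz)"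
  proof -
    have o1z: "order_at_0 1 (z i)" for i
    proof -
      obtain K where K: "\<And>x. \<bar>f i x - f i 0\<bar> \<le> K * norm x"
        using compact_support_Lipschitz[OF smf sf] by blast
      have "\<bar>z i x\<bar> \<le> (K + \<bar>f i 0\<bar> * 3) * norm x" for x
      proof -
        have "z i x = (f i x - f i 0) + f i 0 * (1 - cutoff x)" by (simp add: z_def algebra_simps)
        then have "\<bar>z i x\<bar> \<le> \<bar>f i x - f i 0\<bar> + \<bar>f i 0\<bar> * \<bar>1 - cutoff x\<bar>"
          by (metis abs_mult abs_triangle_ineq)
        also have "\<dots> \<le> K * norm x + \<bar>f i 0\<bar> * (3 * norm x)"
          using K cutoff_near_0 by (intro add_mono mult_left_mono) auto
        finally show ?thesis by (simp add: algebra_simps)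
      qed
      moreover have "continuous_on (- {0}) (z i)"
        using order_at_0_diff[OF order_at_0_compact_support(1)[OF smf sf] order_at_0_const_mult[OF cutoff_order(1)]]
        unfolding z_def order_at_0_def by blast
      ultimately show ?thesis unfolding order_at_0_def by auto
    qed
    have oz: "order_at_0 0 (dz i j)" for i j
      unfolding dz_def by (intro order_at_0_diff order_at_0_compact_support(2)[OF smf sf] order_at_0_const_mult cutoff_order)
    have sz: "norm x > R \<Longrightarrow> z i x = 0" "norm x > R \<Longrightarrow> dz i j x = 0" "norm x > R \<Longrightarrow> ddz i j x = 0" for i j x
      by (simp_all add: z_def dz_def ddz_def R sf sf1 sf2)
    have oz2: "order_at_0 (-1) (ddz i j)" for i j
    proof (rule order_at_0_mono[where k = 0 and R = R])
      show "ddz i j x = 0" if "norm x > R" for x by (rule sz(3)[OF that])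
      show "(-1 :: int) \<le> 0" by simp
      show "order_at_0 0 (ddz i j)"
        unfolding ddz_def by (intro order_at_0_diff order_at_0_compact_support(3)[OF smf sf] order_at_0_const_mult cutoff_order)
    qed
    have hz: "has_pd j (z i) (dz i j x) x" for i j x
      unfolding z_def dz_def
      by (rule has_pd_eqI[OF has_pd_diff[OF smooth_on_has_pd[OF smf UNIV_I] has_pd_mult[OF has_pd_const has_pd_cutoff]]]) simp
    have hz2: "has_pd j (dz i j) (ddz i j x) x" for i j x
      unfolding dz_def ddz_def
      by (rule has_pd_eqI[OF has_pd_diff[OF smooth_on_has_pd[OF smooth_on_pderivative[OF smf] UNIV_I]
            has_pd_mult[OF has_pd_const has_pd_cutoff1]]]) simp
    show "(LINT x|lborel. weak_density dz ddz x) = 0"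
      by (rule weak_density_integral_zero[OF o1z oz oz2 sz hz hz2])
    show "integrable lborel (weak_density dz ddz)"
      by (rule weak_density_integrable[OF oz oz2 sz(2,3)])
  qed
  let ?c = "\<lambda>k. weak_density (\<lambda>i j. if i = k then cutoff1 j else (\<lambda>_. 0)) (\<lambda>i j. if i = k then cutoff2 j else (\<lambda>_. 0))"
  have "- (u x \<bullet> laplacian \<phi> x) - u x \<bullet> advect u \<phi> x - p x * divergence \<phi> x
      = weak_density dz ddz x + (\<Sum>k\<in>UNIV. \<phi> 0 $ k * ?c k x)" for x
  proof -
    have 1: "laplacian \<phi> x $ i = (\<Sum>j\<in>UNIV. pderivative j (pderivative j (f i)) x)" for i
      by (subst laplacian_component[OF open_UNIV sm UNIV_I]) (simp add: laplacian_def f_def)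
    have 2: "advect u \<phi> x $ i = (\<Sum>j\<in>UNIV. u x $ j * pderivative j (f i) x)" for i
      by (subst advect_component[OF smooth_on_diff[OF sm UNIV_I]]) (simp add: f_def)
    have 3: "divergence \<phi> x = (\<Sum>i\<in>UNIV. pderivative i (f i) x)"
      by (simp add: divergence_def f_def)
    have 4: "\<phi> 0 $ k = f k 0" for k by (simp add: f_def)
    show ?thesis
      unfolding inner_vec_def 1 2 3 4 weak_density_def dz_def ddz_def sum_3 by (simp add: algebra_simps)
  qed
  then have "(LINT x|lborel. - (u x \<bullet> laplacian \<phi> x) - u x \<bullet> advect u \<phi> x - p x * divergence \<phi> x)
      = (LINT x|lborel. weak_density dz ddz x + (\<Sum>k\<in>UNIV. \<phi> 0 $ k * ?c k x))"
    by (simp only:)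
  also have "\<dots> = (LINT x|lborel. weak_density dz ddz x) + (\<Sum>k\<in>UNIV. \<phi> 0 $ k * (LINT x|lborel. ?c k x))"
    using int cutoff_weak_density_integrable by simp
  also have "\<dots> = force \<bullet> \<phi> 0"
    by (simp add: zero force_def inner_vec_def mult.commute)
  finally show ?thesis .
qed

text \<open>The velocity is only of order -1, so \<open>\<psi> * u\<close> has an integrable
  divergence and no correction of the test function at the origin is necessary.\<close>

lemma weak_divergence:
  fixes \<psi> :: "real^3 \<Rightarrow> real"
  assumes "test_function \<psi>"
  shows "(LINT x|lborel. u x \<bullet> gradient \<psi> x) = 0"
proof -
  obtain R where R: "\<And>x. norm x > R \<Longrightarrow> \<psi> x = 0" using test_function_support[OF assms] by blast
  have sm: "smooth_on UNIV \<psi>" using assms by (simp add: test_function_def)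
  have s1: "norm x > R \<Longrightarrow> pderivative j \<psi> x = 0" for x j by (rule pderivative_support[OF R])
  define D where "D = (\<lambda>j x. pderivative j \<psi> x * U j x + pderivative j (U j) x * \<psi> x)"
  have o1: "order_at_0 (-2) (\<lambda>x. pderivative j \<psi> x * U j x)" for j
    by (rule order_at_0_mono[OF order_at_0_mult'[OF order_at_0_compact_support(2)[OF sm R] U_order(1) refl], where R = R])
      (auto simp: s1)
  have D: "order_at_0 (-2) (D j)" for j
    unfolding D_def
    by (intro order_at_0_add o1 order_at_0_mult'[OF U_order(2) order_at_0_compact_support(1)[OF sm R]]) auto
  have supD: "D j x = 0" if "norm x > R" for j x using that by (simp add: D_def R s1)
  have int: "integrable lborel (D j)" for j by (rule order_at_0_integrable[OF D supD])
  have zero: "(LINT x|lborel. D j x) = 0" for j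
  proof (rule integral_pd_zero[OF int])
    show "has_pd j (\<lambda>x. \<psi> x * U j x) (D j x) x" if "x \<noteq> 0" for x
      unfolding D_def using that
      by (intro has_pd_mult smooth_on_has_pd[OF sm UNIV_I] smooth_on_has_pd[OF smooth_U]) auto
    show "continuous_on (- {0}) (D j)" using D[of j] by (simp add: order_at_0_def)
    show "\<psi> x * U j x = 0" if "norm x > R" for x using R that by simp
  qed
  have eq: "u x \<bullet> gradient \<psi> x = (\<Sum>j\<in>UNIV. D j x)" if x: "x \<noteq> 0" for x
  proof -
    have d: "pderivative 1 (U 1) x + pderivative 2 (U 2) x + pderivative 3 (U 3) x = 0"
      using div_free[OF x] by (simp add: divergence_def sum_3)
    have d3: "pderivative 3 (U 3) x = - pderivative 1 (U 1) x - pderivative 2 (U 2) x"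
      using d by linarith
    show ?thesis by (simp add: D_def gradient_def inner_vec_def sum_3 d3 algebra_simps)
  qed
  have m: "(\<lambda>x. u x \<bullet> gradient \<psi> x) \<in> borel_measurable lborel"
  proof -
    have "integrable lborel (\<lambda>x. \<Sum>j\<in>UNIV. pderivative j \<psi> x * U j x)"
      by (rule order_at_0_integrable[OF order_at_0_sum[OF finite o1], where R = R]) (simp add: s1)
    then show ?thesis
      by (auto simp: gradient_def inner_vec_def mult.commute dest: borel_measurable_integrable)
  qed
  have "(LINT x|lborel. u x \<bullet> gradient \<psi> x) = (LINT x|lborel. (\<Sum>j\<in>UNIV. D j x))"
  proof (rule integral_cong_AE[OF m])
    show "(\<lambda>x. \<Sum>j\<in>UNIV. D j x) \<in> borel_measurable lborel"
      using int by (intro borel_measurable_sum borel_measurable_integrable)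
    show "AE x in lborel. u x \<bullet> gradient \<psi> x = (\<Sum>j\<in>UNIV. D j x)"
      using AE_lborel_singleton[of "0 :: real^3"] by (rule AE_mp) (use eq in \<open>auto intro!: AE_I2\<close>)
  qed
  also have "\<dots> = (\<Sum>j\<in>UNIV. LINT x|lborel. D j x)"
    using int by (intro Bochner_Integration.integral_sum)
  finally show ?thesis by (simp add: zero)
qed

lemma Landau_field_force: "Landau_field force u"
  unfolding Landau_field_def distributional_NS_def
  using smooth_u smooth_p homog_u homog_p weak_momentum weak_divergence by blast

end

section \<open>A nonzero force for every Landau profile\<close>

section \<open>The force of an explicit Landau field\<close>

lemma homog_Euler:
  fixes f :: "real^3 \<Rightarrow> real"
  assumes "homog k f" "f differentiable (at x)" "x \<noteq> 0"
  shows "(\<Sum>j\<in>UNIV. x $ j * pderivative j f x) = - (real k * f x)"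
proof -
  have "((\<lambda>t::real. t *\<^sub>R x) has_derivative (\<lambda>t. t *\<^sub>R x)) (at 1)"
    by (auto intro!: derivative_eq_intros)
  moreover have "(f has_derivative frechet_derivative f (at x)) (at (1 *\<^sub>R x))"
    using assms(2) by (simp add: frechet_derivative_works)
  ultimately have "((\<lambda>t. f (t *\<^sub>R x)) has_derivative (\<lambda>t. frechet_derivative f (at x) (t *\<^sub>R x))) (at 1)"
    by (rule has_derivative_compose)
  moreover have "(\<lambda>t. frechet_derivative f (at x) (t *\<^sub>R x)) = (*) (frechet_derivative f (at x) x)"
    using linear_cmul[OF linear_frechet_derivative[OF assms(2)]] by (auto simp: fun_eq_iff)
  ultimately have 1: "((\<lambda>t. f (t *\<^sub>R x)) has_real_derivative frechet_derivative f (at x) x) (at 1)"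
    by (simp add: has_field_derivative_def)
  have "((\<lambda>t::real. inverse (t ^ k)) has_real_derivative - real k) (at 1)"
    by (auto intro!: derivative_eq_intros)
  then have "((\<lambda>t. inverse (t ^ k) * f x) has_real_derivative - real k * f x) (at 1)"
    by (rule DERIV_cmult_right)
  then have "((\<lambda>t. f (t *\<^sub>R x)) has_real_derivative - real k * f x) (at 1)"
    by (rule has_field_derivative_transform_within_open[of _ _ _ "{0<..}"])
      (use assms(1,3) in \<open>auto simp: homog_def divide_inverse mult.commute\<close>)
  then show ?thesis
    using DERIV_unique[OF 1] frechet_derivative_pderivative[OF assms(2), of x] by simp
qed

lemma norm_sq_3: "(norm x)\<^sup>2 = (x $ 1)\<^sup>2 + (x $ 2)\<^sup>2 + (x $ 3)\<^sup>2" for x :: "real^3"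
  unfolding power2_norm_eq_inner inner_vec_def sum_3 by (simp add: power2_eq_square)

definition cos_polar :: "real^3 \<Rightarrow> real" where
  "cos_polar x = x $ 3 / norm x"

lemma abs_cos_polar_le: "\<bar>cos_polar x\<bar> \<le> 1"
  using component_le_norm_cart[of x 3] by (cases "x = 0") (auto simp: cos_polar_def)

lemma cos_polar_scale: "l > 0 \<Longrightarrow> cos_polar (l *\<^sub>R x) = cos_polar x"
  by (simp add: cos_polar_def)

lemma continuous_on_cos_polar [continuous_intros]:
  "(\<And>x. x \<in> S \<Longrightarrow> x \<noteq> 0) \<Longrightarrow> continuous_on S cos_polar"
  unfolding cos_polar_def[abs_def] by (intro continuous_intros) auto

lemma has_pd_divide:
  assumes "has_pd j f d x" "has_pd j g e x" "g x \<noteq> 0"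
  shows "has_pd j (\<lambda>x. f x / g x) ((d * g x - f x * e) / (g x)\<^sup>2) x"
  using assms unfolding has_pd_def power2_eq_square
  using DERIV_divide[of "\<lambda>t. f (x + t *\<^sub>R axis j 1)" d 0 UNIV "\<lambda>t. g (x + t *\<^sub>R axis j 1)" e] by simp

lemma has_pd_cos_polar:
  assumes "x \<noteq> 0"
  shows "has_pd j cos_polar ((if j = 3 then 1 else 0) / norm x - cos_polar x * x $ j / (norm x)\<^sup>2) x"
  unfolding cos_polar_def[abs_def]
  by (rule has_pd_eqI[OF has_pd_divide[OF has_pd_coord has_pd_norm[OF assms]]])
    (use assms in \<open>auto simp: field_simps power2_eq_square\<close>)

lemma order_at_0_coord: "order_at_0 1 (\<lambda>x. x $ j)"
  unfolding order_at_0_def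
  by (auto intro!: continuous_intros exI[of _ 1] component_le_norm_cart)

lemma order_at_0_cos_polar:
  assumes "continuous_on {-1..1} g"
  shows "order_at_0 0 (\<lambda>x. g (cos_polar x))"
proof -
  have "continuous_on (- {0}) (\<lambda>x. g (cos_polar x))"
    using abs_cos_polar_le
    by (intro continuous_on_compose2[OF assms] continuous_intros) (auto simp: abs_le_iff minus_le_iff)
  moreover have "homog 0 (\<lambda>x. g (cos_polar x))" by (simp add: homog_def cos_polar_scale)
  ultimately show ?thesis using order_at_0_homog by fastforce
qed

lemma order_at_0_inverse_norm: "order_at_0 (-1) (\<lambda>x. 1 / norm x)"
  unfolding order_at_0_def by (auto intro!: continuous_intros exI[of _ 1] simp: power_int_minus field_simps)

lemma order_at_0_bump_mult:
  assumes "order_at_0 k f" "-2 \<le> k"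
  shows "order_at_0 (-2) (\<lambda>x. bump x * f x)"
proof (rule order_at_0_mono[where R = 1 and k = k])
  have "order_at_0 0 bump"
    by (rule order_at_0_bounded_support[where R = 1]) (auto intro!: continuous_intros simp: bump_eq_0)
  then show "order_at_0 k (\<lambda>x. bump x * f x)" by (rule order_at_0_mult') (use assms in auto)
qed (use assms in \<open>auto simp: bump_eq_0\<close>)

text \<open>Coefficients of the Landau field written as
  \<open>alpha * x / |x|\<^sup>2 + beta * e_z / |x|\<close>. Since \<open>e_z\<close> equals
  \<open>s\<close> times the radial unit vector minus the sine of the polar angle times the
  meridional one, the latter component of the explicit formula fixes beta, and the radial one then
  gives alpha. The Landau pressure is \<open>2 * alpha / |x|\<^sup>2\<close>.\<close>

definition Landau_alpha :: "real \<Rightarrow> real \<Rightarrow> real" where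
  "Landau_alpha a s = 2 * (a * s - 1) / (a - s)\<^sup>2"

definition Landau_beta :: "real \<Rightarrow> real \<Rightarrow> real" where
  "Landau_beta a s = 2 / (a - s)"

text \<open>A tangential correction on the unit sphere: adding the derivative of
  \<open>(1 - s\<^sup>2) * flux_shift a s\<close> to the radial momentum flux gives a density of one sign.\<close>

definition flux_shift :: "real \<Rightarrow> real \<Rightarrow> real" where
  "flux_shift a s = (4 - 4/3 * a\<^sup>2) / (a - s)\<^sup>2 + 4/3 * a * (a\<^sup>2 - 1) / (a - s) ^ 3"

definition flux_shift' :: "real \<Rightarrow> real \<Rightarrow> real" where
  "flux_shift' a s = 2 * (4 - 4/3 * a\<^sup>2) / (a - s) ^ 3 + 4 * a * (a\<^sup>2 - 1) / (a - s) ^ 4"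

lemma DERIV_const_over_power:
  fixes a s :: real
  assumes "a \<noteq> s"
  shows "((\<lambda>s. C / (a - s) ^ Suc n) has_real_derivative real (Suc n) * C / (a - s) ^ Suc (Suc n)) (at s)"
proof -
  have "((\<lambda>s. inverse (a - s)) has_real_derivative inverse (a - s) ^ 2) (at s)"
    using assms by (auto intro!: derivative_eq_intros simp: power2_eq_square)
  from DERIV_cmult[OF DERIV_power[OF this, of "Suc n"], of C] show ?thesis
    by (simp add: divide_inverse power_inverse mult_ac power2_eq_square)
qed

lemma DERIV_flux_shift:
  assumes "a \<noteq> s"
  shows "(flux_shift a has_real_derivative flux_shift' a s) (at s)"
proof -
  have "flux_shift' a s = real (Suc 1) * (4 - 4/3 * a\<^sup>2) / (a - s) ^ Suc (Suc 1)
      + real (Suc 2) * (4/3 * a * (a\<^sup>2 - 1)) / (a - s) ^ Suc (Suc 2)"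
    by (simp add: flux_shift'_def numeral_3_eq_3 numeral_2_eq_2 eval_nat_numeral)
  moreover have "flux_shift a = (\<lambda>s. (4 - 4/3 * a\<^sup>2) / (a - s) ^ Suc 1 + 4/3 * a * (a\<^sup>2 - 1) / (a - s) ^ Suc 2)"
    by (simp add: flux_shift_def fun_eq_iff numeral_2_eq_2 numeral_3_eq_3)
  ultimately show ?thesis
    by (simp only:) (intro DERIV_add DERIV_const_over_power assms)
qed

text \<open>The first line is the radial flux of vertical momentum on the unit sphere:
  \<open>al * s + be\<close> is the vertical and \<open>al + be * s\<close> the radial velocity, the
  summand 1 is viscous stress by homogeneity, and \<open>2 * al * s\<close> is the pressure. The
  second line is the derivative of \<open>(1 - s\<^sup>2) * flux_shift a s\<close>, which has zero
  integral over the sphere. The integral of the right-hand side is the classical relation between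
  \<open>\<beta>\<close> and \<open>a\<close>, logarithm included, but its integrand visibly has the
  sign of \<open>a\<close>.\<close>

lemma flux_identity:
  fixes a s :: real
  assumes "a \<noteq> s"
  defines "al \<equiv> Landau_alpha a s" and "be \<equiv> Landau_beta a s"
  shows "(al * s + be) * (1 + al + be * s) + 2 * al * s
      + (1 - s\<^sup>2) * flux_shift' a s - 2 * s * flux_shift a s
    = 8 * a * (2/3 - (1 - s\<^sup>2) / 4) / (a - s)\<^sup>2"
proof -
  define q where "q = a - s"
  have q: "q \<noteq> 0" and s: "s = a - q" using assms by (auto simp: q_def)
  show ?thesis
    unfolding al_def be_def Landau_alpha_def Landau_beta_def flux_shift_def flux_shift'_def s
    using q by (simp add: divide_simps) algebra
qed

context homogeneous_NS
begin

text \<open>Adding total derivatives turns the density of the third force component into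
  \<open>a\<close> times a nonnegative function \<open>H\<close>. A vanishing force would make
  \<open>H\<close>, and with it the bump, vanish almost everywhere.\<close>

lemma Landau_force_nonzero:
  assumes a: "\<bar>a\<bar> > 1"
    and u: "\<And>x i. x \<noteq> 0 \<Longrightarrow> u x $ i = Landau_alpha a (cos_polar x) / (norm x)\<^sup>2 * x $ i
      + Landau_beta a (cos_polar x) / norm x * (if i = 3 then 1 else 0)"
    and p: "\<And>x. x \<noteq> 0 \<Longrightarrow> p x = 2 * Landau_alpha a (cos_polar x) / (norm x)\<^sup>2"
  shows "force \<noteq> 0"
proof
  assume "force = 0"
  have ne: "a \<noteq> s" if "\<bar>s\<bar> \<le> 1" for s using a that by auto
  define E where "E = (\<lambda>x. flux_shift a (cos_polar x))"
  define E1 where "E1 = (\<lambda>x. flux_shift' a (cos_polar x))"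
  define d where "d = (\<lambda>j::3. if j = 3 then 1 else 0 :: real)"
  define ds where "ds = (\<lambda>j x. d j / norm x - cos_polar x * x $ j / (norm x)\<^sup>2)"
  define c where "c = (\<lambda>j x. d j - cos_polar x * (x $ j / norm x))"
  define dc where "dc = (\<lambda>j x. - (ds j x * (x $ j / norm x) + (1 / norm x - (x $ j)\<^sup>2 / norm x ^ 3) * cos_polar x))"
  \<comment> \<open>The radial part \<open>- U 3 x * x $ j\<close> trades the second derivatives of
    the cutoff for a term \<open>U 3 x\<close> of viscous flux. The other part is tangential,
    because \<open>c\<close> is \<open>norm x\<close> times the gradient of
    \<open>cos_polar\<close>; it produces the derivative of
    \<open>(1 - s\<^sup>2) * flux_shift a s\<close>. The weight \<open>6 * (bump x)\<^sup>2\<close>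
    is the one in \<open>cutoff1\<close>.\<close>
  define V where "V = (\<lambda>j x. E x * c j x - U 3 x * x $ j)"
  define dV where "dV = (\<lambda>j x. (E1 x * ds j x) * c j x + dc j x * E x - (pderivative j (U 3) x * x $ j + U 3 x))"
  define D where "D = (\<lambda>j x. 6 * (- (4 * bump x * x $ j) * V j x + dV j x * (bump x)\<^sup>2))"
  have pd_E: "has_pd j E (E1 x * ds j x) x" if "x \<noteq> 0" for j x
    unfolding E_def E1_def ds_def d_def
    by (rule has_pd_chain[OF DERIV_flux_shift has_pd_cos_polar]) (use that ne abs_cos_polar_le in auto)
  have pd_xn: "has_pd j (\<lambda>x. x $ j / norm x) (1 / norm x - (x $ j)\<^sup>2 / norm x ^ 3) x" if "x \<noteq> 0" for j x
    by (rule has_pd_eqI[OF has_pd_divide[OF has_pd_coord has_pd_norm[OF that]]])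
      (use that in \<open>auto simp: field_simps power2_eq_square power3_eq_cube\<close>)
  have pd_c: "has_pd j (c j) (dc j x) x" if "x \<noteq> 0" for j x
    unfolding c_def dc_def ds_def d_def
    by (rule has_pd_eqI[OF has_pd_diff[OF has_pd_const has_pd_mult[OF has_pd_cos_polar pd_xn]]])
      (use that in auto)
  have pd_V: "has_pd j (V j) (dV j x) x" if "x \<noteq> 0" for j x
    unfolding V_def dV_def
    by (rule has_pd_eqI[OF has_pd_diff[OF has_pd_mult[OF pd_E pd_c] has_pd_mult[OF smooth_on_has_pd[OF smooth_U] has_pd_coord]]])
      (use that in auto)
  have pd_b: "has_pd j (\<lambda>x. (bump x)\<^sup>2) (- (4 * bump x * x $ j)) x" for j x
    using has_pd_bump_power[of j 0 x] by (simp add: numeral_2_eq_2)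
  have pd_W: "has_pd j (\<lambda>x. 6 * ((bump x)\<^sup>2 * V j x)) (D j x) x" if "x \<noteq> 0" for j x
    unfolding D_def
    by (rule has_pd_eqI[OF has_pd_mult[OF has_pd_const has_pd_mult[OF pd_b pd_V[OF that]]]]) simp
  have oE: "order_at_0 0 E" "order_at_0 0 E1"
    unfolding E_def E1_def flux_shift_def flux_shift'_def
    by (rule order_at_0_cos_polar, intro continuous_intros, use ne in force, use ne in force)+
  have ocp: "order_at_0 0 cos_polar" using order_at_0_cos_polar[of "\<lambda>x. x"] by simp
  have od: "order_at_0 0 (\<lambda>x. d j)" for j by (auto simp: order_at_0_def)
  have o1: "order_at_0 0 (\<lambda>x. x $ j / norm x)" for j
    using order_at_0_mult'[OF order_at_0_coord order_at_0_inverse_norm, of 0 j] by simp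
  have ods: "order_at_0 (-1) (ds j)" for j
  proof -
    have "ds j = (\<lambda>x. d j * (1 / norm x) - cos_polar x * ((x $ j / norm x) * (1 / norm x)))"
      by (simp add: ds_def fun_eq_iff power2_eq_square)
    then show ?thesis
      by (simp only:) (intro order_at_0_diff order_at_0_mult'[OF od order_at_0_inverse_norm]
        order_at_0_mult'[OF ocp order_at_0_mult[OF o1 order_at_0_inverse_norm]]; simp)
  qed
  have oc: "order_at_0 0 (c j)" for j
    unfolding c_def by (intro order_at_0_diff od order_at_0_mult'[OF ocp o1]) simp
  have odc: "order_at_0 (-1) (dc j)" for j
  proof -
    have "dc j = (\<lambda>x. - (ds j x * (x $ j / norm x) + ((1 / norm x) - ((x $ j / norm x) * (x $ j / norm x)) * (1 / norm x)) * cos_polar x))"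
      by (simp add: dc_def fun_eq_iff power2_eq_square power3_eq_cube)
    then show ?thesis
      by (simp only:) (intro order_at_0_minus order_at_0_add order_at_0_mult'[OF ods o1]
        order_at_0_mult'[OF order_at_0_diff[OF order_at_0_inverse_norm order_at_0_mult'[OF order_at_0_mult[OF o1 o1] order_at_0_inverse_norm]] ocp]; simp)
  qed
  have oV: "order_at_0 0 (V j)" for j
    unfolding V_def by (intro order_at_0_diff order_at_0_mult'[OF oE(1) oc] order_at_0_mult'[OF U_order(1) order_at_0_coord]; simp)
  have odV: "order_at_0 (-1) (dV j)" for j
    unfolding dV_def by (intro order_at_0_diff order_at_0_add order_at_0_mult'[OF order_at_0_mult[OF oE(2) ods] oc]
      order_at_0_mult'[OF odc oE(1)] order_at_0_mult'[OF U_order(2) order_at_0_coord] U_order(1); simp)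
  have ob: "order_at_0 0 bump"
    by (rule order_at_0_bounded_support[where R = 1]) (auto intro!: continuous_intros simp: bump_eq_0)
  have oD: "order_at_0 (-2) (D j)" for j
  proof -
    have "D j = (\<lambda>x. bump x * (6 * (- 4 * (x $ j * V j x))) + bump x * (6 * (dV j x * bump x)))"
      by (simp add: D_def fun_eq_iff power2_eq_square algebra_simps)
    moreover have "order_at_0 (-2) (\<lambda>x. bump x * (6 * (- 4 * (x $ j * V j x))))"
    proof (rule order_at_0_bump_mult)
      show "order_at_0 1 (\<lambda>x. 6 * (- 4 * (x $ j * V j x)))"
      by (intro order_at_0_const_mult order_at_0_mult'[OF order_at_0_coord oV]) simp
    qed simp
    moreover have "order_at_0 (-2) (\<lambda>x. bump x * (6 * (dV j x * bump x)))"
    proof (rule order_at_0_bump_mult)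
      show "order_at_0 (-1) (\<lambda>x. 6 * (dV j x * bump x))"
        by (intro order_at_0_const_mult order_at_0_mult'[OF odV ob]) simp
    qed simp
    ultimately show ?thesis by (simp only: order_at_0_add)
  qed
  have sD: "D j x = 0" if "norm x > 1" for j x
    using that by (simp add: D_def bump_eq_0)
  have iD: "integrable lborel (D j)" for j by (rule order_at_0_integrable[OF oD sD])
  have zD: "(LINT x|lborel. D j x) = 0" for j
  proof (rule integral_pd_zero[OF iD pd_W])
    show "continuous_on (- {0}) (D j)" using oD[of j] by (simp add: order_at_0_def)
    show "6 * ((bump x)\<^sup>2 * V j x) = 0" if "norm x > 1" for x using that by (simp add: bump_eq_0)
  qed
  let ?G = "weak_density (\<lambda>i j. if i = 3 then cutoff1 j else (\<lambda>_. 0)) (\<lambda>i j. if i = 3 then cutoff2 j else (\<lambda>_. 0))"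
  define H where "H = (\<lambda>x. 6 * (bump x)\<^sup>2 / norm x * (8 * (2/3 - (1 - (cos_polar x)\<^sup>2) / 4) / (a - cos_polar x)\<^sup>2))"
  have GH: "?G x + (\<Sum>j\<in>UNIV. D j x) = a * H x" if x: "x \<noteq> 0" for x
  proof -
    define n s m al be where "n = norm x" and "s = cos_polar x" and "m = bump x"
      and "al = Landau_alpha a s" and "be = Landau_beta a s"
    have n: "n > 0" using x by (simp add: n_def)
    have x3: "x $ 3 = s * n" using x by (simp add: s_def n_def cos_polar_def)
    have nsq: "(x $ 1)\<^sup>2 + (x $ 2)\<^sup>2 = n\<^sup>2 * (1 - s\<^sup>2)"
      using norm_sq_3[of x] by (simp add: n_def[symmetric] x3 power_mult_distrib algebra_simps)
    have u3: "U 3 x = (al * s + be) / n"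
      using n by (simp add: u[OF x] al_def be_def s_def[symmetric] n_def[symmetric] x3 field_simps power2_eq_square)
    have ux: "(\<Sum>j\<in>UNIV. u x $ j * x $ j) = al + be * s"
    proof -
      have "(\<Sum>j\<in>UNIV. u x $ j * x $ j) = al / n\<^sup>2 * ((x $ 1)\<^sup>2 + (x $ 2)\<^sup>2 + (s * n)\<^sup>2) + be / n * (s * n)"
        by (simp add: sum_3 u[OF x] al_def be_def s_def[symmetric] n_def[symmetric] x3 algebra_simps power2_eq_square)
      then show ?thesis unfolding nsq using n by (simp add: field_simps)
    qed
    have px: "p x = 2 * al / n\<^sup>2" by (simp add: p[OF x] al_def s_def n_def)
    have euler: "(\<Sum>j\<in>UNIV. x $ j * pderivative j (U 3) x) = - U 3 x"
      using homog_Euler[OF neg_homogeneous_component[OF homog_u] smooth_on_diff[OF smooth_U], of x 3] x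
      by simp
    have xc: "(\<Sum>j\<in>UNIV. x $ j * c j x) = 0"
    proof -
      have "(\<Sum>j\<in>UNIV. x $ j * c j x) = s * n - s / n * ((x $ 1)\<^sup>2 + (x $ 2)\<^sup>2 + (s * n)\<^sup>2)"
        by (simp add: sum_3 c_def d_def s_def[symmetric] n_def[symmetric] x3 algebra_simps power2_eq_square)
      then show ?thesis unfolding nsq using n by (simp add: field_simps power2_eq_square)
    qed
    have dsc: "(\<Sum>j\<in>UNIV. ds j x * c j x) = (1 - s\<^sup>2) / n"
    proof -
      have "(\<Sum>j\<in>UNIV. ds j x * c j x) = s * s / n ^ 3 * ((x $ 1)\<^sup>2 + (x $ 2)\<^sup>2) + (1 - s * s) * (1 - s * s) / n"
        using n by (simp add: sum_3 ds_def c_def d_def s_def[symmetric] n_def[symmetric] x3 field_simps power2_eq_square power3_eq_cube)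
      note e = this
      show ?thesis unfolding e nsq using n by (simp add: field_simps power2_eq_square power3_eq_cube)
    qed
    have dcs: "(\<Sum>j\<in>UNIV. dc j x) = - 2 * s / n"
    proof -
      have "(\<Sum>j\<in>UNIV. dc j x) = 2 * s / n ^ 3 * ((x $ 1)\<^sup>2 + (x $ 2)\<^sup>2) - 2 * s / n - 2 * (1 - s * s) * s / n"
        using n by (simp add: sum_3 dc_def ds_def d_def s_def[symmetric] n_def[symmetric] x3 field_simps power2_eq_square power3_eq_cube)
      note e = this
      show ?thesis unfolding e nsq using n by (simp add: field_simps power2_eq_square power3_eq_cube)
    qed
    have xV: "(\<Sum>j\<in>UNIV. x $ j * V j x) = - n\<^sup>2 * U 3 x"
    proof -
      have "(\<Sum>j\<in>UNIV. x $ j * V j x) = E x * (\<Sum>j\<in>UNIV. x $ j * c j x) - U 3 x * ((x $ 1)\<^sup>2 + (x $ 2)\<^sup>2 + (s * n)\<^sup>2)"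
        by (simp add: V_def sum_3 x3 algebra_simps power2_eq_square)
      then show ?thesis unfolding xc nsq by (simp add: algebra_simps power2_eq_square)
    qed
    have sdV: "(\<Sum>j\<in>UNIV. dV j x) = E1 x * ((1 - s\<^sup>2) / n) - 2 * s / n * E x - 2 * U 3 x"
    proof -
      have "(\<Sum>j\<in>UNIV. dV j x) = E1 x * (\<Sum>j\<in>UNIV. ds j x * c j x) + (\<Sum>j\<in>UNIV. dc j x) * E x
          - ((\<Sum>j\<in>UNIV. x $ j * pderivative j (U 3) x) + 3 * U 3 x)"
        by (simp add: dV_def sum_3 algebra_simps)
      then show ?thesis unfolding dsc dcs euler by (simp add: algebra_simps)
    qed
    have sD: "(\<Sum>j\<in>UNIV. D j x) = 24 * m * n\<^sup>2 * U 3 x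
        + 6 * m\<^sup>2 * (E1 x * ((1 - s\<^sup>2) / n) - 2 * s / n * E x - 2 * U 3 x)"
    proof -
      have "(\<Sum>j\<in>UNIV. D j x) = - 24 * m * (\<Sum>j\<in>UNIV. x $ j * V j x) + 6 * m\<^sup>2 * (\<Sum>j\<in>UNIV. dV j x)"
        by (simp add: D_def m_def sum_3 algebra_simps)
      then show ?thesis unfolding xV sdV by (simp add: algebra_simps)
    qed
    have G: "?G x = - (U 3 x * (24 * m * n\<^sup>2 - 18 * m\<^sup>2)) + 6 * m\<^sup>2 * U 3 x * (al + be * s) + 6 * m\<^sup>2 * p x * (s * n)"
    proof -
      have "?G x = - (U 3 x * (24 * m * ((x $ 1)\<^sup>2 + (x $ 2)\<^sup>2 + (s * n)\<^sup>2) - 18 * m\<^sup>2))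
          + 6 * m\<^sup>2 * U 3 x * (\<Sum>j\<in>UNIV. u x $ j * x $ j) + 6 * m\<^sup>2 * p x * (s * n)"
        by (simp add: weak_density_def sum_3 cutoff1_def cutoff2_def m_def[symmetric] x3 algebra_simps)
      then show ?thesis unfolding nsq ux by (simp add: algebra_simps)
    qed
    have as: "a \<noteq> s" using ne abs_cos_polar_le by (simp add: s_def)
    have "?G x + (\<Sum>j\<in>UNIV. D j x) = 6 * m\<^sup>2 / n * ((al * s + be) * (1 + al + be * s) + 2 * al * s
      + (1 - s\<^sup>2) * flux_shift' a s - 2 * s * flux_shift a s)"
      unfolding G sD u3 px E_def E1_def s_def[symmetric] using n by (simp add: field_simps power2_eq_square)
    also have "\<dots> = a * H x"
      unfolding al_def be_def by (subst flux_identity[OF as]) (simp add: H_def m_def n_def s_def)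
    finally show ?thesis .
  qed
  have iG: "integrable lborel ?G" by (rule cutoff_weak_density_integrable)
  have a0: "a \<noteq> 0" using a by auto
  have HG: "AE x in lborel. (?G x + (\<Sum>j\<in>UNIV. D j x)) / a = H x"
    using AE_lborel_singleton[of "0 :: real^3"] by (rule AE_mp) (use GH a0 in \<open>auto intro!: AE_I2\<close>)
  have mH: "H \<in> borel_measurable lborel"
  proof -
    have "continuous_on (- {0}) H"
      unfolding H_def using ne abs_cos_polar_le by (intro continuous_intros) auto
    then show ?thesis using borel_measurable_off_origin by simp
  qed
  have iGD: "integrable lborel (\<lambda>x. (?G x + (\<Sum>j\<in>UNIV. D j x)) / a)"
    using iG iD by simp
  have iH: "integrable lborel H"
    using iGD integrable_cong_AE[OF borel_measurable_integrable[OF iGD] mH HG] by simp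
  have "(LINT x|lborel. H x) = (LINT x|lborel. (?G x + (\<Sum>j\<in>UNIV. D j x)) / a)"
    using integral_cong_AE[OF borel_measurable_integrable[OF iGD] mH HG] by simp
  also have "\<dots> = ((LINT x|lborel. ?G x) + (\<Sum>j\<in>UNIV. LINT x|lborel. D j x)) / a"
    using iG iD by simp
  also have "\<dots> = (force $ 3) / a" by (simp add: zD force_def)
  finally have int0: "(LINT x|lborel. H x) = 0" using \<open>force = 0\<close> by simp
  \<comment> \<open>The expression is at least 2/3 - 1/4 = 5/12.\<close>
  have Hpos: "2/3 - (1 - (cos_polar x)\<^sup>2) / 4 > 0" for x by (simp add: field_simps add_pos_nonneg)
  have "AE x in lborel. 0 \<le> H x"
    unfolding H_def using Hpos bump_bounds by (intro AE_I2 mult_nonneg_nonneg divide_nonneg_nonneg) (auto intro: less_imp_le)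
  then have "AE x in lborel. H x = 0" using integral_nonneg_eq_0_iff_AE[OF iH] int0 by simp
  then have "AE x in lborel. x \<noteq> 0 \<longrightarrow> x \<in> - ball (0 :: real^3) 1"
  proof (rule eventually_mono, intro impI)
    fix x :: "real^3" assume "H x = 0" "x \<noteq> 0"
    then have "bump x = 0" using Hpos[of x] ne[OF abs_cos_polar_le[of x]] by (auto simp: H_def)
    then show "x \<in> - ball 0 1" using power_strict_mono[of "norm x" 1 2] by (auto simp: bump_def)
  qed
  with AE_lborel_singleton[of "0 :: real^3"] have "AE x in lborel. x \<in> - ball (0 :: real^3) 1"
    by eventually_elim simp
  \<comment> \<open>A closed set of full measure is the whole space, but this one misses the
    origin.\<close>
  then have "AE x in lebesgue. x \<in> - ball (0 :: real^3) 1" by (rule AE_completion)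
  then have "(0 :: real^3) \<in> - ball 0 1"
    by (rule mem_closed_if_AE_lebesgue[rotated]) (simp add: closed_Compl)
  then show False by simp
qed

end

section \<open>One-dimensional analysis of the reduced equations\<close>

section \<open>Ordinary differential equations in the polar variable\<close>

text \<open>Multiplying by the integrating factor \<open>exp (- C x)\<close>, with \<open>C\<close>
  an antiderivative of \<open>c\<close>, makes \<open>y\<close> constant. This happens on the
  compact interval between \<open>s\<close> and \<open>t\<close>, since \<open>c\<close> may be
  unbounded near the ends.\<close>

lemma linear_ODE_zero:
  fixes y c :: "real \<Rightarrow> real"
  assumes der: "\<And>s. s \<in> {l<..<r} \<Longrightarrow> (y has_real_derivative c s * y s) (at s)"
    and cont: "continuous_on {l<..<r} c"
    and t: "t \<in> {l<..<r}" "y t = 0" and s: "s \<in> {l<..<r}"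
  shows "y s = 0"
proof -
  define a b where "a = min s t" and "b = max s t"
  have ab: "{a..b} \<subseteq> {l<..<r}" "s \<in> {a..b}" "t \<in> {a..b}" using s t(1) by (auto simp: a_def b_def)
  obtain C where C: "\<And>x. x \<in> {a..b} \<Longrightarrow> (C has_vector_derivative c x) (at x within {a..b})"
    using antiderivative_continuous[OF continuous_on_subset[OF cont ab(1)]] by blast
  define z where "z = (\<lambda>x. y x * exp (- C x))"
  have "(z has_real_derivative 0) (at x within {a..b})" if x: "x \<in> {a..b}" for x
  proof -
    have "(C has_real_derivative c x) (at x within {a..b})"
      using C[OF x] by (simp add: has_real_derivative_iff_has_vector_derivative)
    moreover have "(y has_real_derivative c x * y x) (at x within {a..b})"
      using der x ab(1) has_field_derivative_at_within by blast
    ultimately show ?thesis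
      unfolding z_def by (auto intro!: derivative_eq_intros simp: algebra_simps)
  qed
  then have "\<exists>k. \<forall>x\<in>{a..b}. z x = k"
    by (intro has_field_derivative_zero_constant) auto
  then have "z s = z t" using ab by metis
  then show ?thesis by (simp add: z_def t)
qed

lemma DERIV_zero_constant_interval:
  fixes f :: "real \<Rightarrow> real"
  assumes "\<And>s. s \<in> {l<..<r} \<Longrightarrow> (f has_real_derivative 0) (at s)"
  obtains c where "\<And>s. s \<in> {l<..<r} \<Longrightarrow> f s = c"
proof -
  have "\<exists>c. \<forall>s\<in>{l<..<r}. f s = c"
    by (rule has_field_derivative_zero_constant)
      (use has_field_derivative_at_within[OF assms] in auto)
  then show thesis using that by blast
qed

lemma DERIV_eq_constant_interval:
  fixes f :: "real \<Rightarrow> real"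
  assumes "\<And>s. s \<in> {l<..<r} \<Longrightarrow> (f has_real_derivative d) (at s)"
  obtains c where "\<And>s. s \<in> {l<..<r} \<Longrightarrow> f s = d * s + c"
proof -
  have "((\<lambda>s. f s - d * s) has_real_derivative 0) (at s)" if "s \<in> {l<..<r}" for s
    using assms[OF that] by (auto intro!: derivative_eq_intros)
  then obtain c where "\<And>s. s \<in> {l<..<r} \<Longrightarrow> f s - d * s = c"
    using DERIV_zero_constant_interval by blast
  then show thesis using that by (metis add.commute diff_add_cancel)
qed

text \<open>Here \<open>(1 - s\<^sup>2) * k s\<close> corresponds to the angular momentum, which satisfies a maximum principle.\<close>

lemma swirl_zero:
  fixes k k1 k2 b G :: "real \<Rightarrow> real"
  assumes k: "\<And>s. s \<in> {-1<..<1} \<Longrightarrow> (k has_real_derivative k1 s) (at s)"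
    and k1: "\<And>s. s \<in> {-1<..<1} \<Longrightarrow> (k1 has_real_derivative k2 s) (at s)"
    and b: "continuous_on {-1<..<1} b"
    and ode: "\<And>s. s \<in> {-1<..<1} \<Longrightarrow>
      (1 - s\<^sup>2) * k2 s - 4 * s * k1 s - 2 * k s = b s * ((1 - s\<^sup>2) * k1 s - 2 * s * k s)"
    and G: "continuous_on {-1..1} G" "G (-1) = 0" "G 1 = 0"
      "\<And>s. s \<in> {-1<..<1} \<Longrightarrow> G s = (1 - s\<^sup>2) * k s"
    and s: "s \<in> {-1<..<1}"
  shows "k s = 0"
proof -
  define G1 where "G1 = (\<lambda>s. (1 - s\<^sup>2) * k1 s - 2 * s * k s)"
  have dG: "(G has_real_derivative G1 s) (at s)" if s: "s \<in> {-1<..<1}" for s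
  proof -
    have "((\<lambda>s. (1 - s\<^sup>2) * k s) has_real_derivative G1 s) (at s)"
      unfolding G1_def using k[OF s] by (auto intro!: derivative_eq_intros)
    then show ?thesis
      by (rule has_field_derivative_transform_within_open[of _ _ _ "{-1<..<1}"]) (use s G(4) in auto)
  qed
  have dG1: "(G1 has_real_derivative b s * G1 s) (at s)" if s: "s \<in> {-1<..<1}" for s
  proof -
    have "(G1 has_real_derivative ((1 - s\<^sup>2) * k2 s - 4 * s * k1 s - 2 * k s)) (at s)"
      unfolding G1_def using k[OF s] k1[OF s] by (auto intro!: derivative_eq_intros)
    then show ?thesis using ode[OF s] by (simp add: G1_def)
  qed
  \<comment> \<open>The maximum principle in one dimension: \<open>G\<close> vanishes at both ends,
    so its derivative \<open>G1\<close> vanishes somewhere by Rolle, and being a solution of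
    \<open>G1' = b * G1\<close> it vanishes everywhere.\<close>
  obtain t where t: "-1 < t" "t < 1" "(G has_real_derivative 0) (at t)"
    using Rolle[of "-1" 1 G] G(1-3) dG real_differentiable_def
    by (metis (no_types, lifting) DERIV_unique greaterThanLessThan_iff has_field_derivative_def
        lambda_zero less_numeral_extra(1) neg_less_0_iff_less order_less_trans real_differentiableE)
  then have "G1 t = 0" using DERIV_unique dG by (meson greaterThanLessThan_iff)
  then have G1: "G1 s = 0" if "s \<in> {-1<..<1}" for s
    using linear_ODE_zero[OF dG1 b _ _ that, of t] t by simp
  have "G s = G (-1)"
  proof (rule DERIV_isconst2[of "-1" 1 G s])
    show "(G has_real_derivative 0) (at x)" if "-1 < x" "x < 1" for x
      using dG[of x] G1[of x] that by simp
  qed (use G s in auto)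
  then have "(1 - s\<^sup>2) * k s = 0" using G s by simp
  moreover have "s\<^sup>2 < 1" using s by (auto simp: abs_square_less_1)
  ultimately show ?thesis by simp
qed

text \<open>The weighted energy identity for the azimuthal magnetic field: the derivative of the
  boundary term \<open>R\<close> is a sum of two terms that the hypothesis on \<open>a\<close> makes nonnegative.\<close>

lemma energy_zero:
  fixes k k1 k2 a b b1 R :: "real \<Rightarrow> real"
  assumes k: "\<And>s. s \<in> {-1<..<1} \<Longrightarrow> (k has_real_derivative k1 s) (at s)"
    and k1: "\<And>s. s \<in> {-1<..<1} \<Longrightarrow> (k1 has_real_derivative k2 s) (at s)"
    and b: "\<And>s. s \<in> {-1<..<1} \<Longrightarrow> (b has_real_derivative b1 s) (at s)"
    and a: "\<And>s. s \<in> {-1<..<1} \<Longrightarrow> a s = s * b s - (1 - s\<^sup>2) * b1 s"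
    and ode: "\<And>s. s \<in> {-1<..<1} \<Longrightarrow> (1 - s\<^sup>2) * k2 s - 4 * s * k1 s - 2 * k s
      = - 2 * a s * k s - 2 * s * b s * k s + (1 - s\<^sup>2) * b s * k1 s"
    and a_less: "\<And>s. s \<in> {-1<..<1} \<Longrightarrow> (1 - s\<^sup>2) * a s < 1 - 2 * s\<^sup>2 / 3"
    and R: "continuous_on {-1..1} R" "R (-1) = 0" "R 1 = 0"
      "\<And>s. s \<in> {-1<..<1} \<Longrightarrow> R s = sqrt (1 - s\<^sup>2) ^ 5 * k s * k1 s
         - s * sqrt (1 - s\<^sup>2) ^ 3 * (k s)\<^sup>2 / 2 - sqrt (1 - s\<^sup>2) ^ 5 * b s * (k s)\<^sup>2 / 2"
    and s: "s \<in> {-1<..<1}"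
  shows "k s = 0"
proof -
  define w where "w = (\<lambda>s::real. sqrt (1 - s\<^sup>2))"
  \<comment> \<open>The magnetic equation is multiplied by \<open>w ^ 3 * k\<close> and integrated
    by parts; the \<open>s * w ^ 3\<close> term of \<open>R\<close> completes the square. The factor
    3/2 is 2 - 1/2: the equation contributes \<open>- 2 * a\<close>, and integrating the transport
    term by parts gives back \<open>a / 2\<close> once \<open>b1\<close> is eliminated by the
    divergence relation.\<close>
  define R1 where "R1 = (\<lambda>s. w s * ((1 - s\<^sup>2) * k1 s - s * k s)\<^sup>2
     + 3/2 * w s * (k s)\<^sup>2 * (1 - 2 * s\<^sup>2 / 3 - (1 - s\<^sup>2) * a s))"
  have w: "w s > 0" "(w s)\<^sup>2 = 1 - s\<^sup>2" if "s \<in> {-1<..<1}" for s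
  proof -
    have "s\<^sup>2 < 1" using that by (auto simp: abs_square_less_1)
    then show "w s > 0" "(w s)\<^sup>2 = 1 - s\<^sup>2" by (simp_all add: w_def)
  qed
  have dw: "(w has_real_derivative - (s / w s)) (at s)" if s: "s \<in> {-1<..<1}" for s
  proof -
    have "0 < 1 - s\<^sup>2" using w[OF s] by (metis zero_less_power)
    then show ?thesis unfolding w_def
      by (auto intro!: derivative_eq_intros simp: field_simps)
  qed
  have dR: "(R has_real_derivative R1 s) (at s)" if s: "s \<in> {-1<..<1}" for s
  proof -
    define D where "D = (5 * w s ^ 4 * (- (s / w s)) * k s * k1 s + w s ^ 5 * (k1 s * k1 s + k s * k2 s))
      - ((w s ^ 3 + s * (3 * w s ^ 2 * (- (s / w s)))) * (k s)\<^sup>2 + s * w s ^ 3 * (2 * k s * k1 s)) / 2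
      - ((5 * w s ^ 4 * (- (s / w s)) * b s + w s ^ 5 * b1 s) * (k s)\<^sup>2 + w s ^ 5 * b s * (2 * k s * k1 s)) / 2"
    have "((\<lambda>s. w s ^ 5 * k s * k1 s - s * w s ^ 3 * (k s)\<^sup>2 / 2 - w s ^ 5 * b s * (k s)\<^sup>2 / 2)
        has_real_derivative D) (at s)"
      unfolding D_def
      by (rule derivative_eq_intros refl k[OF s] k1[OF s] b[OF s] dw[OF s]
          | simp add: algebra_simps add_divide_distrib diff_divide_distrib)+
    then have dR: "(R has_real_derivative D) (at s)"
      by (rule has_field_derivative_transform_within_open[of _ _ _ "{-1<..<1}"])
        (use s R(4) in \<open>auto simp: w_def\<close>)
    have q: "w s ^ 4 * (s / w s) = w s * (1 - s\<^sup>2) * s" "w s ^ 2 * (s / w s) = w s * s"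
      "w s ^ 3 = w s * (1 - s\<^sup>2)" "w s ^ 5 = w s * (1 - s\<^sup>2)\<^sup>2"
      unfolding w(2)[OF s, symmetric] using w(1)[OF s] by (simp_all add: eval_nat_numeral)
    have b1: "(1 - s\<^sup>2) * b1 s = s * b s - a s" using a[OF s] by simp
    have "D = w s * (- 5 * (1 - s\<^sup>2) * s * k s * k1 s + (1 - s\<^sup>2)\<^sup>2 * (k1 s)\<^sup>2
          + (1 - s\<^sup>2) * k s * ((1 - s\<^sup>2) * k2 s)
        - ((1 - s\<^sup>2 - 3 * s\<^sup>2) * (k s)\<^sup>2 + s * (1 - s\<^sup>2) * (2 * k s * k1 s)) / 2
        - ((- 5 * (1 - s\<^sup>2) * s * b s + (1 - s\<^sup>2) * ((1 - s\<^sup>2) * b1 s)) * (k s)\<^sup>2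
          + (1 - s\<^sup>2)\<^sup>2 * b s * (2 * k s * k1 s)) / 2)"
      using q unfolding D_def by algebra
    also have "(1 - s\<^sup>2) * k2 s = 4 * s * k1 s + 2 * k s - 2 * a s * k s - 2 * s * b s * k s + (1 - s\<^sup>2) * b s * k1 s"
      using ode[OF s] by linarith
    finally have "D = R1 s"
      unfolding b1 R1_def by (simp add: field_simps power2_eq_square)
    then show ?thesis using dR by simp
  qed
  have pos: "3/2 * w s * (k s)\<^sup>2 * (1 - 2 * s\<^sup>2 / 3 - (1 - s\<^sup>2) * a s) \<ge> 0" if "s \<in> {-1<..<1}" for s
    using w[OF that] a_less[OF that] by (intro mult_nonneg_nonneg) auto
  have R1: "R1 s \<ge> 0" if "s \<in> {-1<..<1}" for s
    unfolding R1_def by (rule add_nonneg_nonneg[OF _ pos[OF that]]) (use w(1)[OF that] in simp)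
  \<comment> \<open>A nondecreasing function with equal boundary values is constant, so both
    nonnegative terms of \<open>R1\<close> vanish. Strictness of \<open>a_less\<close> then forces
    \<open>k\<close> to be 0.\<close>
  have "R x = 0" if x: "x \<in> {-1<..<1}" for x
  proof (rule antisym)
    have "R (-1) \<le> R x"
    proof (rule DERIV_nonneg_imp_increasing_open[of "-1" x R])
      show "\<exists>y. (R has_real_derivative y) (at t) \<and> 0 \<le> y" if "-1 < t" "t < x" for t
        using dR[of t] R1[of t] that x by auto
    qed (use x continuous_on_subset[OF R(1)] in auto)
    then show "0 \<le> R x" using R by simp
    have "R x \<le> R 1"
    proof (rule DERIV_nonneg_imp_increasing_open[of x 1 R])
      show "\<exists>y. (R has_real_derivative y) (at t) \<and> 0 \<le> y" if "x < t" "t < 1" for t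
        using dR[of t] R1[of t] that x by auto
    qed (use x continuous_on_subset[OF R(1)] in auto)
    then show "R x \<le> 0" using R by simp
  qed
  then have "((\<lambda>_. 0) has_real_derivative R1 s) (at s)"
    by (intro has_field_derivative_transform_within_open[OF dR[OF s], of "{-1<..<1}"]) (use s in auto)
  then have "R1 s = 0" using DERIV_unique DERIV_const by blast
  moreover have "w s * ((1 - s\<^sup>2) * k1 s - s * k s)\<^sup>2 \<ge> 0" using w[OF s] by simp
  ultimately have "3/2 * w s * (k s)\<^sup>2 * (1 - 2 * s\<^sup>2 / 3 - (1 - s\<^sup>2) * a s) = 0"
    using pos[OF s] unfolding R1_def by linarith
  then show ?thesis using w[OF s] a_less[OF s] by auto
qed

text \<open>A solution with a zero is zero by linear uniqueness with coefficient
  \<open>b / 2\<close>. Otherwise \<open>1 / b\<close> is affine with slope -1/2, so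
  \<open>b = 2 / (a - s)\<close>; existence on the open interval keeps \<open>a\<close> outside it,
  and boundedness rules out the endpoints.\<close>

lemma Riccati_bounded_global:
  fixes b :: "real \<Rightarrow> real"
  assumes der: "\<And>s. s \<in> {-1<..<1} \<Longrightarrow> (b has_real_derivative (b s)\<^sup>2 / 2) (at s)"
    and bound: "\<And>s. s \<in> {-1<..<1} \<Longrightarrow> \<bar>b s\<bar> \<le> C"
  shows "(\<forall>s\<in>{-1<..<1}. b s = 0) \<or> (\<exists>a. \<bar>a\<bar> > 1 \<and> (\<forall>s\<in>{-1<..<1}. b s = 2 / (a - s)))"
proof (cases "\<exists>t\<in>{-1<..<1}. b t = 0")
  case True
  then obtain t where t: "t \<in> {-1<..<1}" "b t = 0" by blast
  have "continuous_on {-1<..<1} b"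
    by (rule continuous_at_imp_continuous_on) (blast intro: DERIV_isCont[OF der])
  then have "continuous_on {-1<..<1} (\<lambda>s. b s / 2)"
    by (intro continuous_intros) simp_all
  then have "b s = 0" if "s \<in> {-1<..<1}" for s
    using linear_ODE_zero[of "-1" 1 b "\<lambda>s. b s / 2" t s] der t that by (simp add: power2_eq_square)
  then show ?thesis by blast
next
  case False
  then have nz: "b s \<noteq> 0" if "s \<in> {-1<..<1}" for s using that by blast
  have "((\<lambda>s. inverse (b s)) has_real_derivative - (1/2)) (at s)" if "s \<in> {-1<..<1}" for s
    using der[OF that] nz[OF that]
    by (auto intro!: derivative_eq_intros simp: power2_eq_square field_simps)
  then obtain c where c: "\<And>s. s \<in> {-1<..<1} \<Longrightarrow> inverse (b s) = - (1/2) * s + c"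
    using DERIV_eq_constant_interval by blast
  define a where "a = 2 * c"
  have ba: "b s = 2 / (a - s)" and ne: "a \<noteq> s" if s: "s \<in> {-1<..<1}" for s
  proof -
    have i: "inverse (b s) = (a - s) / 2" using c[OF s] by (simp add: a_def)
    then show "a \<noteq> s" using nz[OF s] by auto
    show "b s = 2 / (a - s)" using i by (metis inverse_divide inverse_inverse_eq)
  qed
  have C0: "C \<ge> 0" using bound[of 0] abs_ge_zero[of "b 0"] by simp
  \<comment> \<open>At distance \<open>d\<close> from a pole located at 1 or -1 the solution has
    modulus \<open>2 / d = 2 * (1 + C)\<close>, above the bound \<open>C\<close>;
    \<open>d \<le> 1\<close> keeps the point inside the interval.\<close>
  define d where "d = 1 / (1 + C)"
  have d: "0 < d" "d \<le> 1" "2 / d > C" using C0 by (auto simp: d_def field_simps)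
  have "a \<noteq> 1" "a \<noteq> -1"
  proof -
    show "a \<noteq> 1"
    proof
      assume "a = 1"
      then have "\<bar>2 / d\<bar> \<le> C" using ba[of "1 - d"] bound[of "1 - d"] d by simp
      then show False using d by simp
    qed
    show "a \<noteq> -1"
    proof
      assume "a = -1"
      then have "\<bar>2 / - d\<bar> \<le> C" using ba[of "d - 1"] bound[of "d - 1"] d by simp
      then show False using d by simp
    qed
  qed
  moreover have "a \<notin> {-1<..<1}" using ne by blast
  ultimately have "\<bar>a\<bar> > 1" by auto
  then show ?thesis using ba by blast
qed

lemma filterlim_quadratic_zero:
  fixes c0 c1 c2 :: real
  assumes "((\<lambda>s. c2 * s\<^sup>2 + c1 * s + c0) \<longlongrightarrow> 0) F" "F = at_left t \<or> F = at_right t"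
  shows "c2 * t\<^sup>2 + c1 * t + c0 = 0"
proof -
  have "F \<noteq> bot"
    using assms(2) by (elim disjE) simp_all
  moreover have "((\<lambda>s. c2 * s\<^sup>2 + c1 * s + c0) \<longlongrightarrow> c2 * t\<^sup>2 + c1 * t + c0) F"
    using assms(2) by (elim disjE) (auto intro!: tendsto_intros)
  ultimately show ?thesis using tendsto_unique assms(1) by blast
qed

text \<open>The two remaining momentum equations integrate to a first-order Riccati equation; all
  integration constants vanish because of the regularity on the axis.\<close>

lemma poloidal_Riccati:
  fixes a a1 a2 b b1 b2 b3 q q1 :: "real \<Rightarrow> real"
  assumes b: "\<And>s. s \<in> {-1<..<1} \<Longrightarrow> (b has_real_derivative b1 s) (at s)"
    "\<And>s. s \<in> {-1<..<1} \<Longrightarrow> (b1 has_real_derivative b2 s) (at s)"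
    "\<And>s. s \<in> {-1<..<1} \<Longrightarrow> (b2 has_real_derivative b3 s) (at s)"
    and ad: "\<And>s. s \<in> {-1<..<1} \<Longrightarrow> (a has_real_derivative a1 s) (at s)"
      "\<And>s. s \<in> {-1<..<1} \<Longrightarrow> (a1 has_real_derivative a2 s) (at s)"
    and q: "\<And>s. s \<in> {-1<..<1} \<Longrightarrow> (q has_real_derivative q1 s) (at s)"
    and a: "\<And>s. s \<in> {-1<..<1} \<Longrightarrow> a s = s * b s - (1 - s\<^sup>2) * b1 s"
    and e1: "\<And>s. s \<in> {-1<..<1} \<Longrightarrow> - 2 * q s - s * q1 s =
       ((1 - s\<^sup>2) * a2 s - 2 * s * a1 s + 2 * a s) - (- 2 * (a s)\<^sup>2 + b s * (- 2 * s * a s + (1 - s\<^sup>2) * a1 s))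
       - (a s)\<^sup>2 - 4 * a s - 2 * s * a1 s"
    and e3: "\<And>s. s \<in> {-1<..<1} \<Longrightarrow> - 2 * s * q s + (1 - s\<^sup>2) * q1 s =
       s * (((1 - s\<^sup>2) * a2 s - 2 * s * a1 s + 2 * a s) - (- 2 * (a s)\<^sup>2 + b s * (- 2 * s * a s + (1 - s\<^sup>2) * a1 s))
       - (a s)\<^sup>2) + 2 * (- 2 * s * a s + (1 - s\<^sup>2) * a1 s) + (1 - s\<^sup>2) * b2 s - 2 * s * b1 s + a s * b s"
    and bound: "\<And>s. s \<in> {-1<..<1} \<Longrightarrow> \<bar>b s\<bar> \<le> C"
    and lim: "((\<lambda>s. (1 - s\<^sup>2) * b1 s) \<longlongrightarrow> 0) (at_left 1)" "((\<lambda>s. (1 - s\<^sup>2) * b1 s) \<longlongrightarrow> 0) (at_right (-1))"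
    and s: "s \<in> {-1<..<1}"
  shows "b1 s = (b s)\<^sup>2 / 2 \<and> q s = 2 * a s"
proof -
  let ?I = "{-1<..<1::real}"
  have a1: "a1 s = b s + 3 * s * b1 s - (1 - s\<^sup>2) * b2 s" if s: "s \<in> ?I" for s
  proof -
    have "((\<lambda>s. s * b s - (1 - s\<^sup>2) * b1 s) has_real_derivative b s + 3 * s * b1 s - (1 - s\<^sup>2) * b2 s) (at s)"
      by (rule derivative_eq_intros refl b[OF s] | simp add: algebra_simps)+
    then have "(a has_real_derivative b s + 3 * s * b1 s - (1 - s\<^sup>2) * b2 s) (at s)"
      by (rule has_field_derivative_transform_within_open[of _ _ _ ?I]) (use s a in auto)
    then show ?thesis using DERIV_unique ad(1)[OF s] by blast
  qed
  have a2: "a2 s = 4 * b1 s + 5 * s * b2 s - (1 - s\<^sup>2) * b3 s" if s: "s \<in> ?I" for s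
  proof -
    have "((\<lambda>s. b s + 3 * s * b1 s - (1 - s\<^sup>2) * b2 s) has_real_derivative 4 * b1 s + 5 * s * b2 s - (1 - s\<^sup>2) * b3 s) (at s)"
      by (rule derivative_eq_intros refl b[OF s] | simp add: algebra_simps)+
    then have "(a1 has_real_derivative 4 * b1 s + 5 * s * b2 s - (1 - s\<^sup>2) * b3 s) (at s)"
      by (rule has_field_derivative_transform_within_open[of _ _ _ ?I]) (use s a1 in auto)
    then show ?thesis using DERIV_unique ad(2)[OF s] by blast
  qed
  \<comment> \<open>The combination \<open>e3 - s * e1\<close> isolates \<open>q1\<close>, since
    \<open>(1 - s\<^sup>2) + s\<^sup>2 = 1\<close>, and cancels the second derivative of
    \<open>a\<close>. What remains is an exact derivative.\<close>
  have q1: "q1 s = a1 s + b s + s * b1 s + s * (b s)\<^sup>2 - (1 - s\<^sup>2) * b s * b1 s" if s: "s \<in> ?I" for s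
  proof -
    have "q1 s = (- 2 * s * q s + (1 - s\<^sup>2) * q1 s) - s * (- 2 * q s - s * q1 s)"
      by (simp add: algebra_simps power2_eq_square)
    also have "\<dots> = 2 * a1 s + (1 - s\<^sup>2) * b2 s - 2 * s * b1 s + a s * b s"
      unfolding e1[OF s] e3[OF s] by (simp add: algebra_simps power2_eq_square)
    finally show ?thesis unfolding a1[OF s] a[OF s] by (simp add: algebra_simps power2_eq_square)
  qed
  have "((\<lambda>s. q s - (a s + s * b s - (1 - s\<^sup>2) * (b s)\<^sup>2 / 2)) has_real_derivative 0) (at s)" if s: "s \<in> ?I" for s
    by (rule derivative_eq_intros refl b[OF s] ad[OF s] q[OF s] | simp add: q1[OF s] field_simps power2_eq_square)+
  then obtain c where c: "\<And>s. s \<in> ?I \<Longrightarrow> q s - (a s + s * b s - (1 - s\<^sup>2) * (b s)\<^sup>2 / 2) = c"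
    using DERIV_zero_constant_interval by blast
  \<comment> \<open>Here \<open>m\<close> is the defect in the Riccati equation. After eliminating
    \<open>q\<close> and \<open>a\<close>, the equation \<open>e1\<close> says that
    \<open>(1 - s\<^sup>2)\<^sup>2 * m\<close> has constant second derivative \<open>2 * c\<close>,
    hence is a quadratic polynomial.\<close>
  define m where "m = (\<lambda>s. b1 s - (b s)\<^sup>2 / 2)"
  define L where "L = (\<lambda>s. (1 - s\<^sup>2)\<^sup>2 * m s)"
  define L1 where "L1 = (\<lambda>s. - 4 * s * (1 - s\<^sup>2) * m s + (1 - s\<^sup>2)\<^sup>2 * (b2 s - b s * b1 s))"
  have dL: "(L has_real_derivative L1 s) (at s)" if s: "s \<in> ?I" for s
    unfolding L_def L1_def m_def
    by (rule derivative_eq_intros refl b[OF s] | simp add: field_simps power2_eq_square)+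
  have dL1: "(L1 has_real_derivative 2 * c) (at s)" if s: "s \<in> ?I" for s
  proof -
    have "(L1 has_real_derivative (- 4 * (1 - s\<^sup>2) + 8 * s\<^sup>2) * m s - 8 * s * (1 - s\<^sup>2) * (b2 s - b s * b1 s)
        + (1 - s\<^sup>2)\<^sup>2 * (b3 s - (b1 s)\<^sup>2 - b s * b2 s)) (at s)"
      unfolding L1_def m_def
      by (rule derivative_eq_intros refl b[OF s] | simp add: field_simps power2_eq_square)+
    moreover have "q s = a s + s * b s - (1 - s\<^sup>2) * (b s)\<^sup>2 / 2 + c" using c[OF s] by simp
    then have "(- 4 * (1 - s\<^sup>2) + 8 * s\<^sup>2) * m s - 8 * s * (1 - s\<^sup>2) * (b2 s - b s * b1 s)
        + (1 - s\<^sup>2)\<^sup>2 * (b3 s - (b1 s)\<^sup>2 - b s * b2 s) = 2 * c"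
      using e1[OF s] unfolding q1[OF s] a1[OF s] a2[OF s] a[OF s] m_def
      by (simp add: field_simps power2_eq_square)
    ultimately show ?thesis by simp
  qed
  obtain c1 where c1: "\<And>s. s \<in> ?I \<Longrightarrow> L1 s = 2 * c * s + c1"
    using DERIV_eq_constant_interval[OF dL1] by blast
  have "((\<lambda>s. L s - c * s\<^sup>2) has_real_derivative c1) (at s)" if s: "s \<in> ?I" for s
    using dL[OF s] c1[OF s] by (auto intro!: derivative_eq_intros)
  then obtain c0 where c0: "\<And>s. s \<in> ?I \<Longrightarrow> L s - c * s\<^sup>2 = c1 * s + c0"
    using DERIV_eq_constant_interval by blast
  have L: "L s = c * s\<^sup>2 + c1 * s + c0" if "s \<in> ?I" for s using c0[OF that] by simp
  define M where "M = (\<lambda>s. (1 - s\<^sup>2) * m s)"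
  have evl: "\<forall>\<^sub>F s in at_left 1. s \<in> ?I" and evr: "\<forall>\<^sub>F s in at_right (-1). s \<in> ?I"
    using eventually_at_left_real[of "-1" 1] eventually_at_right_real[of "-1" 1] by auto
  have Mlim: "(M \<longlongrightarrow> 0) F" if F: "((\<lambda>s. (1 - s\<^sup>2) * b1 s) \<longlongrightarrow> 0) F" "\<forall>\<^sub>F s in F. s \<in> ?I"
    "((\<lambda>s. 1 - s\<^sup>2) \<longlongrightarrow> 0) F" for F
  proof -
    have "((\<lambda>s. (1 - s\<^sup>2) * (b s)\<^sup>2 / 2) \<longlongrightarrow> 0) F"
    proof (rule Lim_null_comparison)
      show "\<forall>\<^sub>F s in F. norm ((1 - s\<^sup>2) * (b s)\<^sup>2 / 2) \<le> C\<^sup>2 * \<bar>1 - s\<^sup>2\<bar> / 2"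
        using F(2)
      proof eventually_elim
        case (elim s)
        have "\<bar>b s\<bar>\<^sup>2 \<le> C\<^sup>2" using bound[OF elim] by (intro power_mono) auto
        then show ?case by (simp add: abs_mult mult.commute mult_right_mono)
      qed
      have "((\<lambda>s. C\<^sup>2 * \<bar>1 - s\<^sup>2\<bar> / 2) \<longlongrightarrow> C\<^sup>2 * \<bar>0\<bar> / 2) F"
        by (intro tendsto_intros F(3)) simp
      then show "((\<lambda>s. C\<^sup>2 * \<bar>1 - s\<^sup>2\<bar> / 2) \<longlongrightarrow> 0) F" by simp
    qed
    from tendsto_diff[OF F(1) this] show ?thesis by (simp add: M_def m_def algebra_simps)
  qed
  have sq: "((\<lambda>s::real. 1 - s\<^sup>2) \<longlongrightarrow> 0) (at_left 1)" "((\<lambda>s::real. 1 - s\<^sup>2) \<longlongrightarrow> 0) (at_right (-1))"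
    by (auto intro!: tendsto_eq_intros)
  have Ml: "(M \<longlongrightarrow> 0) (at_left 1)" and Mr: "(M \<longlongrightarrow> 0) (at_right (-1))"
    using Mlim lim sq evl evr by blast+
  have LM: "L s = (1 - s\<^sup>2) * M s" for s by (simp add: L_def M_def power2_eq_square)
  have "((\<lambda>s. c * s\<^sup>2 + c1 * s + c0) \<longlongrightarrow> 0) (at_left 1)"
  proof (rule Lim_transform_eventually)
    show "((\<lambda>s. (1 - s\<^sup>2) * M s) \<longlongrightarrow> 0) (at_left 1)" using tendsto_mult[OF sq(1) Ml] by simp
    show "\<forall>\<^sub>F s in at_left 1. (1 - s\<^sup>2) * M s = c * s\<^sup>2 + c1 * s + c0"
      using evl by eventually_elim (use L LM in auto)
  qed
  then have q1: "c + c1 + c0 = 0" using filterlim_quadratic_zero[of c c1 c0 "at_left 1" 1] by simp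
  have "((\<lambda>s. c * s\<^sup>2 + c1 * s + c0) \<longlongrightarrow> 0) (at_right (-1))"
  proof (rule Lim_transform_eventually)
    show "((\<lambda>s. (1 - s\<^sup>2) * M s) \<longlongrightarrow> 0) (at_right (-1))" using tendsto_mult[OF sq(2) Mr] by simp
    show "\<forall>\<^sub>F s in at_right (-1). (1 - s\<^sup>2) * M s = c * s\<^sup>2 + c1 * s + c0"
      using evr by eventually_elim (use L LM in auto)
  qed
  then have q2: "c - c1 + c0 = 0" using filterlim_quadratic_zero[of c c1 c0 "at_right (-1)" "-1"] by simp
  have sq1: "s\<^sup>2 < 1" if "s \<in> ?I" for s using that by (auto simp: abs_square_less_1)
  \<comment> \<open>Vanishing of \<open>L\<close> at both poles gives \<open>c1 = 0\<close> and
    \<open>c0 = - c\<close>, so \<open>M\<close> is constant. The limit of \<open>M\<close> itself,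
    one power of \<open>1 - s\<^sup>2\<close> stronger than that of \<open>L\<close>, then removes
    the last constant.\<close>
  have Mc: "M s = - c" if s: "s \<in> ?I" for s
  proof -
    have "c1 = 0" "c0 = - c" using q1 q2 by auto
    then have "(1 - s\<^sup>2) * M s = (1 - s\<^sup>2) * (- c)" using L[OF s] LM[of s] by (simp add: algebra_simps)
    moreover have "1 - s\<^sup>2 \<noteq> 0" using sq1[OF s] by simp
    ultimately show ?thesis by (rule mult_left_cancel[THEN iffD1, rotated])
  qed
  have "((\<lambda>_. - c) \<longlongrightarrow> 0) (at_left (1::real))"
    by (rule Lim_transform_eventually[OF Ml]) (use evl in eventually_elim, use Mc in auto)
  then have c: "c = 0" by (simp add: tendsto_const_iff)
  then have "m s = 0" using Mc[OF s] sq1[OF s] by (simp add: M_def)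
  then have b1: "b1 s = (b s)\<^sup>2 / 2" by (simp add: m_def)
  moreover have "q s = 2 * a s"
    using \<open>\<And>s. s \<in> ?I \<Longrightarrow> q s - _ = c\<close>[OF s] unfolding c a[OF s] b1 by (simp add: field_simps)
  ultimately show ?thesis by blast
qed

section \<open>From axisymmetric homogeneous fields to profiles in \<open>s\<close>\<close>

section \<open>Finite differentiability on the real line\<close>

text \<open>The derivative is quantified existentially at each level, which makes closure under
  products and composition a direct induction; \<open>diffn_Suc_deriv\<close> returns to
  \<open>deriv\<close> on open sets.\<close>

primrec diffn :: "nat \<Rightarrow> real set \<Rightarrow> (real \<Rightarrow> real) \<Rightarrow> bool" where
  "diffn 0 S f \<longleftrightarrow> True"
| "diffn (Suc n) S f \<longleftrightarrow> (\<exists>f'. (\<forall>x\<in>S. (f has_real_derivative f' x) (at x)) \<and> diffn n S f')"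

lemma diffn_SucD: "diffn (Suc n) S f \<Longrightarrow> diffn n S f"
proof (induction n arbitrary: f)
  case (Suc n)
  then obtain f' where "\<forall>x\<in>S. (f has_real_derivative f' x) (at x)" "diffn (Suc n) S f'"
    by (subst (asm) diffn.simps(2)) blast
  then show ?case using Suc.IH[of f'] unfolding diffn.simps(2)[of n S f]
    by (intro exI[of _ f'] conjI)
qed simp

lemma diffn_const: "diffn n S (\<lambda>x. c)"
proof (induction n arbitrary: c)
  case (Suc n)
  then show ?case by (auto intro!: exI[of _ "\<lambda>_. 0"])
qed simp

lemma diffn_ident: "diffn n S (\<lambda>x. x)"
proof (cases n)
  case (Suc m)
  then show ?thesis using diffn_const[of m S 1] by (auto intro!: exI[of _ "\<lambda>_. 1"])
qed simp

lemma diffn_add: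
  "diffn n S f \<Longrightarrow> diffn n S g \<Longrightarrow> diffn n S (\<lambda>x. f x + g x)"
proof (induction n arbitrary: f g)
  case (Suc n)
  then obtain f' g' where "\<forall>x\<in>S. (f has_real_derivative f' x) (at x)" "diffn n S f'"
    "\<forall>x\<in>S. (g has_real_derivative g' x) (at x)" "diffn n S g'" by auto
  then show ?case using Suc.IH[of f' g']
    by (auto intro!: exI[of _ "\<lambda>x. f' x + g' x"] DERIV_add)
qed simp

lemma diffn_mult:
  "diffn n S f \<Longrightarrow> diffn n S g \<Longrightarrow> diffn n S (\<lambda>x. f x * g x)"
proof (induction n arbitrary: f g)
  case (Suc n)
  obtain f' g' where "\<forall>x\<in>S. (f has_real_derivative f' x) (at x)" "diffn n S f'"
    "\<forall>x\<in>S. (g has_real_derivative g' x) (at x)" "diffn n S g'" using Suc.prems by auto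
  moreover from this have "diffn n S (\<lambda>x. f' x * g x + g' x * f x)"
    using Suc.prems[THEN diffn_SucD] by (intro diffn_add Suc.IH)
  ultimately show ?case
    by (auto intro!: exI[of _ "\<lambda>x. f' x * g x + g' x * f x"] DERIV_mult)
qed simp

lemma diffn_diff: "diffn n S f \<Longrightarrow> diffn n S g \<Longrightarrow> diffn n S (\<lambda>x. f x - g x)"
  using diffn_add[of n S f "\<lambda>x. (-1) * g x"] diffn_mult[OF diffn_const, of n S g "-1"] by simp

lemma diffn_compose:
  "diffn n T g \<Longrightarrow> diffn n S f \<Longrightarrow> f ` S \<subseteq> T \<Longrightarrow> diffn n S (\<lambda>x. g (f x))"
proof (induction n arbitrary: f g)
  case (Suc n)
  obtain f' g' where f': "\<forall>x\<in>S. (f has_real_derivative f' x) (at x)" "diffn n S f'"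
    and g': "\<forall>x\<in>T. (g has_real_derivative g' x) (at x)" "diffn n T g'" using Suc.prems by auto
  have "diffn n S (\<lambda>x. g' (f x) * f' x)"
    by (rule diffn_mult[OF Suc.IH[OF g'(2) diffn_SucD[OF Suc.prems(2)] Suc.prems(3)] f'(2)])
  moreover have "((\<lambda>x. g (f x)) has_real_derivative g' (f x) * f' x) (at x)" if "x \<in> S" for x
  proof (rule DERIV_chain2[where f = g and g = f])
    show "(g has_real_derivative g' (f x)) (at (f x))" using g'(1) Suc.prems(3) that by blast
    show "(f has_real_derivative f' x) (at x)" using f'(1) that by blast
  qed
  ultimately show ?case unfolding diffn.simps(2)
    by (intro exI[of _ "\<lambda>x. g' (f x) * f' x"] conjI ballI)
qed simp

lemma one_minus_square_pos: "s \<in> {-1<..<1} \<Longrightarrow> 1 - s\<^sup>2 > (0 :: real)"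
  by (auto simp: abs_square_less_1)

lemma DERIV_inverse_sqrt:
  assumes "s \<in> {-1<..<1}"
  shows "((\<lambda>s. inverse (sqrt (1 - s\<^sup>2))) has_real_derivative s * inverse (sqrt (1 - s\<^sup>2)) ^ 3) (at s)"
proof -
  have p: "1 - s\<^sup>2 > 0" by (rule one_minus_square_pos[OF assms])
  then have "(sqrt has_real_derivative inverse (sqrt (1 - s\<^sup>2)) / 2) (at (1 - s\<^sup>2))"
    by (rule DERIV_real_sqrt)
  moreover have "((\<lambda>s. 1 - s\<^sup>2) has_real_derivative - 2 * s) (at s)"
    by (auto intro!: derivative_eq_intros)
  ultimately have "((\<lambda>s. sqrt (1 - s\<^sup>2)) has_real_derivative inverse (sqrt (1 - s\<^sup>2)) / 2 * (- 2 * s)) (at s)"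
    by (rule DERIV_chain2)
  note d = DERIV_inverse_fun[OF this]
  have "- (inverse q / 2 * (- 2 * s) * inverse (q ^ Suc (Suc 0))) = s * inverse q ^ 3" for q :: real
    by (simp add: power3_eq_cube)
  note e = this[of "sqrt (1 - s\<^sup>2)"]
  have "sqrt (1 - s\<^sup>2) \<noteq> 0" using p by simp
  from DERIV_cong[OF d[OF this] e] show ?thesis .
qed

text \<open>The induction closes because the derivative is \<open>s\<close> times the cube of the
  function itself.\<close>

lemma diffn_inverse_sqrt: "diffn n {-1<..<1} (\<lambda>s. inverse (sqrt (1 - s\<^sup>2)))"
proof (induction n)
  case (Suc n)
  let ?r = "\<lambda>s :: real. inverse (sqrt (1 - s\<^sup>2))"
  have "(?r has_real_derivative s * (?r s * (?r s * ?r s))) (at s)" if s: "s \<in> {-1<..<1}" for s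
    by (rule DERIV_cong[OF DERIV_inverse_sqrt[OF s]]) (simp only: power3_eq_cube mult.assoc)
  moreover have "diffn n {-1<..<1} (\<lambda>s. s * (?r s * (?r s * ?r s)))"
    by (intro diffn_mult diffn_ident Suc)
  ultimately show ?case unfolding diffn.simps(2)
    by (intro exI[of _ "\<lambda>s. s * (?r s * (?r s * ?r s))"] conjI ballI)
qed simp

lemma diffn_arccos: "diffn n {-1<..<1} arccos"
proof (cases n)
  case (Suc m)
  have "(arccos has_real_derivative (-1) * inverse (sqrt (1 - s\<^sup>2))) (at s)" if "s \<in> {-1<..<1}" for s
    using DERIV_arccos[of s] that by simp
  moreover have "diffn m {-1<..<1} (\<lambda>s. (-1) * inverse (sqrt (1 - s\<^sup>2)))"
    by (intro diffn_mult diffn_const diffn_inverse_sqrt)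
  ultimately show ?thesis unfolding Suc diffn.simps(2)
    by (intro exI[of _ "\<lambda>s. (-1) * inverse (sqrt (1 - s\<^sup>2))"] conjI ballI)
qed simp

section \<open>The unit half-circle in the meridian plane\<close>

text \<open>Parametrised by the polar angle, the curve passes smoothly through both poles, unlike
  the parametrisation by \<open>s\<close>, whose derivative blows up there. On it
  \<open>x $ 2 = 0\<close>, so the Cartesian components 1 and 2 are the radial and azimuthal ones
  for angles strictly between 0 and \<open>pi\<close>.\<close>

definition meridian :: "real \<Rightarrow> real^3" where
  "meridian t = sin t *\<^sub>R axis 1 1 + cos t *\<^sub>R axis 3 1"

lemma meridian_nth [simp]: "meridian t $ 1 = sin t" "meridian t $ 2 = 0" "meridian t $ 3 = cos t"
  by (simp_all add: meridian_def axis_def)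

lemma norm_meridian [simp]: "norm (meridian t) = 1"
proof -
  have "(norm (meridian t))\<^sup>2 = 1" by (simp add: norm_sq_3)
  then show ?thesis using norm_ge_zero[of "meridian t"] by (simp add: power2_eq_1_iff)
qed

lemma meridian_neq_0 [simp]: "meridian t \<noteq> 0"
  by (metis norm_meridian norm_zero zero_neq_one)

text \<open>The derivative of \<open>f\<close> along the rotations of the meridian plane.\<close>

definition rot_deriv :: "(real^3 \<Rightarrow> real) \<Rightarrow> real^3 \<Rightarrow> real" where
  "rot_deriv f x = x $ 3 * pderivative 1 f x + (- 1) * (x $ 1 * pderivative 3 f x)"

lemma smooth_on_rot_deriv:
  assumes "open S" "smooth_on S f" shows "smooth_on S (rot_deriv f)"
proof -
  have p: "Ck_on k S (pderivative j f)" for k j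
    using smooth_on_pderivative[OF assms(2)] by (simp add: smooth_on_def)
  have "Ck_on k S (rot_deriv f)" for k
    unfolding rot_deriv_def[abs_def]
    by (intro Ck_on_add Ck_on_mult Ck_on_coord Ck_on_const assms p)
  then show ?thesis by (simp add: smooth_on_def)
qed

lemma DERIV_meridian:
  assumes "smooth_on (- {0}) f"
  shows "((\<lambda>t. f (meridian t)) has_real_derivative rot_deriv f (meridian t)) (at t)"
proof -
  have d: "f differentiable (at (meridian t))" by (rule smooth_on_diff[OF assms]) simp
  have 1: "(f has_derivative frechet_derivative f (at (meridian t))) (at (meridian t))"
    using d by (simp only: frechet_derivative_works)
  define v :: "real^3" where "v = cos t *\<^sub>R axis 1 1 - sin t *\<^sub>R axis 3 1"
  have "(meridian has_vector_derivative v) (at t)"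
    unfolding meridian_def[abs_def] v_def by (auto intro!: derivative_eq_intros)
  then have 2: "(meridian has_derivative (\<lambda>h. h *\<^sub>R v)) (at t)" by (simp add: has_vector_derivative_def)
  have "((\<lambda>t. f (meridian t)) has_derivative (\<lambda>h. frechet_derivative f (at (meridian t)) (h *\<^sub>R v))) (at t)"
    by (rule has_derivative_compose[OF 2 1])
  moreover have "frechet_derivative f (at (meridian t)) (h *\<^sub>R v) = rot_deriv f (meridian t) * h" for h
    unfolding frechet_derivative_pderivative[OF d] rot_deriv_def
    by (simp add: sum_3 v_def axis_def algebra_simps)
  ultimately show ?thesis by (simp add: has_field_derivative_def)
qed

lemma diffn_meridian: "smooth_on (- {0}) f \<Longrightarrow> diffn n UNIV (\<lambda>t. f (meridian t))"
proof (induction n arbitrary: f)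
  case (Suc n)
  have "diffn n UNIV (\<lambda>t. rot_deriv f (meridian t))"
    by (rule Suc.IH[OF smooth_on_rot_deriv[OF _ Suc.prems]]) (simp add: open_Compl)
  then show ?case unfolding diffn.simps(2) using DERIV_meridian[OF Suc.prems]
    by (intro exI[of _ "\<lambda>t. rot_deriv f (meridian t)"] conjI ballI) blast+
qed simp

lemma diffn_meridian_arccos: "smooth_on (- {0}) f \<Longrightarrow> diffn n {-1<..<1} (\<lambda>s. f (meridian (arccos s)))"
  by (rule diffn_compose[OF diffn_meridian diffn_arccos]) simp_all

section \<open>Differential operators off the axis\<close>

definition off_axis :: "(real^3) set" where
  "off_axis = {x. x $ 1 \<noteq> 0 \<or> x $ 2 \<noteq> 0}"

lemma open_off_axis: "open off_axis"
proof -
  have "off_axis = (\<lambda>x. x $ 1) -` (- {0}) \<union> (\<lambda>x. x $ 2) -` (- {0})" by (auto simp: off_axis_def)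
  moreover have "open ((\<lambda>x :: real^3. x $ i) -` (- {0}))" for i
    by (intro open_vimage continuous_intros)
  ultimately show ?thesis using open_Un by metis
qed

lemma off_axis_neq_0: "x \<in> off_axis \<Longrightarrow> x \<noteq> 0" by (auto simp: off_axis_def)

lemma cos_polar_off_axis:
  assumes "x \<in> off_axis" shows "cos_polar x \<in> {-1<..<1}"
proof -
  have x: "norm x > 0" using off_axis_neq_0[OF assms] by simp
  have "(x $ 1)\<^sup>2 + (x $ 2)\<^sup>2 > 0"
    using assms by (auto simp: off_axis_def sum_power2_gt_zero_iff)
  then have "(x $ 3)\<^sup>2 < (norm x)\<^sup>2" by (simp add: norm_sq_3)
  then have "\<bar>x $ 3\<bar> < norm x" using abs_le_square_iff[of "norm x" "x $ 3"] by simp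
  then show ?thesis using x by (auto simp: cos_polar_def field_simps abs_less_iff)
qed

text \<open>A certificate that \<open>G\<close> is the gradient and \<open>L\<close> the Laplacian
  of \<open>f\<close> off the axis. Certificates combine under sums and multiplication by
  coordinates, so the derivatives of all field components are assembled from those of the scalar
  profiles.\<close>

definition C2_data :: "(real^3 \<Rightarrow> real) \<Rightarrow> (3 \<Rightarrow> real^3 \<Rightarrow> real) \<Rightarrow> (real^3 \<Rightarrow> real) \<Rightarrow> bool" where
  "C2_data f G L \<longleftrightarrow> (\<forall>x\<in>off_axis. (\<forall>j. has_pd j f (G j x) x) \<and>
     (\<exists>d. (\<forall>j. has_pd j (G j) (d j) x) \<and> L x = (\<Sum>j\<in>UNIV. d j)))"

lemma C2_data_add:
  assumes "C2_data f G L" "C2_data g H M"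
  shows "C2_data (\<lambda>x. f x + g x) (\<lambda>j x. G j x + H j x) (\<lambda>x. L x + M x)"
  unfolding C2_data_def
proof (intro ballI conjI allI)
  fix x j assume x: "x \<in> off_axis"
  obtain d e where "\<forall>j. has_pd j f (G j x) x" "\<forall>j. has_pd j (G j) (d j) x" "L x = (\<Sum>j\<in>UNIV. d j)"
    "\<forall>j. has_pd j g (H j x) x" "\<forall>j. has_pd j (H j) (e j) x" "M x = (\<Sum>j\<in>UNIV. e j)"
    using assms x unfolding C2_data_def by meson
  then show "has_pd j (\<lambda>x. f x + g x) (G j x + H j x) x"
    "\<exists>d. (\<forall>j. has_pd j (\<lambda>x. G j x + H j x) (d j) x) \<and> L x + M x = (\<Sum>j\<in>UNIV. d j)"
    by (auto intro!: has_pd_add exI[of _ "\<lambda>j. d j + e j"] simp: sum.distrib)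
qed

lemma C2_data_coord_mult:
  assumes "C2_data g G L"
  shows "C2_data (\<lambda>x. c * x $ i * g x) (\<lambda>j x. (if i = j then c else 0) * g x + c * x $ i * G j x)
     (\<lambda>x. 2 * c * G i x + c * x $ i * L x)"
  unfolding C2_data_def
proof (intro ballI conjI allI)
  fix x j assume x: "x \<in> off_axis"
  obtain d where g: "\<And>j. has_pd j g (G j x) x" and d: "\<And>j. has_pd j (G j) (d j) x" and L: "L x = (\<Sum>j\<in>UNIV. d j)"
    using assms x unfolding C2_data_def by meson
  have ci: "has_pd j (\<lambda>x. c * x $ i) (if i = j then c else 0) x" for j
    by (rule has_pd_eqI[OF has_pd_mult[OF has_pd_const has_pd_coord]]) simp
  show "has_pd j (\<lambda>x. c * x $ i * g x) ((if i = j then c else 0) * g x + c * x $ i * G j x) x"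
    by (rule has_pd_eqI[OF has_pd_mult[OF ci g]]) simp
  have "has_pd j (\<lambda>x. (if i = j then c else 0) * g x + c * x $ i * G j x)
      (2 * (if i = j then c else 0) * G j x + c * x $ i * d j) x" for j
    by (rule has_pd_eqI[OF has_pd_add[OF has_pd_mult[OF has_pd_const g] has_pd_mult[OF ci d]]]) simp
  moreover have "2 * c * G i x + c * x $ i * L x
      = (\<Sum>j\<in>UNIV. 2 * (if i = j then c else 0) * G j x + c * x $ i * d j)"
  proof -
    have "(\<Sum>j\<in>UNIV. 2 * (if i = j then c else 0) * G j x) = (\<Sum>j\<in>UNIV. if i = j then 2 * c * G j x else 0)"
      by (intro sum.cong) auto
    then show ?thesis by (simp add: L sum.distrib sum_distrib_left)
  qed
  ultimately show "\<exists>d. (\<forall>j. has_pd j (\<lambda>x. (if i = j then c else 0) * g x + c * x $ i * G j x) (d j) x) \<and>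
      2 * c * G i x + c * x $ i * L x = (\<Sum>j\<in>UNIV. d j)"
    by (intro exI[of _ "\<lambda>j. 2 * (if i = j then c else 0) * G j x + c * x $ i * d j"] conjI allI)
qed

definition polar_hom :: "nat \<Rightarrow> (real \<Rightarrow> real) \<Rightarrow> real^3 \<Rightarrow> real" where
  "polar_hom m f x = f (cos_polar x) / norm x ^ m"

lemma has_pd_polar_hom:
  assumes x: "x \<in> off_axis" and f: "\<And>s. s \<in> {-1<..<1} \<Longrightarrow> (f has_real_derivative f1 s) (at s)"
  shows "has_pd j (polar_hom m f) (x $ j * polar_hom (m+2) (\<lambda>s. - (s * f1 s + real m * f s)) x
     + (if j = 3 then 1 else 0) * polar_hom (m+1) f1 x) x"
proof -
  have x0: "x \<noteq> 0" by (rule off_axis_neq_0[OF x])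
  have "((\<lambda>y. inverse (y ^ m)) has_real_derivative - (real m / norm x ^ Suc m)) (at (norm x))"
  proof (cases m)
    case (Suc k)
    have nz: "norm x ^ m \<noteq> 0" using x0 by simp
    show ?thesis
      by (rule DERIV_cong[OF DERIV_inverse_fun[OF DERIV_pow nz]]) (use x0 in \<open>simp add: Suc field_simps\<close>)
  qed simp
  note n = has_pd_chain[OF this has_pd_norm[OF x0]]
  note h = has_pd_mult[OF has_pd_chain[OF f[OF cos_polar_off_axis[OF x]] has_pd_cos_polar[OF x0]] n]
  show ?thesis
    unfolding polar_hom_def[abs_def] divide_inverse[of "f _"]
    by (rule has_pd_eqI[OF h]) (use x0 in \<open>simp add: field_simps power2_eq_square\<close>)
qed

text \<open>The Laplacian of \<open>norm x ^ (- m) * f s\<close> is the Legendre operator plus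
  \<open>m * (m - 1)\<close> applied to \<open>f\<close>. The gradient is split along
  \<open>x\<close> and \<open>e_z\<close> because the gradient of \<open>s\<close> is
  \<open>e_z / |x| - s * x / |x|\<^sup>2\<close>.\<close>

lemma C2_data_polar_hom:
  assumes f: "\<And>s. s \<in> {-1<..<1} \<Longrightarrow> (f has_real_derivative f1 s) (at s)"
    and f1: "\<And>s. s \<in> {-1<..<1} \<Longrightarrow> (f1 has_real_derivative f2 s) (at s)"
  shows "C2_data (polar_hom m f) (\<lambda>j x. x $ j * polar_hom (m+2) (\<lambda>s. - (s * f1 s + real m * f s)) x
     + (if j = 3 then 1 else 0) * polar_hom (m+1) f1 x)
     (polar_hom (m+2) (\<lambda>s. (1 - s\<^sup>2) * f2 s - 2 * s * f1 s + real m * (real m - 1) * f s))"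
  unfolding C2_data_def
proof (intro ballI conjI allI)
  fix x j assume x: "x \<in> off_axis"
  have x0: "x \<noteq> 0" by (rule off_axis_neq_0[OF x])
  show "has_pd j (polar_hom m f) (x $ j * polar_hom (m+2) (\<lambda>s. - (s * f1 s + real m * f s)) x
     + (if j = 3 then 1 else 0) * polar_hom (m+1) f1 x) x"
    by (rule has_pd_polar_hom[OF x f])
  define P where "P = (\<lambda>s. - (s * f1 s + real m * f s))"
  define P1 where "P1 = (\<lambda>s. - (f1 s + s * f2 s + real m * f1 s))"
  have P: "(P has_real_derivative P1 s) (at s)" if "s \<in> {-1<..<1}" for s
    unfolding P_def P1_def using f[OF that] f1[OF that] by (auto intro!: derivative_eq_intros)
  define e where "e = (\<lambda>j::3. if j = 3 then 1 else 0 :: real)"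
  define d where "d = (\<lambda>j. polar_hom (m+2) P x + x $ j * (x $ j * polar_hom (m+4) (\<lambda>s. - (s * P1 s + real (m+2) * P s)) x
      + e j * polar_hom (m+3) P1 x)
      + e j * (x $ j * polar_hom (m+3) (\<lambda>s. - (s * f2 s + real (m+1) * f1 s)) x + e j * polar_hom (m+2) f2 x))"
  have "has_pd j (\<lambda>x. x $ j * polar_hom (m+2) P x + e j * polar_hom (m+1) f1 x) (d j) x" for j
    using has_pd_add[OF has_pd_mult[OF has_pd_coord has_pd_polar_hom[OF x P, of j "m+2"]]
        has_pd_mult[OF has_pd_const has_pd_polar_hom[OF x f1, of j "m+1"]], of j "e j"]
  proof (rule has_pd_eqI)
    have m: "m + 2 + 2 = m + 4" "m + 2 + 1 = m + 3" "m + 1 + 2 = m + 3" "m + 1 + 1 = m + 2" by simp_all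
    show "(if j = j then 1 else 0) * polar_hom (m + 2) P x +
      (x $ j * polar_hom (m + 2 + 2) (\<lambda>s. - (s * P1 s + real (m + 2) * P s)) x +
      (if j = 3 then 1 else 0) * polar_hom (m + 2 + 1) P1 x) * x $ j +
      (0 * polar_hom (m + 1) f1 x +
      (x $ j * polar_hom (m + 1 + 2) (\<lambda>s. - (s * f2 s + real (m + 1) * f1 s)) x +
      (if j = 3 then 1 else 0) * polar_hom (m + 1 + 1) f2 x) * e j) = d j"
      unfolding m d_def e_def by (simp add: mult.commute)
  qed
  moreover have "polar_hom (m+2) (\<lambda>s. (1 - s\<^sup>2) * f2 s - 2 * s * f1 s + real m * (real m - 1) * f s) x = (\<Sum>j\<in>UNIV. d j)"
  proof -
    define n s where "n = norm x" and "s = cos_polar x"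
    have n: "n > 0" using x0 by (simp add: n_def)
    have x3: "x $ 3 = s * n" using x0 by (simp add: s_def n_def cos_polar_def)
    have nn: "x $ 1 * x $ 1 + x $ 2 * x $ 2 + x $ 3 * x $ 3 = n\<^sup>2"
      using norm_sq_3[of x] by (simp add: n_def power2_eq_square)
    have "(\<Sum>j\<in>UNIV. d j) = 3 * polar_hom (m+2) P x
      + (x $ 1 * x $ 1 + x $ 2 * x $ 2 + x $ 3 * x $ 3) * polar_hom (m+4) (\<lambda>s. - (s * P1 s + real (m+2) * P s)) x
      + x $ 3 * polar_hom (m+3) P1 x + x $ 3 * polar_hom (m+3) (\<lambda>s. - (s * f2 s + real (m+1) * f1 s)) x
      + polar_hom (m+2) f2 x"
      by (simp add: d_def e_def sum_3 algebra_simps)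
    also have "\<dots> = (3 * P s - (s * P1 s + real (m+2) * P s) + s * P1 s - s * (s * f2 s + real (m+1) * f1 s) + f2 s) / n ^ (m+2)"
      unfolding nn unfolding x3 polar_hom_def n_def[symmetric] s_def[symmetric]
      using n by (simp add: field_simps power2_eq_square eval_nat_numeral)
    also have "\<dots> = polar_hom (m+2) (\<lambda>s. (1 - s\<^sup>2) * f2 s - 2 * s * f1 s + real m * (real m - 1) * f s) x"
      unfolding polar_hom_def n_def[symmetric] s_def[symmetric] P_def
      by (simp add: algebra_simps power2_eq_square)
    finally show ?thesis ..
  qed
  ultimately show "\<exists>d. (\<forall>j. has_pd j (\<lambda>x. x $ j * polar_hom (m+2) (\<lambda>s. - (s * f1 s + real m * f s)) x
     + (if j = 3 then 1 else 0) * polar_hom (m+1) f1 x) (d j) x) \<and>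
     polar_hom (m+2) (\<lambda>s. (1 - s\<^sup>2) * f2 s - 2 * s * f1 s + real m * (real m - 1) * f s) x = (\<Sum>j\<in>UNIV. d j)"
    unfolding P_def e_def by blast
qed

text \<open>Transfers the formulas to a field component that agrees with \<open>f\<close> only off
  the axis. Openness of \<open>off_axis\<close> is what allows differentiating the agreement
  twice.\<close>

lemma C2_data_derivatives:
  assumes "smooth_on (- {0}) g" "\<forall>x\<in>off_axis. g x = f x" "C2_data f G L" "x \<in> off_axis"
  shows "pderivative j g x = G j x" "laplacian g x = L x"
proof -
  have pd: "pderivative j g y = G j y" if y: "y \<in> off_axis" for j y
  proof (rule pderivative_eqI[OF open_off_axis y bspec[OF assms(2)]])
    show "g differentiable (at y)"
      by (rule smooth_on_diff[OF assms(1)]) (use off_axis_neq_0[OF y] in simp)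
    show "has_pd j f (G j y) y" using assms(3) y unfolding C2_data_def by blast
  qed
  then show "pderivative j g x = G j x" using assms(4) .
  obtain d where d: "\<And>j. has_pd j (G j) (d j) x" "L x = (\<Sum>j\<in>UNIV. d j)"
    using assms(3,4) unfolding C2_data_def by meson
  have "pderivative j (pderivative j g) x = d j" for j
  proof (rule pderivative_eqI[OF open_off_axis assms(4) pd _ d(1)])
    show "pderivative j g differentiable (at x)"
      by (rule smooth_on_diff[OF smooth_on_pderivative[OF assms(1)]]) (use off_axis_neq_0[OF assms(4)] in simp)
  qed
  then show "laplacian g x = L x" by (simp add: laplacian_def d(2))
qed

section \<open>Axisymmetric homogeneous fields\<close>

lemma sqrt_one_minus_cos_polar:
  assumes "x \<in> off_axis"
  shows "norm x * sqrt (1 - (cos_polar x)\<^sup>2) = sqrt ((x $ 1)\<^sup>2 + (x $ 2)\<^sup>2)"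
proof -
  have x0: "norm x > 0" using off_axis_neq_0[OF assms] by simp
  have "(norm x)\<^sup>2 * (1 - (cos_polar x)\<^sup>2) = (norm x)\<^sup>2 - (x $ 3)\<^sup>2"
    using x0 by (simp add: cos_polar_def power_divide right_diff_distrib)
  then have "(norm x)\<^sup>2 * (1 - (cos_polar x)\<^sup>2) = (x $ 1)\<^sup>2 + (x $ 2)\<^sup>2"
    using norm_sq_3[of x] by simp
  then show ?thesis using x0 by (metis abs_of_pos real_sqrt_abs real_sqrt_mult)
qed

text \<open>Dividing by the sine of the polar angle turns a cylindrical component on the unit sphere
  into the coefficient of \<open>x\<close> or of \<open>e_z \<times> x\<close>.\<close>

definition hor_coeff :: "(real^3 \<Rightarrow> real) \<Rightarrow> real \<Rightarrow> real" where
  "hor_coeff f s = f (meridian (arccos s)) * inverse (sqrt (1 - s\<^sup>2))"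

text \<open>Since \<open>x\<close> itself has a vertical component, its share \<open>s * a\<close>
  is subtracted; the rest is the coefficient of \<open>e_z\<close>.\<close>

definition ver_coeff :: "(real^3 \<Rightarrow> real^3) \<Rightarrow> real \<Rightarrow> real" where
  "ver_coeff v s = v (meridian (arccos s)) $ 3 - s * hor_coeff (\<lambda>x. v x $ 1) s"

lemma axisymmetric_meridian:
  assumes "axisymmetric_form v vr vt vz" "s \<in> {-1<..<1}"
  defines "w \<equiv> sqrt (1 - s\<^sup>2)"
  shows "v (meridian (arccos s)) $ 1 = vr w s" "v (meridian (arccos s)) $ 2 = vt w s" "v (meridian (arccos s)) $ 3 = vz w s"
proof -
  have "meridian (arccos s) = cyl_point w 0 s"
    using assms(2) by (simp add: vec_eq_iff forall_3 cyl_point_def w_def sin_arccos cos_arccos)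
  moreover have "w > 0" using one_minus_square_pos[OF assms(2)] by (simp add: w_def)
  ultimately show "v (meridian (arccos s)) $ 1 = vr w s" "v (meridian (arccos s)) $ 2 = vt w s" "v (meridian (arccos s)) $ 3 = vz w s"
    using assms(1) by (simp_all add: axisymmetric_form_def e_r_def e_theta_def e_z_def)
qed

text \<open>Homogeneity moves \<open>x\<close> to the unit sphere and axisymmetry rotates it onto
  the meridian, where the coefficients were defined.\<close>

lemma axisymmetric_homogeneous:
  assumes ax: "axisymmetric_form v vr vt vz" and hom: "neg_homogeneous 1 v" and x: "x \<in> off_axis"
  defines "A \<equiv> polar_hom 2 (hor_coeff (\<lambda>x. v x $ 1)) x" and "C \<equiv> polar_hom 2 (hor_coeff (\<lambda>x. v x $ 2)) x"
    and "E \<equiv> polar_hom 1 (ver_coeff v) x"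
  shows "v x $ 1 = x $ 1 * A - x $ 2 * C" "v x $ 2 = x $ 2 * A + x $ 1 * C" "v x $ 3 = x $ 3 * A + E"
proof -
  define n s w where "n = norm x" and "s = cos_polar x" and "w = sqrt (1 - s\<^sup>2)"
  have n: "n > 0" using off_axis_neq_0[OF x] by (simp add: n_def)
  have s: "s \<in> {-1<..<1}" using cos_polar_off_axis[OF x] by (simp add: s_def)
  have w: "w > 0" using one_minus_square_pos[OF s] by (simp add: w_def)
  have x3: "x $ 3 = s * n" using n by (simp add: s_def n_def cos_polar_def)
  have nw: "n * w = sqrt ((x $ 1)\<^sup>2 + (x $ 2)\<^sup>2)"
    using sqrt_one_minus_cos_polar[OF x] by (simp add: n_def w_def s_def)
  have "(n * w)\<^sup>2 = (x $ 1)\<^sup>2 + (x $ 2)\<^sup>2" unfolding nw by simp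
  moreover have "(x $ 1 / (n * w))\<^sup>2 + (x $ 2 / (n * w))\<^sup>2 = ((x $ 1)\<^sup>2 + (x $ 2)\<^sup>2) / (n * w)\<^sup>2"
    by (simp add: power_divide add_divide_distrib)
  moreover have "(n * w)\<^sup>2 \<noteq> 0" using n w by simp
  ultimately have "(x $ 1 / (n * w))\<^sup>2 + (x $ 2 / (n * w))\<^sup>2 = 1"
    by simp
  then obtain t where t: "x $ 1 / (n * w) = cos t" "x $ 2 / (n * w) = sin t"
    using sincos_total_2pi by blast
  have x12: "x $ 1 = n * w * cos t" "x $ 2 = n * w * sin t" using t n w by (auto simp: field_simps)
  have xc: "x = n *\<^sub>R cyl_point w t s"
    using x12 x3 by (simp add: vec_eq_iff forall_3 cyl_point_def mult.commute)
  have c0: "cyl_point w t s \<noteq> 0" using xc off_axis_neq_0[OF x] by auto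
  have "v x = (1 / n) *\<^sub>R v (cyl_point w t s)"
    using hom n c0 unfolding neg_homogeneous_def xc by simp
  also have "v (cyl_point w t s) = vr w s *\<^sub>R e_r t + vt w s *\<^sub>R e_theta t + vz w s *\<^sub>R e_z"
    using ax w by (simp add: axisymmetric_form_def)
  finally have v: "v x $ 1 = (vr w s * cos t - vt w s * sin t) / n"
    "v x $ 2 = (vr w s * sin t + vt w s * cos t) / n" "v x $ 3 = vz w s / n"
    by (simp_all add: e_r_def e_theta_def e_z_def algebra_simps add_divide_distrib diff_divide_distrib)
  have A: "A = vr w s / (w * n\<^sup>2)" and C: "C = vt w s / (w * n\<^sup>2)" and E: "E = (vz w s - s * (vr w s / w)) / n"
    using axisymmetric_meridian[OF ax s]
    by (simp_all add: A_def C_def E_def polar_hom_def hor_coeff_def ver_coeff_def w_def[symmetric]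
        n_def[symmetric] s_def[symmetric] divide_inverse mult_ac)
  show "v x $ 1 = x $ 1 * A - x $ 2 * C" "v x $ 2 = x $ 2 * A + x $ 1 * C" "v x $ 3 = x $ 3 * A + E"
    unfolding v A C E x3 using n w
    by (simp_all add: x12 field_simps power2_eq_square)
qed

section \<open>Reduction of the MHD system to ordinary differential equations\<close>

lemma diffn_cong:
  assumes "open S" "\<And>x. x \<in> S \<Longrightarrow> f x = g x" "diffn n S f"
  shows "diffn n S g"
proof (cases n)
  case (Suc m)
  then obtain f' where f': "\<forall>x\<in>S. (f has_real_derivative f' x) (at x)" "diffn m S f'"
    using assms(3) by auto
  have "(g has_real_derivative f' x) (at x)" if "x \<in> S" for x
    using f'(1) that by (intro has_field_derivative_transform_within_open[OF _ assms(1) that assms(2)]) blast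
  then show ?thesis unfolding Suc diffn.simps(2) using f'(2) by (intro exI[of _ f'] conjI ballI)
qed simp

lemma diffn_Suc_deriv:
  assumes "open S" "diffn (Suc n) S f"
  shows "\<And>x. x \<in> S \<Longrightarrow> (f has_real_derivative deriv f x) (at x)" "diffn n S (deriv f)"
proof -
  obtain f' where f': "\<forall>x\<in>S. (f has_real_derivative f' x) (at x)" "diffn n S f'"
    using assms(2) unfolding diffn.simps by blast
  have eq: "f' x = deriv f x" if "x \<in> S" for x using f'(1) that DERIV_imp_deriv by metis
  show "(f has_real_derivative deriv f x) (at x)" if "x \<in> S" for x
    using f'(1) that eq[OF that] by metis
  show "diffn n S (deriv f)" by (rule diffn_cong[OF assms(1) eq f'(2)])
qed

lemma diffn_derivs:
  assumes "\<And>n. diffn n {-1<..<1} f" "s \<in> {-1<..<1}"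
  shows "(f has_real_derivative deriv f s) (at s)"
    "(deriv f has_real_derivative deriv (deriv f) s) (at s)"
    "(deriv (deriv f) has_real_derivative deriv (deriv (deriv f)) s) (at s)"
proof -
  have o: "open {-1<..<1::real}" by simp
  have 1: "diffn 2 {-1<..<1} (deriv f)"
    by (rule diffn_Suc_deriv(2)[OF o]) (rule assms(1))
  have 2: "diffn 1 {-1<..<1} (deriv (deriv f))"
    using diffn_Suc_deriv(2)[OF o, of 1 "deriv f"] 1 by (simp add: numeral_2_eq_2)
  show "(f has_real_derivative deriv f s) (at s)"
    by (rule diffn_Suc_deriv(1)[OF o assms(1) assms(2)])
  show "(deriv f has_real_derivative deriv (deriv f) s) (at s)"
    using diffn_Suc_deriv(1)[OF o, of 1 "deriv f"] 1 assms(2) by (simp add: numeral_2_eq_2)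
  show "(deriv (deriv f) has_real_derivative deriv (deriv (deriv f)) s) (at s)"
    using diffn_Suc_deriv(1)[OF o, of 0 "deriv (deriv f)"] 2 assms(2) by simp
qed

lemma diffn_hor_coeff:
  assumes "smooth_on (- {0}) f" shows "diffn n {-1<..<1} (hor_coeff f)"
  unfolding hor_coeff_def[abs_def]
  by (intro diffn_mult diffn_meridian_arccos assms diffn_inverse_sqrt)

lemma diffn_ver_coeff:
  assumes "smooth_on (- {0}) v" shows "diffn n {-1<..<1} (ver_coeff v)"
  unfolding ver_coeff_def[abs_def]
  by (intro diffn_diff diffn_mult diffn_ident diffn_meridian_arccos diffn_hor_coeff smooth_on_component assms)
    (simp_all add: open_Compl)

text \<open>\<open>rad_hom\<close> and \<open>axial_hom\<close> are the coefficients of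
  \<open>x\<close> and \<open>e_z\<close> in the gradient of \<open>polar_hom m f\<close>, and
  \<open>lap_hom\<close> is its Laplacian.\<close>

definition rad_hom :: "nat \<Rightarrow> (real \<Rightarrow> real) \<Rightarrow> real^3 \<Rightarrow> real" where
  "rad_hom m f = polar_hom (m+2) (\<lambda>s. - (s * deriv f s + real m * f s))"

definition axial_hom :: "nat \<Rightarrow> (real \<Rightarrow> real) \<Rightarrow> real^3 \<Rightarrow> real" where
  "axial_hom m f = polar_hom (m+1) (deriv f)"

definition lap_hom :: "nat \<Rightarrow> (real \<Rightarrow> real) \<Rightarrow> real^3 \<Rightarrow> real" where
  "lap_hom m f = polar_hom (m+2) (\<lambda>s. (1 - s\<^sup>2) * deriv (deriv f) s - 2 * s * deriv f s
     + real m * (real m - 1) * f s)"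

definition grad_hom :: "nat \<Rightarrow> (real \<Rightarrow> real) \<Rightarrow> 3 \<Rightarrow> real^3 \<Rightarrow> real" where
  "grad_hom m f j x = x $ j * rad_hom m f x + (if j = 3 then 1 else 0) * axial_hom m f x"

lemma grad_hom_nth:
  "grad_hom m f 1 x = x $ 1 * rad_hom m f x"
  "grad_hom m f 2 x = x $ 2 * rad_hom m f x"
  "grad_hom m f 3 x = x $ 3 * rad_hom m f x + axial_hom m f x"
  by (simp_all add: grad_hom_def)

lemma C2_data_hom:
  assumes "\<And>n. diffn n {-1<..<1} f"
  shows "C2_data (polar_hom m f) (grad_hom m f) (lap_hom m f)"
  unfolding grad_hom_def[abs_def] lap_hom_def rad_hom_def axial_hom_def
  by (rule C2_data_polar_hom) (use diffn_derivs[OF assms] in blast)+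

lemma polar_hom_meridian:
  assumes "s \<in> {-1<..<1}"
  shows "polar_hom m f (meridian (arccos s)) = f s"
  using assms by (simp add: polar_hom_def cos_polar_def)

lemma hom_meridian:
  assumes "s \<in> {-1<..<1}"
  shows "rad_hom m f (meridian (arccos s)) = - (s * deriv f s + real m * f s)"
    "axial_hom m f (meridian (arccos s)) = deriv f s"
    "lap_hom m f (meridian (arccos s)) = (1 - s\<^sup>2) * deriv (deriv f) s - 2 * s * deriv f s
     + real m * (real m - 1) * f s"
  by (simp_all add: rad_hom_def axial_hom_def lap_hom_def polar_hom_meridian[OF assms])

lemma meridian_off_axis:
  assumes "s \<in> {-1<..<1}" shows "meridian (arccos s) \<in> off_axis"
  using one_minus_square_pos[OF assms] assms by (simp add: off_axis_def sin_arccos)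

lemma sin_arccos_square:
  assumes "s \<in> {-1<..<1}"
  shows "sin (arccos s) * sin (arccos s) = 1 - s\<^sup>2" "sin (arccos s) \<noteq> 0"
proof -
  show 1: "sin (arccos s) * sin (arccos s) = 1 - s\<^sup>2"
    using assms sin_squared_eq[of "arccos s"] by (simp add: power2_eq_square)
  then show "sin (arccos s) \<noteq> 0" using one_minus_square_pos[OF assms] by auto
qed

lemma polar_hom_cong:
  "norm x = norm y \<Longrightarrow> x $ 3 = y $ 3 \<Longrightarrow> polar_hom m f x = polar_hom m f y"
  by (simp add: polar_hom_def cos_polar_def)

locale axisymmetric_MHD =
  fixes u B :: "real^3 \<Rightarrow> real^3" and p :: "real^3 \<Rightarrow> real"
    and ur ut uz Bt :: "real \<Rightarrow> real \<Rightarrow> real"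
  assumes sol: "smooth_MHD_solution u B p"
    and sim: "self_similar u B p"
    and axi_u: "axisymmetric_form u ur ut uz"
    and axi_B: "axisymmetric_form B (\<lambda>r z. 0) Bt (\<lambda>r z. 0)"
begin

lemma smooth: "smooth_on (- {0}) u" "smooth_on (- {0}) B" "smooth_on (- {0}) p"
  using sol by (simp_all add: smooth_MHD_solution_def)

lemma smooth_comp: "smooth_on (- {0}) (\<lambda>x. u x $ i)" "smooth_on (- {0}) (\<lambda>x. B x $ i)"
  by (rule smooth_on_component[OF _ smooth(1)] smooth_on_component[OF _ smooth(2)], simp add: open_Compl)+

lemma homogeneous: "neg_homogeneous 1 u" "neg_homogeneous 1 B" "neg_homogeneous 2 p"
proof -
  have "u (l *\<^sub>R x) = (1 / l) *\<^sub>R u x" "B (l *\<^sub>R x) = (1 / l) *\<^sub>R B x" "p (l *\<^sub>R x) = (1 / l\<^sup>2) *\<^sub>R p x"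
    if "l > 0" "x \<noteq> 0" for l x
  proof -
    have "u x = l *\<^sub>R u (l *\<^sub>R x)" "B x = l *\<^sub>R B (l *\<^sub>R x)" "p x = l\<^sup>2 * p (l *\<^sub>R x)"
      using sim that unfolding self_similar_def by blast+
    then show "u (l *\<^sub>R x) = (1 / l) *\<^sub>R u x" "B (l *\<^sub>R x) = (1 / l) *\<^sub>R B x" "p (l *\<^sub>R x) = (1 / l\<^sup>2) *\<^sub>R p x"
      using that by simp_all
  qed
  then show "neg_homogeneous 1 u" "neg_homogeneous 1 B" "neg_homogeneous 2 p"
    by (simp_all add: neg_homogeneous_def)
qed

text \<open>With \<open>s\<close> the cosine of the polar angle, off the axis
  \<open>u = a x / |x|\<^sup>2 + b e\<^sub>z / |x| + g (e\<^sub>z \<times> x) / |x|\<^sup>2\<close> and \<open>B = k (e\<^sub>z \<times> x) / |x|\<^sup>2\<close>.\<close>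

abbreviation "a \<equiv> hor_coeff (\<lambda>x. u x $ 1)"
abbreviation "g \<equiv> hor_coeff (\<lambda>x. u x $ 2)"
abbreviation "b \<equiv> ver_coeff u"
abbreviation "k \<equiv> hor_coeff (\<lambda>x. B x $ 2)"

lemma coeff_diffn: "diffn n {-1<..<1} a" "diffn n {-1<..<1} g" "diffn n {-1<..<1} b" "diffn n {-1<..<1} k"
  by (rule diffn_hor_coeff[OF smooth_comp(1)] diffn_hor_coeff[OF smooth_comp(2)] diffn_ver_coeff[OF smooth(1)])+

text \<open>The factors \<open>1 *\<close> and \<open>(-1) *\<close> are kept so that each term has
  the shape \<open>c * x $ i * g x\<close> expected by \<open>C2_data_coord_mult\<close>.\<close>

lemma u_rep:
  assumes "x \<in> off_axis"
  shows "u x $ 1 = 1 * x $ 1 * polar_hom 2 a x + (-1) * x $ 2 * polar_hom 2 g x"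
    "u x $ 2 = 1 * x $ 2 * polar_hom 2 a x + 1 * x $ 1 * polar_hom 2 g x"
    "u x $ 3 = 1 * x $ 3 * polar_hom 2 a x + polar_hom 1 b x"
  using axisymmetric_homogeneous[OF axi_u homogeneous(1) assms] by simp_all

lemma u_rep_ball:
  "\<forall>x\<in>off_axis. u x $ 1 = 1 * x $ 1 * polar_hom 2 a x + (-1) * x $ 2 * polar_hom 2 g x"
  "\<forall>x\<in>off_axis. u x $ 2 = 1 * x $ 2 * polar_hom 2 a x + 1 * x $ 1 * polar_hom 2 g x"
  "\<forall>x\<in>off_axis. u x $ 3 = 1 * x $ 3 * polar_hom 2 a x + polar_hom 1 b x"
  by (intro ballI u_rep; assumption)+

lemma B_rep:
  assumes "x \<in> off_axis"
  shows "B x $ 1 = (-1) * x $ 2 * polar_hom 2 k x" "B x $ 2 = 1 * x $ 1 * polar_hom 2 k x" "B x $ 3 = 0"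
proof -
  have c: "hor_coeff (\<lambda>x. B x $ 1) s = 0" "ver_coeff B s = 0" if "s \<in> {-1<..<1}" for s
    using axisymmetric_meridian[OF axi_B that] by (simp_all add: hor_coeff_def ver_coeff_def)
  have "polar_hom 2 (hor_coeff (\<lambda>x. B x $ 1)) x = 0" "polar_hom 1 (ver_coeff B) x = 0"
    using c[OF cos_polar_off_axis[OF assms]] by (simp_all add: polar_hom_def)
  then show "B x $ 1 = (-1) * x $ 2 * polar_hom 2 k x" "B x $ 2 = 1 * x $ 1 * polar_hom 2 k x" "B x $ 3 = 0"
    using axisymmetric_homogeneous[OF axi_B homogeneous(2) assms] by simp_all
qed

lemma B_rep_ball:
  "\<forall>x\<in>off_axis. B x $ 1 = (-1) * x $ 2 * polar_hom 2 k x"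
  "\<forall>x\<in>off_axis. B x $ 2 = 1 * x $ 1 * polar_hom 2 k x"
  "\<forall>x\<in>off_axis. B x $ 3 = 0"
  by (intro ballI B_rep; assumption)+

lemmas u_data = C2_data_derivatives[OF smooth_comp(1)
    u_rep_ball(1) C2_data_add[OF C2_data_coord_mult[OF C2_data_hom[OF coeff_diffn(1)]]
      C2_data_coord_mult[OF C2_data_hom[OF coeff_diffn(2)]]]]
  C2_data_derivatives[OF smooth_comp(1)
    u_rep_ball(2) C2_data_add[OF C2_data_coord_mult[OF C2_data_hom[OF coeff_diffn(1)]]
      C2_data_coord_mult[OF C2_data_hom[OF coeff_diffn(2)]]]]
  C2_data_derivatives[OF smooth_comp(1)
    u_rep_ball(3) C2_data_add[OF C2_data_coord_mult[OF C2_data_hom[OF coeff_diffn(1)]]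
      C2_data_hom[OF coeff_diffn(3)]]]

lemma C2_data_zero: "C2_data (\<lambda>x. 0) (\<lambda>j x. 0) (\<lambda>x. 0)"
  unfolding C2_data_def
proof (intro ballI conjI allI)
  fix x j show "has_pd j (\<lambda>x. 0) 0 x" by (rule has_pd_const)
  show "\<exists>d. (\<forall>j. has_pd j (\<lambda>x. 0) (d j) x) \<and> 0 = (\<Sum>j\<in>UNIV. d j)"
    by (intro exI[of _ "\<lambda>_. 0"]) (simp add: has_pd_const)
qed

lemmas B_data = C2_data_derivatives[OF smooth_comp(2) B_rep_ball(1) C2_data_coord_mult[OF C2_data_hom[OF coeff_diffn(4)]]]
  C2_data_derivatives[OF smooth_comp(2) B_rep_ball(2) C2_data_coord_mult[OF C2_data_hom[OF coeff_diffn(4)]]]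
  C2_data_derivatives[OF smooth_comp(2) B_rep_ball(3) C2_data_zero]

lemma momentum_eq:
  assumes "x \<noteq> 0"
  shows "pderivative i p x = laplacian (\<lambda>x. u x $ i) x
    - (\<Sum>j\<in>UNIV. u x $ j * pderivative j (\<lambda>x. u x $ i) x) + (\<Sum>j\<in>UNIV. B x $ j * pderivative j (\<lambda>x. B x $ i) x)"
proof -
  have x: "x \<in> - {0}" and o: "open (- {0 :: real^3})" using assms by (auto simp: open_Compl)
  have "(- laplacian u x + advect u u x - advect B B x + gradient p x) $ i = 0"
    using sol assms unfolding smooth_MHD_solution_def by simp
  then show ?thesis
    using laplacian_component[OF o smooth(1) x, of i] advect_component[OF smooth_on_diff[OF smooth(1) x], of u i]
      advect_component[OF smooth_on_diff[OF smooth(2) x], of B i]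
    by (simp add: gradient_def)
qed

lemma induction_eq:
  assumes "x \<noteq> 0"
  shows "laplacian (\<lambda>x. B x $ i) x = (\<Sum>j\<in>UNIV. u x $ j * pderivative j (\<lambda>x. B x $ i) x)
    - (\<Sum>j\<in>UNIV. B x $ j * pderivative j (\<lambda>x. u x $ i) x)"
proof -
  have x: "x \<in> - {0}" and o: "open (- {0 :: real^3})" using assms by (auto simp: open_Compl)
  have "(- laplacian B x + advect u B x - advect B u x) $ i = 0"
    using sol assms unfolding smooth_MHD_solution_def by simp
  then show ?thesis
    using laplacian_component[OF o smooth(2) x, of i] advect_component[OF smooth_on_diff[OF smooth(2) x], of u i]
      advect_component[OF smooth_on_diff[OF smooth(1) x], of B i]
    by simp
qed

text \<open>Euler's identity \<open>x \<bullet> \<nabla>p = - 2 p\<close> transfers the axisymmetry of \<open>u\<close> and \<open>B\<close> to the pressure.\<close>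

lemma pressure_formula:
  assumes x: "x \<in> off_axis"
  defines "R \<equiv> (x $ 1)\<^sup>2 + (x $ 2)\<^sup>2" and "z \<equiv> x $ 3"
    and "A \<equiv> polar_hom 2 a x" and "C \<equiv> polar_hom 2 g x" and "E \<equiv> polar_hom 1 b x" and "K \<equiv> polar_hom 2 k x"
    and "Ar \<equiv> rad_hom 2 a x" and "Az \<equiv> axial_hom 2 a x" and "Er \<equiv> rad_hom 1 b x" and "Ez \<equiv> axial_hom 1 b x"
  shows "- 2 * p x = 2 * ((R + z\<^sup>2) * Ar + z * Az) + (R + z\<^sup>2) * lap_hom 2 a x + z * lap_hom 1 b x
    - (2 * ((R + z\<^sup>2) * A + z * E) * A + (R + z\<^sup>2) * (((R + z\<^sup>2) * A + z * E) * Ar + (z * A + E) * Az)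
      + (z * A + E) * E + z * (((R + z\<^sup>2) * A + z * E) * Er + (z * A + E) * Ez)
      - (R * A\<^sup>2 + R * C\<^sup>2 + (z * A + E)\<^sup>2)) - R * K\<^sup>2"
proof -
  have x0: "x \<noteq> 0" by (rule off_axis_neq_0[OF x])
  have "(\<Sum>j\<in>UNIV. x $ j * pderivative j p x) = - (real 2 * p x)"
    using smooth_on_diff[OF smooth(3)] x0
    by (intro homog_Euler neg_homogeneous_homog homogeneous(3)) auto
  then have "- 2 * p x = (\<Sum>j\<in>UNIV. x $ j * pderivative j p x)" by simp
  also have "\<dots> = 2 * ((R + z\<^sup>2) * Ar + z * Az) + (R + z\<^sup>2) * lap_hom 2 a x + z * lap_hom 1 b x
    - (2 * ((R + z\<^sup>2) * A + z * E) * A + (R + z\<^sup>2) * (((R + z\<^sup>2) * A + z * E) * Ar + (z * A + E) * Az)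
      + (z * A + E) * E + z * (((R + z\<^sup>2) * A + z * E) * Er + (z * A + E) * Ez)
      - (R * A\<^sup>2 + R * C\<^sup>2 + (z * A + E)\<^sup>2)) - R * K\<^sup>2"
    unfolding sum_3 momentum_eq[OF x0] u_data[OF x] B_data[OF x] u_rep[OF x] B_rep[OF x] grad_hom_nth
      R_def z_def A_def C_def E_def K_def Ar_def Az_def Er_def Ez_def
    by (simp, simp add: algebra_simps power2_eq_square)
  finally show ?thesis .
qed

definition q :: "real \<Rightarrow> real" where "q s = p (meridian (arccos s))"

lemma q_diffn: "diffn n {-1<..<1} q"
  unfolding q_def[abs_def] by (rule diffn_meridian_arccos[OF smooth(3)])

lemma p_rep:
  assumes x: "x \<in> off_axis" shows "p x = polar_hom 2 q x"
proof -
  define n s where "n = norm x" and "s = cos_polar x"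
  have n: "n > 0" using off_axis_neq_0[OF x] by (simp add: n_def)
  have s: "s \<in> {-1<..<1}" using cos_polar_off_axis[OF x] by (simp add: s_def)
  have x3: "x $ 3 = n * s" using n by (simp add: s_def n_def cos_polar_def)
  define y where "y = n *\<^sub>R meridian (arccos s)"
  have y: "y \<in> off_axis" using meridian_off_axis[OF s] n by (auto simp: y_def off_axis_def)
  have ny: "norm x = norm y" using n by (simp add: y_def n_def)
  have y3: "x $ 3 = y $ 3" using s by (simp add: y_def x3)
  have R: "(x $ 1)\<^sup>2 + (x $ 2)\<^sup>2 = (y $ 1)\<^sup>2 + (y $ 2)\<^sup>2"
    using norm_sq_3[of x] norm_sq_3[of y] ny y3 by simp
  \<comment> \<open>The right-hand side of \<open>pressure_formula\<close> involves the point only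
    through \<open>norm x\<close>, \<open>x $ 3\<close> and the squared distance to the axis, which
    \<open>x\<close> and the meridian point \<open>y\<close> share.\<close>
  have "- 2 * p x = - 2 * p y"
    unfolding pressure_formula[OF x] pressure_formula[OF y] R y3 rad_hom_def axial_hom_def lap_hom_def polar_hom_cong[OF ny y3] ..
  then have "p x = p y" by simp
  also have "\<dots> = (1 / n\<^sup>2) *\<^sub>R p (meridian (arccos s))"
    using homogeneous(3) n unfolding y_def neg_homogeneous_def by simp
  also have "\<dots> = polar_hom 2 q x" by (simp add: polar_hom_def q_def n_def s_def)
  finally show ?thesis .
qed

lemma p_rep_ball: "\<forall>x\<in>off_axis. p x = polar_hom 2 q x"
  using p_rep by blast

lemmas p_data = C2_data_derivatives(1)[OF smooth(3) p_rep_ball C2_data_hom[OF q_diffn]]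

text \<open>By Euler's identity \<open>A * x\<close> with \<open>A\<close> homogeneous of degree -2
  has divergence \<open>A\<close>, the rotational part has none, and the vertical derivative of
  \<open>b / |x|\<close> supplies the terms in \<open>b\<close>.\<close>

lemma ode_divergence:
  assumes s: "s \<in> {-1<..<1}" shows "a s = s * b s - (1 - s\<^sup>2) * deriv b s"
proof -
  have x: "meridian (arccos s) \<in> off_axis" by (rule meridian_off_axis[OF s])
  have w: "(sin (arccos s))\<^sup>2 = 1 - s\<^sup>2" using sin_arccos_square(1)[OF s] by (simp add: power2_eq_square)
  have c: "cos (arccos s) = s" using s by simp
  have "divergence u (meridian (arccos s)) = 0"
    using sol off_axis_neq_0[OF x] unfolding smooth_MHD_solution_def by blast
  then have "a s - s * b s + (sin (arccos s))\<^sup>2 * (- (s * deriv a s + 2 * a s)) + (s\<^sup>2 - 1) * (- (s * deriv a s + 2 * a s))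
      + (1 - s\<^sup>2) * deriv b s = 0"
    unfolding divergence_def sum_3 u_data[OF x] grad_hom_nth polar_hom_meridian[OF s] hom_meridian[OF s]
    by (simp add: c algebra_simps power2_eq_square)
  then show ?thesis unfolding w by (simp add: algebra_simps)
qed

text \<open>The second Cartesian component at a meridian point is the azimuthal one. Every term
  carries a factor \<open>sin (arccos s)\<close>, which is nonzero and divides out.\<close>

lemma ode_magnetic:
  assumes s: "s \<in> {-1<..<1}"
  shows "(1 - s\<^sup>2) * deriv (deriv k) s - 4 * s * deriv k s - 2 * k s
    = - 2 * a s * k s - 2 * s * b s * k s + (1 - s\<^sup>2) * b s * deriv k s"
proof -
  define w where "w = sin (arccos s)"
  have x: "meridian (arccos s) \<in> off_axis" by (rule meridian_off_axis[OF s])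
  have w: "w * w = 1 - s\<^sup>2" and w0: "w \<noteq> 0"
    using sin_arccos_square[OF s] by (simp_all add: w_def)
  have c: "cos (arccos s) = s" using s by simp
  have "w * (2 * (- (s * deriv k s + 2 * k s)) + ((1 - s\<^sup>2) * deriv (deriv k) s - 2 * s * deriv k s + 2 * k s))
    = w * (a s * (k s + (w * w) * (- (s * deriv k s + 2 * k s)))
       + (s * a s + b s) * (s * (- (s * deriv k s + 2 * k s)) + deriv k s) - k s * a s)"
    using induction_eq[OF off_axis_neq_0[OF x], of 2]
    unfolding sum_3 u_data[OF x] B_data[OF x] u_rep[OF x] B_rep[OF x] grad_hom_nth polar_hom_meridian[OF s] hom_meridian[OF s]
    by (simp add: c w_def algebra_simps)
  then have "2 * (- (s * deriv k s + 2 * k s)) + ((1 - s\<^sup>2) * deriv (deriv k) s - 2 * s * deriv k s + 2 * k s)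
    = a s * (k s + (1 - s\<^sup>2) * (- (s * deriv k s + 2 * k s)))
       + (s * a s + b s) * (s * (- (s * deriv k s + 2 * k s)) + deriv k s) - k s * a s"
    using w0 unfolding w by simp
  then show ?thesis by (simp add: algebra_simps power2_eq_square)
qed

text \<open>On the meridian plane axisymmetry of the pressure makes its azimuthal derivative vanish,
  and a purely azimuthal \<open>B\<close> exerts no azimuthal tension, so the equation is linear and
  homogeneous in \<open>g\<close>.\<close>

lemma ode_swirl:
  assumes s: "s \<in> {-1<..<1}"
  shows "(1 - s\<^sup>2) * deriv (deriv g) s - 4 * s * deriv g s - 2 * g s
    = b s * ((1 - s\<^sup>2) * deriv g s - 2 * s * g s)"
proof -
  define w where "w = sin (arccos s)"
  have x: "meridian (arccos s) \<in> off_axis" by (rule meridian_off_axis[OF s])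
  have w: "w * w = 1 - s\<^sup>2" and w0: "w \<noteq> 0"
    using sin_arccos_square[OF s] by (simp_all add: w_def)
  have c: "cos (arccos s) = s" using s by simp
  have "w * (2 * (- (s * deriv g s + 2 * g s)) + ((1 - s\<^sup>2) * deriv (deriv g) s - 2 * s * deriv g s + 2 * g s))
    = w * (a s * (g s + (w * w) * (- (s * deriv g s + 2 * g s))) + g s * a s
       + (s * a s + b s) * (s * (- (s * deriv g s + 2 * g s)) + deriv g s))"
    using momentum_eq[OF off_axis_neq_0[OF x], of 2]
    unfolding sum_3 u_data[OF x] B_data[OF x] p_data[OF x] u_rep[OF x] B_rep[OF x] grad_hom_nth polar_hom_meridian[OF s] hom_meridian[OF s]
    by (simp add: c w_def algebra_simps)
  then have "2 * (- (s * deriv g s + 2 * g s)) + ((1 - s\<^sup>2) * deriv (deriv g) s - 2 * s * deriv g s + 2 * g s)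
    = a s * (g s + (1 - s\<^sup>2) * (- (s * deriv g s + 2 * g s))) + g s * a s
       + (s * a s + b s) * (s * (- (s * deriv g s + 2 * g s)) + deriv g s)"
    using w0 unfolding w by simp
  then show ?thesis by (simp add: algebra_simps power2_eq_square)
qed

text \<open>Components 1, divided by the sine, and 3 of the momentum equation. The conditions on
  \<open>g\<close> and \<open>k\<close> remove the centrifugal term and the magnetic tension; in the
  second equation the transport part of \<open>deriv b\<close> is rewritten by the divergence
  relation.\<close>

lemma ode_poloidal:
  assumes s: "s \<in> {-1<..<1}" and g0: "g s = 0" and k0: "k s = 0"
  shows "- 2 * q s - s * deriv q s =
       ((1 - s\<^sup>2) * deriv (deriv a) s - 2 * s * deriv a s + 2 * a s)
       - (- 2 * (a s)\<^sup>2 + b s * (- 2 * s * a s + (1 - s\<^sup>2) * deriv a s))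
       - (a s)\<^sup>2 - 4 * a s - 2 * s * deriv a s"
    "- 2 * s * q s + (1 - s\<^sup>2) * deriv q s =
       s * (((1 - s\<^sup>2) * deriv (deriv a) s - 2 * s * deriv a s + 2 * a s)
       - (- 2 * (a s)\<^sup>2 + b s * (- 2 * s * a s + (1 - s\<^sup>2) * deriv a s))
       - (a s)\<^sup>2) + 2 * (- 2 * s * a s + (1 - s\<^sup>2) * deriv a s)
       + (1 - s\<^sup>2) * deriv (deriv b) s - 2 * s * deriv b s + a s * b s"
proof -
  define w where "w = sin (arccos s)"
  have x: "meridian (arccos s) \<in> off_axis" by (rule meridian_off_axis[OF s])
  have w: "w * w = 1 - s\<^sup>2" and w0: "w \<noteq> 0"
    using sin_arccos_square[OF s] by (simp_all add: w_def)
  have c: "cos (arccos s) = s" using s by simp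
  have ez: "(1 - s\<^sup>2) * deriv b s = s * b s - a s" using ode_divergence[OF s] by simp
  have "w * (- (s * deriv q s + 2 * q s))
    = w * (2 * (- (s * deriv a s + 2 * a s)) + ((1 - s\<^sup>2) * deriv (deriv a) s - 2 * s * deriv a s + 2 * a s)
      - (a s * (a s + (w * w) * (- (s * deriv a s + 2 * a s)))
       + (s * a s + b s) * (s * (- (s * deriv a s + 2 * a s)) + deriv a s)))"
    using momentum_eq[OF off_axis_neq_0[OF x], of 1]
    unfolding sum_3 u_data[OF x] B_data[OF x] p_data[OF x] u_rep[OF x] B_rep[OF x] grad_hom_nth polar_hom_meridian[OF s] hom_meridian[OF s]
    by (simp add: c w_def g0 k0 algebra_simps)
  then have "- (s * deriv q s + 2 * q s)
    = 2 * (- (s * deriv a s + 2 * a s)) + ((1 - s\<^sup>2) * deriv (deriv a) s - 2 * s * deriv a s + 2 * a s)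
      - (a s * (a s + (1 - s\<^sup>2) * (- (s * deriv a s + 2 * a s)))
       + (s * a s + b s) * (s * (- (s * deriv a s + 2 * a s)) + deriv a s))"
    using w0 unfolding w by simp
  then show "- 2 * q s - s * deriv q s =
       ((1 - s\<^sup>2) * deriv (deriv a) s - 2 * s * deriv a s + 2 * a s)
       - (- 2 * (a s)\<^sup>2 + b s * (- 2 * s * a s + (1 - s\<^sup>2) * deriv a s))
       - (a s)\<^sup>2 - 4 * a s - 2 * s * deriv a s"
    by (simp add: algebra_simps power2_eq_square)
  have "s * (- (s * deriv q s + 2 * q s)) + deriv q s
    = 2 * (s * (- (s * deriv a s + 2 * a s)) + deriv a s)
      + s * ((1 - s\<^sup>2) * deriv (deriv a) s - 2 * s * deriv a s + 2 * a s)
      + ((1 - s\<^sup>2) * deriv (deriv b) s - 2 * s * deriv b s)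
      - (a s * (w * w) * (s * (- (s * deriv a s + 2 * a s)) - (s * deriv b s + b s))
       + (s * a s + b s) * (a s + s * (s * (- (s * deriv a s + 2 * a s)) + deriv a s)
          + s * (- (s * deriv b s + b s)) + deriv b s))"
    using momentum_eq[OF off_axis_neq_0[OF x], of 3]
    unfolding sum_3 u_data[OF x] B_data[OF x] p_data[OF x] u_rep[OF x] B_rep[OF x] grad_hom_nth polar_hom_meridian[OF s] hom_meridian[OF s]
    by (simp add: c w_def g0 k0 algebra_simps)
  then show "- 2 * s * q s + (1 - s\<^sup>2) * deriv q s =
       s * (((1 - s\<^sup>2) * deriv (deriv a) s - 2 * s * deriv a s + 2 * a s)
       - (- 2 * (a s)\<^sup>2 + b s * (- 2 * s * a s + (1 - s\<^sup>2) * deriv a s))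
       - (a s)\<^sup>2) + 2 * (- 2 * s * a s + (1 - s\<^sup>2) * deriv a s)
       + (1 - s\<^sup>2) * deriv (deriv b) s - 2 * s * deriv b s + a s * b s"
    unfolding w using ez by algebra
qed

end

section \<open>Boundary data at the poles and the classification\<close>

section \<open>Behaviour on the axis\<close>

text \<open>A point of the axis is a limit of points displaced in direction 1, and the approach
  avoids the origin, so continuity carries the equality over.\<close>

lemma off_axis_dense:
  fixes f h :: "real^3 \<Rightarrow> real"
  assumes "continuous_on (- {0}) f" "continuous_on (- {0}) h"
    and "\<And>x. x \<in> off_axis \<Longrightarrow> f x = h x" and x: "x \<noteq> 0"
  shows "f x = h x"
proof (cases "x \<in> off_axis")
  case False
  then have x12: "x $ 1 = 0" "x $ 2 = 0" by (auto simp: off_axis_def)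
  define y where "y = (\<lambda>t::real. x + t *\<^sub>R axis 1 1)"
  have y: "y t \<noteq> 0" for t
  proof
    assume "y t = 0"
    then have "y t $ i = 0" for i by simp
    from this[of 1] this[of 2] this[of 3] have "x $ 3 = 0" by (simp add: y_def axis_def)
    with x12 x show False by (simp add: vec_eq_iff forall_3)
  qed
  have "f (y 0) - h (y 0) = 0"
  proof (rule continuous_constant_on_closure[where S = "{0<..<1}" and f = "\<lambda>t. f (y t) - h (y t)"])
    have "continuous_on UNIV y" unfolding y_def by (intro continuous_intros)
    then show "continuous_on (closure {0<..<1}) (\<lambda>t. f (y t) - h (y t))"
      using y by (intro continuous_on_diff continuous_on_compose2[OF assms(1)] continuous_on_compose2[OF assms(2)])
        (auto intro: continuous_on_subset)
    show "f (y t) - h (y t) = 0" if "t \<in> {0<..<1}" for t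
      using assms(3)[of "y t"] that x12 by (simp add: off_axis_def y_def axis_def)
  qed simp
  then show ?thesis by (simp add: y_def)
qed (use assms in simp)

lemma tendsto_ratio_of_derivatives:
  fixes f h :: "real \<Rightarrow> real"
  assumes "(f has_real_derivative d) (at c)" "(h has_real_derivative e) (at c)" "f c = 0" "h c = 0" "e \<noteq> 0"
  shows "((\<lambda>t. f t / h t) \<longlongrightarrow> d / e) (at c)"
proof -
  have "((\<lambda>t. (f t - f c) / (t - c)) \<longlongrightarrow> d) (at c)" "((\<lambda>t. (h t - h c) / (t - c)) \<longlongrightarrow> e) (at c)"
    using assms(1,2) by (simp_all add: has_field_derivative_iff)
  then have "((\<lambda>t. ((f t - f c) / (t - c)) / ((h t - h c) / (t - c))) \<longlongrightarrow> d / e) (at c)"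
    by (rule tendsto_divide[OF _ _ assms(5)])
  then show ?thesis
    by (rule Lim_transform_eventually) (auto simp: eventually_at_filter assms(3,4))
qed

text \<open>The axisymmetric form constrains nothing on the axis itself. Off it, rotation by
  \<open>pi\<close> reverses the horizontal component, so \<open>f t + f (- t) = 0\<close>;
  continuity extends this to \<open>t = 0\<close> and \<open>t = pi\<close>, where \<open>t\<close>
  and \<open>- t\<close> give the same point.\<close>

lemma axisymmetric_zero_on_axis:
  assumes ax: "axisymmetric_form v vr vt vz" and sm: "smooth_on (- {0}) v"
  shows "v (meridian 0) $ 1 = 0" "v (meridian pi) $ 1 = 0"
proof -
  define f where "f = (\<lambda>t. v (meridian t) $ 1)"
  have smf: "smooth_on (- {0}) (\<lambda>x. v x $ 1)" by (rule smooth_on_component[OF _ sm]) (simp add: open_Compl)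
  have cf: "continuous_on UNIV f"
    unfolding f_def using DERIV_isCont[OF DERIV_meridian[OF smf]] by (simp add: continuous_on_eq_continuous_at)
  have odd: "f t + f (- t) = 0" if t: "t \<in> {0<..<pi}" for t
  proof -
    have s: "sin t > 0" using t sin_gt_zero by simp
    have 1: "meridian t = cyl_point (sin t) 0 (cos t)" and 2: "meridian (- t) = cyl_point (sin t) pi (cos t)"
      by (simp_all add: vec_eq_iff forall_3 cyl_point_def)
    show ?thesis
      using ax s unfolding f_def 1 2 by (simp add: axisymmetric_form_def e_r_def e_theta_def e_z_def)
  qed
  have "f t + f (- t) = 0" if "t \<in> {0..pi}" for t
  proof (rule continuous_constant_on_closure[where S = "{0<..<pi}" and f = "\<lambda>t. f t + f (- t)"])
    show "continuous_on (closure {0<..<pi}) (\<lambda>t. f t + f (- t))"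
      by (intro continuous_intros continuous_on_compose2[OF cf] continuous_on_subset[OF cf]) auto
    show "t \<in> closure {0<..<pi}" using that by simp
  qed (rule odd)
  from this[of 0] this[of pi] have "f 0 = 0" "f pi + f (- pi) = 0" by simp_all
  moreover have "meridian (- pi) = meridian pi" by (simp add: vec_eq_iff forall_3)
  then have "f (- pi) = f pi" by (simp add: f_def)
  ultimately show "v (meridian 0) $ 1 = 0" "v (meridian pi) $ 1 = 0" by (simp_all add: f_def)
qed

lemma continuous_on_arccos_compose:
  assumes "continuous_on {0..pi} f"
  shows "continuous_on {-1..1} (\<lambda>s. f (arccos s))"
  by (rule continuous_on_compose2[OF assms]) (auto intro!: continuous_on_arccos' arccos_lbound arccos_ubound)

lemma DERIV_meridian_arccos:
  assumes "smooth_on (- {0}) f" "s \<in> {-1<..<1}"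
  shows "((\<lambda>s. f (meridian (arccos s))) has_real_derivative
      - (rot_deriv f (meridian (arccos s)) * inverse (sqrt (1 - s\<^sup>2)))) (at s)"
proof -
  have "(arccos has_real_derivative inverse (- sqrt (1 - s\<^sup>2))) (at s)"
    using DERIV_arccos[of s] assms(2) by simp
  from DERIV_chain2[OF DERIV_meridian[OF assms(1)] this] show ?thesis by simp
qed

lemma deriv_hor_coeff:
  assumes "smooth_on (- {0}) f" "s \<in> {-1<..<1}"
  defines "r \<equiv> inverse (sqrt (1 - s\<^sup>2))"
  shows "deriv (hor_coeff f) s = s * r ^ 3 * f (meridian (arccos s)) - rot_deriv f (meridian (arccos s)) * r\<^sup>2"
proof (rule DERIV_imp_deriv)
  show "(hor_coeff f has_real_derivative s * r ^ 3 * f (meridian (arccos s)) - rot_deriv f (meridian (arccos s)) * r\<^sup>2) (at s)"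
    unfolding hor_coeff_def[abs_def] r_def
    by (rule DERIV_cong[OF DERIV_mult[OF DERIV_meridian_arccos[OF assms(1,2)] DERIV_inverse_sqrt[OF assms(2)]]])
      (simp add: algebra_simps power2_eq_square)
qed

context axisymmetric_MHD
begin

lemma meridian_continuous:
  fixes f :: "real^3 \<Rightarrow> real"
  assumes "smooth_on (- {0}) f"
  shows "continuous_on S (\<lambda>t. f (meridian t))"
  using DERIV_isCont[OF DERIV_meridian[OF assms]] continuous_on_subset[OF _ subset_UNIV]
  by (simp add: continuous_on_eq_continuous_at continuous_at_imp_continuous_on)

lemma smooth_rot: "smooth_on (- {0}) f \<Longrightarrow> smooth_on (- {0}) (rot_deriv f)"
  by (rule smooth_on_rot_deriv) (simp_all add: open_Compl)

lemma sqrt_eq_sin_arccos: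
  assumes "s \<in> {-1<..<1}"
  shows "sin (arccos s) = sqrt (1 - s\<^sup>2)" "cos (arccos s) = s"
  using assms by (simp_all add: sin_arccos)

text \<open>\<open>G\<close> is the sine times the azimuthal velocity: continuous up to the poles
  because the velocity is, and zero there because the sine is.\<close>

lemma swirl_vanishes:
  assumes "s \<in> {-1<..<1}" shows "g s = 0"
proof (rule swirl_zero[where k = g and s = s and ?k1.0 = "deriv g" and ?k2.0 = "deriv (deriv g)" and G = "\<lambda>s. sqrt (1 - s\<^sup>2) * u (meridian (arccos s)) $ 2" and b = b])
  fix s :: real assume s: "s \<in> {-1<..<1}"
  show "(g has_real_derivative deriv g s) (at s)" "(deriv g has_real_derivative deriv (deriv g) s) (at s)"
    by (rule diffn_derivs[OF coeff_diffn(2) s])+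
  show "(1 - s\<^sup>2) * deriv (deriv g) s - 4 * s * deriv g s - 2 * g s = b s * ((1 - s\<^sup>2) * deriv g s - 2 * s * g s)"
    by (rule ode_swirl[OF s])
  have "1 - s\<^sup>2 > 0" by (rule one_minus_square_pos[OF s])
  then have "(1 - s\<^sup>2) * inverse (sqrt (1 - s\<^sup>2)) = sqrt (1 - s\<^sup>2)"
    by (simp add: real_div_sqrt flip: divide_inverse)
  then show "sqrt (1 - s\<^sup>2) * u (meridian (arccos s)) $ 2 = (1 - s\<^sup>2) * g s"
    by (simp add: hor_coeff_def)
next
  show "continuous_on {-1<..<1} b"
    by (rule continuous_at_imp_continuous_on) (blast intro: DERIV_isCont[OF diffn_derivs(1)[OF coeff_diffn(3)]])
  show "continuous_on {-1..1} (\<lambda>s. sqrt (1 - s\<^sup>2) * u (meridian (arccos s)) $ 2)"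
    by (intro continuous_intros continuous_on_arccos_compose[where f = "\<lambda>t. u (meridian t) $ 2"]
        meridian_continuous[OF smooth_comp(1)])
qed (use assms in simp_all)

lemma magnetic_vanishes:
  assumes ur: "\<And>r z. r > 0 \<Longrightarrow> r\<^sup>2 + z\<^sup>2 = 1 \<Longrightarrow> ur r z < 1 / (3 * r) + 2 * r / 3"
    and s: "s \<in> {-1<..<1}"
  shows "k s = 0"
proof -
  define h where "h = (\<lambda>t. B (meridian t) $ 2)"
  define h' where "h' = (\<lambda>t. rot_deriv (\<lambda>x. B x $ 2) (meridian t))"
  \<comment> \<open>The boundary term of \<open>energy_zero\<close> rewritten in the polar angle.
    The weights in \<open>sqrt (1 - s\<^sup>2)\<close> cancel all denominators in \<open>k\<close>,
    \<open>deriv k\<close> and \<open>b\<close>, and a factor \<open>sin t\<close> survives in every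
    term, so it is continuous and vanishes at the poles.\<close>
  define R where "R = (\<lambda>t. - (sin t)\<^sup>2 * h t * h' t + cos t * sin t * (h t)\<^sup>2 / 2
     + (sin t)\<^sup>2 * (cos t * u (meridian t) $ 1 - sin t * u (meridian t) $ 3) * (h t)\<^sup>2 / 2)"
  have cont: "continuous_on S h" "continuous_on S h'" "continuous_on S (\<lambda>t. u (meridian t) $ i)" for S i
    unfolding h_def h'_def
    by (rule meridian_continuous[OF smooth_comp(2)] meridian_continuous[OF smooth_rot[OF smooth_comp(2)]]
        meridian_continuous[OF smooth_comp(1)])+
  show ?thesis
  proof (rule energy_zero[where R = "\<lambda>s. R (arccos s)", OF diffn_derivs(1)[OF coeff_diffn(4)] diffn_derivs(2)[OF coeff_diffn(4)]
        diffn_derivs(1)[OF coeff_diffn(3)] ode_divergence ode_magnetic _ _ _ _ _ s])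
    show "continuous_on {-1..1} (\<lambda>s. R (arccos s))"
      unfolding R_def by (intro continuous_on_arccos_compose continuous_intros cont) auto
    show "R (arccos (-1)) = 0" "R (arccos 1) = 0" by (simp_all add: R_def)
    fix s :: real assume s: "s \<in> {-1<..<1}"
    define w where "w = sqrt (1 - s\<^sup>2)"
    have w: "w > 0" "w\<^sup>2 = 1 - s\<^sup>2" using one_minus_square_pos[OF s] by (simp_all add: w_def)
    have sc: "sin (arccos s) = w" "cos (arccos s) = s" using sqrt_eq_sin_arccos[OF s] by (simp_all add: w_def)
    have "a s = ur w s / w"
      by (simp add: hor_coeff_def axisymmetric_meridian(1)[OF axi_u s] w_def divide_inverse)
    \<comment> \<open>The hypothesis is used at the point \<open>r = w\<close>, \<open>z = s\<close>
      of the unit circle and multiplied by \<open>w\<close>.\<close>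
    then have "(1 - s\<^sup>2) * a s = w * ur w s"
      unfolding w(2)[symmetric] using w(1) by (simp add: power2_eq_square)
    also have "\<dots> < w * (1 / (3 * w) + 2 * w / 3)"
      using ur[of w s] w by (intro mult_strict_left_mono) auto
    also have "\<dots> = 1 / 3 + 2 * w\<^sup>2 / 3" using w(1) by (simp add: field_simps power2_eq_square)
    also have "\<dots> = 1 - 2 * s\<^sup>2 / 3" unfolding w(2) by (simp add: field_simps)
    finally show "(1 - s\<^sup>2) * a s < 1 - 2 * s\<^sup>2 / 3" .
    have k: "k s = h (arccos s) / w" and b: "b s = u (meridian (arccos s)) $ 3 - s * (u (meridian (arccos s)) $ 1 / w)"
      by (simp_all add: hor_coeff_def ver_coeff_def h_def w_def divide_inverse)
    have k1: "deriv k s = s / w ^ 3 * h (arccos s) - h' (arccos s) / w\<^sup>2"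
      unfolding deriv_hor_coeff[OF smooth_comp(2) s] h_def h'_def w_def by (simp add: divide_inverse power_inverse)
    show "R (arccos s) = sqrt (1 - s\<^sup>2) ^ 5 * k s * deriv k s - s * sqrt (1 - s\<^sup>2) ^ 3 * (k s)\<^sup>2 / 2
        - sqrt (1 - s\<^sup>2) ^ 5 * b s * (k s)\<^sup>2 / 2"
      unfolding R_def sc k k1 b w_def[symmetric] using w(1)
      by (simp add: field_simps eval_nat_numeral)
  qed
qed

text \<open>The quotient of the horizontal velocity by the sine extends continuously to the poles,
  because both have zeros there and the sine has a simple one. Thus \<open>b\<close> is bounded, and
  \<open>(1 - s\<^sup>2) * deriv b s\<close> is a continuous function of the angle whose values at
  the poles cancel to zero.\<close>

lemma vertical_coeff_regular:
  obtains C where "\<And>s. s \<in> {-1<..<1} \<Longrightarrow> \<bar>b s\<bar> \<le> C"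
    "((\<lambda>s. (1 - s\<^sup>2) * deriv b s) \<longlongrightarrow> 0) (at_left 1)" "((\<lambda>s. (1 - s\<^sup>2) * deriv b s) \<longlongrightarrow> 0) (at_right (-1))"
proof -
  define u1 where "u1 = (\<lambda>t. u (meridian t) $ 1)"
  define u3 where "u3 = (\<lambda>t. u (meridian t) $ 3)"
  define u1' where "u1' = (\<lambda>t. rot_deriv (\<lambda>x. u x $ 1) (meridian t))"
  define u3' where "u3' = (\<lambda>t. rot_deriv (\<lambda>x. u x $ 3) (meridian t))"
  have cont: "continuous_on S u1" "continuous_on S u3" "continuous_on S u1'" "continuous_on S u3'" for S
    unfolding u1_def u3_def u1'_def u3'_def
    by (rule meridian_continuous[OF smooth_comp(1)] meridian_continuous[OF smooth_rot[OF smooth_comp(1)]])+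
  have du1: "(u1 has_real_derivative u1' t) (at t)" for t
    unfolding u1_def u1'_def by (rule DERIV_meridian[OF smooth_comp(1)])
  \<comment> \<open>The values at the poles are those of l'Hospital's rule; the minus sign at
    \<open>pi\<close> is \<open>cos pi\<close>.\<close>
  define E where "E = (\<lambda>t. if t = 0 then u1' 0 else if t = pi then - u1' pi else u1 t / sin t)"
  have z: "u1 0 = 0" "u1 pi = 0"
    unfolding u1_def by (rule axisymmetric_zero_on_axis[OF axi_u smooth(1)])+
  have l0: "((\<lambda>t. u1 t / sin t) \<longlongrightarrow> u1' 0) (at 0)"
    using tendsto_ratio_of_derivatives[OF du1 DERIV_sin, of 0] z by simp
  have lpi: "((\<lambda>t. u1 t / sin t) \<longlongrightarrow> - u1' pi) (at pi)"
    using tendsto_ratio_of_derivatives[OF du1 DERIV_sin, of pi] z by simp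
  have cE: "continuous_on {0..pi} E"
  proof (rule continuous_at_imp_continuous_on, intro ballI)
    fix t :: real assume t: "t \<in> {0..pi}"
    consider "t = 0" | "t = pi" | "t \<in> {0<..<pi}" using t by force
    then show "isCont E t"
    proof cases
      case 1
      have "(E \<longlongrightarrow> u1' 0) (at 0)"
        by (rule Lim_transform_eventually[OF l0])
          (use eventually_at_ball'[OF pi_gt_zero, of 0 UNIV] in \<open>eventually_elim, auto simp: E_def dist_real_def\<close>)
      then show ?thesis using 1 by (simp add: isCont_def E_def)
    next
      case 2
      have "(E \<longlongrightarrow> - u1' pi) (at pi)"
        by (rule Lim_transform_eventually[OF lpi])
          (use eventually_at_ball'[OF pi_gt_zero, of pi UNIV] in \<open>eventually_elim, auto simp: E_def dist_real_def\<close>)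
      then show ?thesis using 2 by (simp add: isCont_def E_def)
    next
      case 3
      have "sin t \<noteq> 0" using 3 sin_gt_zero[of t] by auto
      then have "isCont (\<lambda>t. u1 t / sin t) t"
        using DERIV_isCont[OF du1] by (intro continuous_intros) auto
      moreover have "\<forall>\<^sub>F x in nhds t. x \<in> {0<..<pi}" using 3 by (intro eventually_nhds_in_open) auto
      then have "\<forall>\<^sub>F x in nhds t. E x = u1 x / sin x"
        by eventually_elim (auto simp: E_def)
      then have "isCont E t = isCont (\<lambda>t. u1 t / sin t) t" by (rule isCont_cong)
      ultimately show ?thesis by blast
    qed
  qed
  have Es: "E (arccos s) = u1 (arccos s) / sqrt (1 - s\<^sup>2)" if s: "s \<in> {-1<..<1}" for s
  proof -
    have "arccos s \<noteq> 0" "arccos s \<noteq> pi"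
      using sin_arccos_square(2)[OF s] by (metis sin_zero, metis sin_pi)
    then show ?thesis by (simp add: E_def sqrt_eq_sin_arccos(1)[OF s])
  qed
  \<comment> \<open>Multiplying \<open>deriv b\<close> by \<open>1 - s\<^sup>2\<close> leaves only
    the quotient \<open>E\<close> singular in form. At either pole the first two terms cancel by the
    choice of \<open>E\<close>, and the others contain a sine.\<close>
  define N where "N = (\<lambda>t. cos t * u1' t - (cos t)\<^sup>2 * E t - sin t * u3' t - sin t * u1 t)"
  have "continuous_on {0..pi} N"
    unfolding N_def by (intro continuous_intros cont cE)
  then have cN: "continuous_on {-1..1} (\<lambda>s. N (arccos s))" by (rule continuous_on_arccos_compose)
  have N: "(1 - s\<^sup>2) * deriv b s = N (arccos s)" if s: "s \<in> {-1<..<1}" for s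
  proof -
    define w where "w = sqrt (1 - s\<^sup>2)"
    have w: "w > 0" "w\<^sup>2 = 1 - s\<^sup>2" using one_minus_square_pos[OF s] by (simp_all add: w_def)
    have "(hor_coeff (\<lambda>x. u x $ 1) has_real_derivative deriv a s) (at s)"
      by (rule diffn_derivs[OF coeff_diffn(1) s])
    from DERIV_diff[OF DERIV_meridian_arccos[OF smooth_comp(1) s, of 3] DERIV_mult[OF DERIV_ident this]]
    have "deriv b s = - (u3' (arccos s) / w) - (a s + deriv a s * s)"
      unfolding ver_coeff_def[abs_def] u3'_def w_def by (intro DERIV_imp_deriv) (simp add: divide_inverse)
    also have "a s = u1 (arccos s) / w" by (simp add: hor_coeff_def u1_def w_def divide_inverse)
    also have "deriv a s = s / w ^ 3 * u1 (arccos s) - u1' (arccos s) / w\<^sup>2"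
      unfolding deriv_hor_coeff[OF smooth_comp(1) s] u1_def u1'_def w_def by (simp add: divide_inverse power_inverse)
    finally have d: "deriv b s = - (u3' (arccos s) / w)
        - (u1 (arccos s) / w + (s / w ^ 3 * u1 (arccos s) - u1' (arccos s) / w\<^sup>2) * s)" .
    show ?thesis
      unfolding d N_def Es[OF s] sqrt_eq_sin_arccos[OF s] w_def[symmetric] unfolding w(2)[symmetric] using w(1)
      by (simp add: field_simps eval_nat_numeral)
  qed
  have N0: "N (arccos 1) = 0" "N (arccos (-1)) = 0"
    by (simp_all add: N_def E_def)
  have "((\<lambda>s. N (arccos s)) \<longlongrightarrow> 0) (at_left 1)"
    using continuous_on_Icc_at_leftD[OF cN] N0 by simp
  moreover have "\<forall>\<^sub>F s in at_left (1::real). N (arccos s) = (1 - s\<^sup>2) * deriv b s"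
    by (rule eventually_mono[OF eventually_at_left_real[of "-1" 1]]) (simp_all add: N)
  ultimately have 1: "((\<lambda>s. (1 - s\<^sup>2) * deriv b s) \<longlongrightarrow> 0) (at_left 1)"
    by (rule Lim_transform_eventually)
  have "((\<lambda>s. N (arccos s)) \<longlongrightarrow> 0) (at_right (-1))"
    using continuous_on_Icc_at_rightD[OF cN] N0 by simp
  moreover have "\<forall>\<^sub>F s in at_right (-1::real). N (arccos s) = (1 - s\<^sup>2) * deriv b s"
    by (rule eventually_mono[OF eventually_at_right_real[of "-1" 1]]) (simp_all add: N)
  ultimately have 2: "((\<lambda>s. (1 - s\<^sup>2) * deriv b s) \<longlongrightarrow> 0) (at_right (-1))"
    by (rule Lim_transform_eventually)
  have "continuous_on {0..pi} (\<lambda>t. u3 t - cos t * E t)"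
    by (intro continuous_intros cont cE)
  then have "bounded ((\<lambda>t. u3 t - cos t * E t) ` {0..pi})"
    by (intro compact_imp_bounded compact_continuous_image) auto
  then obtain C where "\<forall>t\<in>{0..pi}. \<bar>u3 t - cos t * E t\<bar> \<le> C"
    by (auto simp: bounded_iff)
  then have C: "\<bar>u3 t - cos t * E t\<bar> \<le> C" if "t \<in> {0..pi}" for t using that by blast
  have "\<bar>b s\<bar> \<le> C" if s: "s \<in> {-1<..<1}" for s
  proof -
    have "b s = u3 (arccos s) - cos (arccos s) * E (arccos s)"
      unfolding Es[OF s] sqrt_eq_sin_arccos(2)[OF s] ver_coeff_def hor_coeff_def u3_def u1_def by (simp add: divide_inverse)
    moreover have "arccos s \<in> {0..pi}" using s by (auto intro: arccos_lbound arccos_ubound)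
    ultimately show ?thesis using C by metis
  qed
  then show thesis using that 1 2 by blast
qed

text \<open>Both signs of \<open>c\<close> are kept: they give forces in the two directions along
  the axis.\<close>

lemma coeff_classification:
  assumes k0: "\<And>s. s \<in> {-1<..<1} \<Longrightarrow> k s = 0"
  shows "(\<forall>s\<in>{-1<..<1}. a s = 0 \<and> b s = 0) \<or>
    (\<exists>c. \<bar>c\<bar> > 1 \<and> (\<forall>s\<in>{-1<..<1}. a s = Landau_alpha c s \<and> b s = Landau_beta c s \<and> q s = 2 * Landau_alpha c s))"
proof -
  obtain C where C: "\<And>s. s \<in> {-1<..<1} \<Longrightarrow> \<bar>b s\<bar> \<le> C"
    and lim: "((\<lambda>s. (1 - s\<^sup>2) * deriv b s) \<longlongrightarrow> 0) (at_left 1)" "((\<lambda>s. (1 - s\<^sup>2) * deriv b s) \<longlongrightarrow> 0) (at_right (-1))"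
    using vertical_coeff_regular by blast
  have R: "deriv b s = (b s)\<^sup>2 / 2 \<and> q s = 2 * a s" if s: "s \<in> {-1<..<1}" for s
    by (rule poloidal_Riccati[OF diffn_derivs[OF coeff_diffn(3)] diffn_derivs(1,2)[OF coeff_diffn(1)]
          diffn_derivs(1)[OF q_diffn] ode_divergence ode_poloidal[OF _ swirl_vanishes k0] C lim s])
  have a: "a s = s * b s - (1 - s\<^sup>2) * (b s)\<^sup>2 / 2" if s: "s \<in> {-1<..<1}" for s
    using ode_divergence[OF s] R[OF s] by simp
  have "(b has_real_derivative (b s)\<^sup>2 / 2) (at s)" if s: "s \<in> {-1<..<1}" for s
    using diffn_derivs(1)[OF coeff_diffn(3) s] R[OF s] by simp
  then have "(\<forall>s\<in>{-1<..<1}. b s = 0) \<or> (\<exists>c. \<bar>c\<bar> > 1 \<and> (\<forall>s\<in>{-1<..<1}. b s = 2 / (c - s)))"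
    by (rule Riccati_bounded_global) (assumption, rule C)
  then show ?thesis
  proof (elim disjE exE conjE)
    assume "\<forall>s\<in>{-1<..<1}. b s = 0"
    then show ?thesis using a by auto
  next
    fix c :: real assume c: "\<bar>c\<bar> > 1" and b: "\<forall>s\<in>{-1<..<1}. b s = 2 / (c - s)"
    have "a s = Landau_alpha c s" if s: "s \<in> {-1<..<1}" for s
    proof -
      define d where "d = c - s"
      have d: "d \<noteq> 0" "c = d + s" using c s by (auto simp: d_def)
      show ?thesis
        unfolding a[OF s] bspec[OF b s] Landau_alpha_def d_def[symmetric] using d
        by (simp add: field_simps power2_eq_square)
    qed
    then show ?thesis using b R c by (intro disjI2 exI[of _ c]) (auto simp: Landau_beta_def)
  qed
qed

lemma rigidity:
  assumes ur: "\<And>r z. r > 0 \<Longrightarrow> r\<^sup>2 + z\<^sup>2 = 1 \<Longrightarrow> ur r z < 1 / (3 * r) + 2 * r / 3"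
  shows "(Landau_solution u \<or> (\<forall>x. x \<noteq> 0 \<longrightarrow> u x = 0)) \<and> (\<forall>x. x \<noteq> 0 \<longrightarrow> B x = 0)"
proof -
  have k0: "k s = 0" if "s \<in> {-1<..<1}" for s by (rule magnetic_vanishes[OF ur that])
  have cu: "continuous_on (- {0}) (\<lambda>x. u x $ i)" and cB: "continuous_on (- {0}) (\<lambda>x. B x $ i)" for i
    by (rule smooth_on_continuous[OF smooth_comp(1)] smooth_on_continuous[OF smooth_comp(2)])+
  have B0: "B x = 0" if x: "x \<noteq> 0" for x
  proof -
    have "B y $ i = 0" if y: "y \<in> off_axis" for i y
    proof -
      have "polar_hom 2 k y = 0" using k0[OF cos_polar_off_axis[OF y]] by (simp add: polar_hom_def)
      then have "B y $ 1 = 0" "B y $ 2 = 0" "B y $ 3 = 0" using B_rep[OF y] by simp_all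
      then show ?thesis using exhaust_3[of i] by auto
    qed
    then have "B x $ i = 0" for i
      using off_axis_dense[OF cB[of i], of "\<lambda>_. 0" x] x by simp
    then show ?thesis by (simp add: vec_eq_iff)
  qed
  have g0: "polar_hom 2 g x = 0" if "x \<in> off_axis" for x
    using swirl_vanishes[OF cos_polar_off_axis[OF that]] by (simp add: polar_hom_def)
  have classes: "(\<forall>s\<in>{-1<..<1}. a s = 0 \<and> b s = 0) \<or>
      (\<exists>c. \<bar>c\<bar> > 1 \<and> (\<forall>s\<in>{-1<..<1}. a s = Landau_alpha c s \<and> b s = Landau_beta c s \<and> q s = 2 * Landau_alpha c s))"
    by (rule coeff_classification) (rule k0)
  have "Landau_solution u \<or> (\<forall>x. x \<noteq> 0 \<longrightarrow> u x = 0)"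
    using classes
  proof (elim disjE exE conjE)
    assume ab: "\<forall>s\<in>{-1<..<1}. a s = 0 \<and> b s = 0"
    have "u y $ i = 0" if y: "y \<in> off_axis" for i y
    proof -
      have "polar_hom 2 a y = 0" "polar_hom 1 b y = 0"
        using ab cos_polar_off_axis[OF y] by (simp_all add: polar_hom_def)
      then have "u y $ 1 = 0" "u y $ 2 = 0" "u y $ 3 = 0" using u_rep[OF y] g0[OF y] by simp_all
      then show ?thesis using exhaust_3[of i] by auto
    qed
    then have "u x $ i = 0" if "x \<noteq> 0" for x i
      using off_axis_dense[OF cu[of i], of "\<lambda>_. 0" x] that by simp
    then show ?thesis by (simp add: vec_eq_iff)
  next
    fix c assume c: "\<bar>c\<bar> > 1"
      and ab: "\<forall>s\<in>{-1<..<1}. a s = Landau_alpha c s \<and> b s = Landau_beta c s \<and> q s = 2 * Landau_alpha c s"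
    \<comment> \<open>Once \<open>B\<close> vanishes, so does its tension \<open>advect B B\<close>,
      and \<open>u\<close> with \<open>p\<close> solves the Navier-Stokes equations off the
      origin.\<close>
    interpret NS: homogeneous_NS u p
    proof
      show "smooth_on (- {0}) u" "smooth_on (- {0}) p" by (rule smooth)+
      show "neg_homogeneous 1 u" "neg_homogeneous 2 p" by (rule homogeneous)+
      fix x :: "real^3" assume x: "x \<noteq> 0"
      have "- laplacian u x + advect u u x - advect B B x + gradient p x = 0" "divergence u x = 0"
        using sol x unfolding smooth_MHD_solution_def by blast+
      moreover have "advect B B x = 0" by (simp add: advect_def B0[OF x])
      ultimately show "- laplacian u x + advect u u x + gradient p x = 0" "divergence u x = 0" by simp_all
    qed
    have ne: "c \<noteq> cos_polar x" for x using c abs_cos_polar_le[of x] by auto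
    have cont: "continuous_on (- {0}) (\<lambda>x. Landau_alpha c (cos_polar x))" "continuous_on (- {0}) (\<lambda>x. Landau_beta c (cos_polar x))"
      unfolding Landau_alpha_def Landau_beta_def using ne by (auto intro!: continuous_intros)
    have "NS.force \<noteq> 0"
    proof (rule NS.Landau_force_nonzero[OF c])
      show "u x $ i = Landau_alpha c (cos_polar x) / (norm x)\<^sup>2 * x $ i
          + Landau_beta c (cos_polar x) / norm x * (if i = 3 then 1 else 0)" if "x \<noteq> 0" for x i
      proof (rule off_axis_dense[OF cu _ _ that])
        show "continuous_on (- {0}) (\<lambda>x. Landau_alpha c (cos_polar x) / (norm x)\<^sup>2 * x $ i
          + Landau_beta c (cos_polar x) / norm x * (if i = 3 then 1 else 0))"
          by (intro continuous_intros cont) auto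
        fix y assume y: "y \<in> off_axis"
        have "polar_hom 2 a y = Landau_alpha c (cos_polar y) / (norm y)\<^sup>2" "polar_hom 1 b y = Landau_beta c (cos_polar y) / norm y"
          using ab cos_polar_off_axis[OF y] by (simp_all add: polar_hom_def)
        then have "u y $ 1 = Landau_alpha c (cos_polar y) / (norm y)\<^sup>2 * y $ 1"
          "u y $ 2 = Landau_alpha c (cos_polar y) / (norm y)\<^sup>2 * y $ 2"
          "u y $ 3 = Landau_alpha c (cos_polar y) / (norm y)\<^sup>2 * y $ 3 + Landau_beta c (cos_polar y) / norm y"
          using u_rep[OF y] g0[OF y] by simp_all
        then show "u y $ i = Landau_alpha c (cos_polar y) / (norm y)\<^sup>2 * y $ i
          + Landau_beta c (cos_polar y) / norm y * (if i = 3 then 1 else 0)"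
          using exhaust_3[of i] by auto
      qed
      show "p x = 2 * Landau_alpha c (cos_polar x) / (norm x)\<^sup>2" if "x \<noteq> 0" for x
      proof (rule off_axis_dense[OF smooth_on_continuous[OF smooth(3)] _ _ that])
        show "continuous_on (- {0}) (\<lambda>x. 2 * Landau_alpha c (cos_polar x) / (norm x)\<^sup>2)"
          by (intro continuous_intros cont) auto
        show "p y = 2 * Landau_alpha c (cos_polar y) / (norm y)\<^sup>2" if y: "y \<in> off_axis" for y
          using p_rep[OF y] ab cos_polar_off_axis[OF y] by (simp add: polar_hom_def)
      qed
    qed
    then show ?thesis using NS.Landau_field_force unfolding Landau_solution_def by blast
  qed
  with B0 show ?thesis by blast
qed

end

theorem theorem1p2:
  fixes u B :: "real^3 \<Rightarrow> real^3" and p :: "real^3 \<Rightarrow> real"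
    and ur ut uz Bt :: "real \<Rightarrow> real \<Rightarrow> real"
  assumes "smooth_MHD_solution u B p"
    and "self_similar u B p"
    and "axisymmetric_form u ur ut uz"
    and "axisymmetric_form B (\<lambda>r z. 0) Bt (\<lambda>r z. 0)"
    and "\<And>r z. r > 0 \<Longrightarrow> r\<^sup>2 + z\<^sup>2 = 1 \<Longrightarrow> ur r z < 1 / (3 * r) + 2 * r / 3"
  shows "(Landau_solution u \<or> (\<forall>x. x \<noteq> 0 \<longrightarrow> u x = 0)) \<and> (\<forall>x. x \<noteq> 0 \<longrightarrow> B x = 0)"
proof -
  interpret axisymmetric_MHD u B p ur ut uz Bt
    using assms(1-4) by unfold_locales
  show ?thesis using assms(5) by (rule rigidity)
qed

end
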